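(* Let $r\geq 3$, $k\geq 1$ and $\ell_1,\dots,\ell_k\geq 5$ be integers, let $s\geq r$ be an integer, and let $t=\sum_{i=1}^k\lfloor\frac{\ell_i+1}{2}\rfloor-1$. For each $i\in[k]$ let $Q_i\in\{P_{\ell_i}^r,C_{\ell_i}^r\}$ (chosen independently). Let $n\to\infty$. (i) If $s\leq t+r-1$, then $$\mathrm{ex}_r(n,K_s^{(r)},Q_1\cup\cdots\cup Q_k)=(1+o(1))\,\mathcal{N}(K_s^{(r)},S_{n,t}^r)=\binom{t}{s-r+1}\frac{n^{r-1}}{(r-1)!}+o(n^{r-1}).$$ (ii) If $s\geq t+r$, then $\mathrm{ex}_r(n,K_s^{(r)},Q_1\cup\cdots\cup Q_k)=o(n^{r-1})$.
   Context: An $r$-graph is a hypergraph all of whose hyperedges have exactly $r$ vertices. $K_s^{(r)}$ is the complete $r$-graph on $s$ vertices. $P_\ell$ and $C_\ell$ are the path and cycle with $\ell$ edges. For a graph $F$, the $r$-expansion $F^r$ is obtained from $F$ by adding $r-2$ new vertices to each edge, all new vertices distinct from each other and from $V(F)$. $\cup$ denotes vertex-disjoint union. $S_{n,t}^r$ is the $n$-vertex $r$-graph whose hyperedges are all $r$-sets intersecting a fixed set of $t$ vertices. $\mathcal{N}(\mathcal{G}_1,\mathcal{G}_2)$ is the number of copies of $\mathcal{G}_1$ in $\mathcal{G}_2$. $\mathrm{ex}_r(n,\mathcal{H},\mathcal{F})$ is the maximum number of copies of $\mathcal{H}$ in an $n$-vertex $r$-graph containing no copy of $\mathcal{F}$.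 *)

theory Defs
  imports "HOL-Library.Landau_Symbols"
begin

type_synonym 'a hypergraph = "'a set \<times> 'a set set"

abbreviation hverts :: "'a hypergraph \<Rightarrow> 'a set" where
  "hverts \<equiv> fst"

abbreviation hedges :: "'a hypergraph \<Rightarrow> 'a set set" where
  "hedges \<equiv> snd"

definition r_graph :: "nat \<Rightarrow> 'a hypergraph \<Rightarrow> bool" where
  "r_graph r G \<longleftrightarrow> finite (hverts G) \<and> (\<forall>e\<in>hedges G. e \<subseteq> hverts G \<and> card e = r)"

definition hyper_iso :: "'a hypergraph \<Rightarrow> 'b hypergraph \<Rightarrow> bool" where
  "hyper_iso G H \<longleftrightarrow>
     (\<exists>f. bij_betw f (hverts G) (hverts H) \<and> hedges H = (\<lambda>e. f ` e) ` hedges G)"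

text \<open>Copies are not necessarily induced subhypergraphs, and they are counted as
  subhypergraphs (unlabelled), not as embeddings.\<close>

definition copies :: "'a hypergraph \<Rightarrow> 'b hypergraph \<Rightarrow> 'b hypergraph set" where
  "copies H G = {G'. hverts G' \<subseteq> hverts G \<and> hedges G' \<subseteq> hedges G \<and> hyper_iso H G'}"

definition num_copies :: "'a hypergraph \<Rightarrow> 'b hypergraph \<Rightarrow> nat" where
  "num_copies H G = card (copies H G)"

text \<open>Vertices of host hypergraphs are taken from \<^typ>\<open>nat\<close>; up to isomorphism this
  covers all finite hypergraphs.\<close>

definition ex_copies :: "nat \<Rightarrow> nat \<Rightarrow> 'a hypergraph \<Rightarrow> 'b hypergraph \<Rightarrow> nat" where
  "ex_copies r n H F =
     Max {num_copies H G | G :: nat hypergraph.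
            r_graph r G \<and> card (hverts G) = n \<and> copies F G = {}}"

definition complete_r_graph :: "nat \<Rightarrow> nat \<Rightarrow> nat hypergraph" where
  "complete_r_graph r s = ({..<s}, {e. e \<subseteq> {..<s} \<and> card e = r})"

text \<open>For \<^term>\<open>t \<le> n\<close>, the \<^term>\<open>t\<close> distinguished vertices are \<^term>\<open>{..<t}\<close>.\<close>

definition star_r_graph :: "nat \<Rightarrow> nat \<Rightarrow> nat \<Rightarrow> nat hypergraph" where
  "star_r_graph r n t = ({..<n}, {e. e \<subseteq> {..<n} \<and> card e = r \<and> e \<inter> {..<t} \<noteq> {}})"

text \<open>In both cases the parameter is the number of edges. The definition of
  \<open>cycle_graph\<close> is meaningful for \<^term>\<open>l \<ge> 3\<close>.\<close>

definition path_graph :: "nat \<Rightarrow> nat hypergraph" where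
  "path_graph l = ({..l}, {{i, i + 1} | i. i < l})"

definition cycle_graph :: "nat \<Rightarrow> nat hypergraph" where
  "cycle_graph l = ({..<l}, {{i, (i + 1) mod l} | i. i < l})"

text \<open>\<^term>\<open>Inr (e, j)\<close> with \<^term>\<open>j < r - 2\<close> are the new vertices added to the edge
  \<^term>\<open>e\<close>; intended for 2-graphs \<^term>\<open>F\<close> and \<^term>\<open>r \<ge> 2\<close>.\<close>

definition expansion :: "nat \<Rightarrow> 'a hypergraph \<Rightarrow> ('a + 'a set \<times> nat) hypergraph" where
  "expansion r F =
     (Inl ` hverts F \<union> Inr ` (hedges F \<times> {..<r - 2}),
      (\<lambda>e. Inl ` e \<union> Inr ` ({e} \<times> {..<r - 2})) ` hedges F)"

definition disjoint_union :: "'i set \<Rightarrow> ('i \<Rightarrow> 'a hypergraph) \<Rightarrow> ('i \<times> 'a) hypergraph" where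
  "disjoint_union I Q =
     (SIGMA i:I. hverts (Q i), \<Union>i\<in>I. (\<lambda>e. Pair i ` e) ` hedges (Q i))"

end

theory Submission imports Defs "HOL-Library.Disjoint_Sets" begin

text \<open>
  Upper bound. Deleting hyperedges through \<open>(r - 1)\<close>-sets of small codegree either ends with a hypergraph
  all of whose codegrees are zero or large, in which the components are found greedily, or it
  charges every copy of the clique to a deleted \<open>(r - 1)\<close>-set. The sets of codegree at most \<open>t\<close> receive at most
  \<open>t choose (s - r + 1)\<close> cliques each, which is the main term, so it remains to see that only \<open>o(n\<^sup>r\<^sup>-\<^sup>1)\<close> sets
  have a bounded codegree exceeding \<open>t\<close> when they are deleted. If there were more, then a dense family of
  \<open>(r - 1)\<close>-sets would carry \<open>t + 1\<close> labels each, a label being a vertex that completes the set to a hyperedge.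
  Such a family contains a large complete bipartite grid whose cells \<open>{a, b} \<union> Z a b\<close> belong to the
  family, and by repeated use of sunflowers the labels may be assumed to be canonical: common to all
  cells, depending on the row only, depending on the column only, or private to the cell. With at least \<open>t\<close>
  common labels, these labels cover the components, as the sum of the numbers \<open>(l i + 1) div 2\<close> is \<open>t + 1\<close>.
  Otherwise there are enough labels that vary to run the components along paths of cells,
  taking a new label in each cell.

  Lower bound. In a component a vertex lies in at most two hyperedges, so \<open>t\<close> vertices
  cannot cover all components and the star on \<open>t\<close> vertices contains no copy.
\<close>

section \<open>Embedding expansions of paths and cycles\<close>

text \<open>The obstacle is parity. A path of cells that leads from the row \<open>a0\<close> to the
  column \<open>b0\<close> and turns at every step has an odd number of cells, so the cell at
  (\<open>a0\<close>, \<open>b0\<close>) closes it to an even cycle; an odd cycle needs two closing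
  hyperedges that meet in one vertex off the path. If labels vary by rows or columns only, or if r =
  3, the codegrees t + 1 provide them: in a cell the row or column vertex is exchanged for another
  neighbour. The exchanged vertices must be distinct for distinct components, so they are fixed and
  reserved before any path is built. If r \<ge> 4 and every cell has a private label, two exchanges
  in one cell would leave too large an intersection; then a third class of grid vertices is used,
  and two cells (a, z), (b, z) meet in z only. The bound l i \<ge> 5 makes every component
  contribute at least 3 to t + 1, so t is large enough for all exchanges. All thresholds are
  independent of n: an exceptional deleted set costs boundedly many cliques, and
  o(\<open>n ^ (r - 1)\<close>) such sets are harmless.\<close>

definition embeds :: "'b hypergraph \<Rightarrow> 'a set set \<Rightarrow> 'a set \<Rightarrow> bool" where
  "embeds Q H S \<longleftrightarrow>
     (\<exists>g. inj_on g (hverts Q) \<and> g ` hverts Q \<subseteq> S \<and> (\<forall>e\<in>hedges Q. g ` e \<in> H))"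

definition lin_path :: "(nat \<Rightarrow> 'a set) \<Rightarrow> nat \<Rightarrow> bool" where
  "lin_path e l \<longleftrightarrow>
     (\<forall>i j. i < j \<longrightarrow> j < l \<longrightarrow>
        (if j = Suc i then is_singleton (e i \<inter> e j) else e i \<inter> e j = {}))"

text \<open>Only pairs are constrained. For \<open>l = 3\<close> this also admits three hyperedges
  through one common vertex, so cycles are used from length 4 on.\<close>

definition lin_cycle :: "(nat \<Rightarrow> 'a set) \<Rightarrow> nat \<Rightarrow> bool" where
  "lin_cycle e l \<longleftrightarrow>
     (\<forall>i j. i < j \<longrightarrow> j < l \<longrightarrow>
        (if j = Suc i \<or> i = 0 \<and> Suc j = l then is_singleton (e i \<inter> e j) else e i \<inter> e j = {}))"

lemma copies_nonempty:
  assumes "embeds Q (hedges G) S" "S \<subseteq> hverts G"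
  shows "copies Q G \<noteq> {}"
proof -
  obtain g where g: "inj_on g (hverts Q)" "g ` hverts Q \<subseteq> S" "\<forall>e\<in>hedges Q. g ` e \<in> hedges G"
    using assms(1) unfolding embeds_def by blast
  have "(g ` hverts Q, (\<lambda>e. g ` e) ` hedges Q) \<in> copies Q G"
    using g assms(2) by (auto simp: copies_def hyper_iso_def bij_betw_def)
  then show ?thesis by blast
qed

lemma embeds_disjoint_union:
  assumes "\<And>i. i \<in> I \<Longrightarrow> embeds (Q i) H (S i)" "disjoint_family_on S I"
  shows "embeds (disjoint_union I Q) H (\<Union>i\<in>I. S i)"
proof -
  obtain g where g: "\<And>i. i \<in> I \<Longrightarrow> inj_on (g i) (hverts (Q i)) \<and> g i ` hverts (Q i) \<subseteq> S i
      \<and> (\<forall>e\<in>hedges (Q i). g i ` e \<in> H)"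
    using assms(1) unfolding embeds_def by metis
  let ?g = "\<lambda>(i, x). g i x"
  have "inj_on ?g (SIGMA i:I. hverts (Q i))"
  proof (rule inj_onI, clarsimp)
    fix i x j y
    assume A: "i \<in> I" "x \<in> hverts (Q i)" "j \<in> I" "y \<in> hverts (Q j)" "g i x = g j y"
    have "g i x \<in> S i" "g j y \<in> S j" using g A by blast+
    then have "i = j" using assms(2) A by (auto simp: disjoint_family_on_def)
    then show "i = j \<and> x = y" using g A by (auto dest: inj_onD)
  qed
  moreover have "?g ` (SIGMA i:I. hverts (Q i)) \<subseteq> (\<Union>i\<in>I. S i)" using g by fastforce
  moreover have "?g ` Pair i ` e = g i ` e" for i e by force
  ultimately show ?thesis
    unfolding embeds_def disjoint_union_def using g by (intro exI[of _ ?g]) auto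
qed

text \<open>\<open>v\<close> places the vertices of \<open>F\<close>, and the rest of each
  \<open>S d\<close> is filled bijectively with the new vertices of the edge \<open>d\<close>. By
  \<open>inter\<close> and \<open>mem\<close> the fillings of different edges are disjoint and miss
  the image of \<open>v\<close>, so the pieces form one injection.\<close>

lemma embeds_expansion:
  fixes F :: "'v hypergraph" and H :: "'a set set"
  assumes v: "inj_on v (hverts F)"
    and F: "\<And>d. d \<in> hedges F \<Longrightarrow> d \<subseteq> hverts F \<and> card d = 2"
    and S: "\<And>d. d \<in> hedges F \<Longrightarrow> S d \<in> H \<and> finite (S d) \<and> card (S d) = r"
    and sub: "\<And>d. d \<in> hedges F \<Longrightarrow> v ` d \<subseteq> S d"
    and inter: "\<And>d d'. d \<in> hedges F \<Longrightarrow> d' \<in> hedges F \<Longrightarrow> d \<noteq> d' \<Longrightarrow> S d \<inter> S d' \<subseteq> v ` hverts F"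
    and mem: "\<And>x d. x \<in> hverts F \<Longrightarrow> d \<in> hedges F \<Longrightarrow> v x \<in> S d \<Longrightarrow> x \<in> d"
    and cov: "\<And>x. x \<in> hverts F \<Longrightarrow> \<exists>d\<in>hedges F. x \<in> d"
  shows "embeds (expansion r F) H (\<Union>d\<in>hedges F. S d)"
proof -
  have "\<exists>b. bij_betw b {..<r - 2} (S d - v ` d)" if "d \<in> hedges F" for d
  proof (rule finite_same_card_bij)
    have "inj_on v d" using F[OF that] v by (meson inj_on_subset)
    then show "card {..<r - 2} = card (S d - v ` d)"
      using S[OF that] F[OF that] sub[OF that]
      by (simp add: card_Diff_subset finite_subset card_image)
  qed (use S[OF that] in auto)
  then obtain b where b: "\<And>d. d \<in> hedges F \<Longrightarrow> bij_betw (b d) {..<r - 2} (S d - v ` d)"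
    by metis
  let ?g = "\<lambda>z. case z of Inl x \<Rightarrow> v x | Inr (d, j) \<Rightarrow> b d j"
  have bin: "b d j \<in> S d - v ` hverts F" if "d \<in> hedges F" "j < r - 2" for d j
  proof -
    have "b d j \<in> S d - v ` d" using b[OF that(1)] that(2) by (auto simp: bij_betw_def)
    then show ?thesis using mem[OF _ that(1)] by auto
  qed
  have inj: "inj_on ?g (hverts (expansion r F))"
  proof (rule inj_onI)
    fix y z assume A: "y \<in> hverts (expansion r F)" "z \<in> hverts (expansion r F)" "?g y = ?g z"
    show "y = z"
    proof (cases y; cases z)
      fix x x' assume "y = Inl x" "z = Inl x'"
      then show ?thesis using A v by (auto simp: expansion_def inj_on_def)
    next
      fix x p assume yz: "y = Inl x" "z = Inr p"
      obtain d j where p: "p = (d, j)" by (cases p)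
      have "d \<in> hedges F" "j < r - 2" "x \<in> hverts F" "v x = b d j"
        using A yz p by (auto simp: expansion_def)
      then show ?thesis using bin[of d j] by (metis DiffD2 imageI)
    next
      fix x p assume yz: "y = Inr p" "z = Inl x"
      obtain d j where p: "p = (d, j)" by (cases p)
      have "d \<in> hedges F" "j < r - 2" "x \<in> hverts F" "v x = b d j"
        using A yz p by (auto simp: expansion_def)
      then show ?thesis using bin[of d j] by (metis DiffD2 imageI)
    next
      fix p p' assume e: "y = Inr p" "z = Inr p'"
      obtain d j d' j' where p: "p = (d, j)" "p' = (d', j')" by (cases p, cases p')
      have h: "d \<in> hedges F" "j < r - 2" "d' \<in> hedges F" "j' < r - 2" "b d j = b d' j'"
        using A e p by (auto simp: expansion_def)
      have "d = d'"
      proof (rule ccontr)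
        assume "d \<noteq> d'"
        then have "b d j \<in> v ` hverts F" using bin[OF h(1,2)] bin[OF h(3,4)] h inter[of d d'] by auto
        then show False using bin[OF h(1,2)] by simp
      qed
      then show ?thesis using h b[OF h(1)] e p by (auto simp: bij_betw_def inj_on_def)
    qed
  qed
  have im: "?g ` (Inl ` d \<union> Inr ` ({d} \<times> {..<r - 2})) = S d" if "d \<in> hedges F" for d
  proof -
    have "?g ` (Inl ` d \<union> Inr ` ({d} \<times> {..<r - 2})) = v ` d \<union> b d ` {..<r - 2}"
      by (simp only: image_Un image_image sum.case) (auto simp: image_iff)
    also have "\<dots> = S d" using b[OF that] sub[OF that] by (auto simp: bij_betw_def)
    finally show ?thesis .
  qed
  have "?g ` hverts (expansion r F) \<subseteq> (\<Union>d\<in>hedges F. S d)"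
  proof -
    have "v x \<in> (\<Union>d\<in>hedges F. S d)" if "x \<in> hverts F" for x
      using cov[OF that] sub by blast
    then show ?thesis using bin by (auto simp: expansion_def)
  qed
  moreover have "\<forall>e\<in>hedges (expansion r F). ?g ` e \<in> H"
    unfolding expansion_def snd_conv ball_simps(9) by (intro ballI, subst im) (use S in auto)
  ultimately show ?thesis unfolding embeds_def using inj by blast
qed

lemma cycle_graph_edge_inj:
  assumes "(l::nat) \<ge> 3" shows "inj_on (\<lambda>i. {i, (i + 1) mod l}) {..<l}"
proof (rule inj_onI)
  fix i j assume A: "i \<in> {..<l}" "j \<in> {..<l}" "{i, (i + 1) mod l} = {j, (j + 1) mod l}"
  show "i = j"
    using A assms by (auto simp: doubleton_eq_iff mod_Suc split: if_splits)
qed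

lemma embeds_cycle:
  assumes l: "l \<ge> 4" and e: "\<And>i. i < l \<Longrightarrow> e i \<in> H \<and> finite (e i) \<and> card (e i) = r"
    and lin: "lin_cycle e l"
  shows "embeds (expansion r (cycle_graph l)) H (\<Union>i<l. e i)"
proof -
  \<comment> \<open>Cyclic predecessor. The vertex \<open>i\<close> of the cycle goes to the vertex
    shared by \<open>e (prv i)\<close> and \<open>e i\<close>, so that the edge from
    \<open>i\<close> to its successor corresponds to \<open>e i\<close>.\<close>
  define prv where "prv i = (if i = 0 then l - 1 else i - 1)" for i
  have adj: "is_singleton (e (prv i) \<inter> e i)" if "i < l" for i
  proof (cases "i = 0")
    case True
    have "(0::nat) < l - 1" "l - 1 < l" "Suc (l - 1) = l" using l by auto
    then have "is_singleton (e 0 \<inter> e (l - 1))" using lin unfolding lin_cycle_def by metis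
    then show ?thesis by (simp add: prv_def True Int_commute)
  next
    case False
    then have "i - 1 < i" "i = Suc (i - 1)" by auto
    then have "is_singleton (e (i - 1) \<inter> e i)" using lin that unfolding lin_cycle_def by metis
    then show ?thesis by (simp add: prv_def False)
  qed
  define v where "v i = the_elem (e (prv i) \<inter> e i)" for i
  have v: "e (prv i) \<inter> e i = {v i}" if "i < l" for i
    using adj[OF that] by (simp add: v_def is_singleton_the_elem)
  have nadj: "e i \<inter> e j = {}" if "i < l" "j < l" "i \<noteq> j" "i \<noteq> prv j" "j \<noteq> prv i" for i j
  proof -
    from \<open>i \<noteq> j\<close> consider "i < j" | "j < i" by linarith
    then show ?thesis
    proof cases
      case 1
      have "\<not> (j = Suc i \<or> i = 0 \<and> Suc j = l)" using that 1 by (auto simp: prv_def)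
      then show ?thesis using lin that 1 unfolding lin_cycle_def by metis
    next
      case 2
      have "\<not> (i = Suc j \<or> j = 0 \<and> Suc i = l)" using that 2 by (auto simp: prv_def)
      then have "e j \<inter> e i = {}" using lin that 2 unfolding lin_cycle_def by metis
      then show ?thesis by blast
    qed
  qed
  have prvl: "prv i < l" if "i < l" for i using that by (auto simp: prv_def)
  \<comment> \<open>A third hyperedge through \<open>v i\<close> would be cyclically adjacent to
    both \<open>e i\<close> and \<open>e (prv i)\<close>, which happens only in a cycle of length 3;
    here \<open>l \<ge> 4\<close> is used.\<close>
  have mem: "j = i \<or> j = prv i" if "i < l" "j < l" "v i \<in> e j" for i j
  proof (rule ccontr)
    assume n: "\<not> ?thesis"
    have "v i \<in> e i" "v i \<in> e (prv i)" using v[OF that(1)] by auto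
    then have "e i \<inter> e j \<noteq> {}" "e (prv i) \<inter> e j \<noteq> {}" using that by auto
    then have "i = prv j" "prv i = prv j \<or> j = prv (prv i)"
      using nadj[of i j] nadj[of "prv i" j] n that prvl by metis+
    then show False using that l n by (auto simp: prv_def split: if_splits)
  qed
  let ?d = "\<lambda>i. {i, (i + 1) mod l}"
  have inj: "inj_on ?d {..<l}" using cycle_graph_edge_inj l by auto
  have ed: "hedges (cycle_graph l) = ?d ` {..<l}" "hverts (cycle_graph l) = {..<l}"
    by (auto simp: cycle_graph_def)
  \<comment> \<open>\<open>embeds_expansion\<close> indexes hyperedges by the edges of the graph,
    hence the inverse of the edge numbering.\<close>
  define S where "S d = e (inv_into {..<l} ?d d)" for d
  have S: "S (?d i) = e i" if "i < l" for i unfolding S_def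
    by (subst inv_into_f_f[OF inj]) (use that in auto)
  have prv_iff: "j = i \<or> j = prv i \<longleftrightarrow> i \<in> ?d j" if "i < l" "j < l" for i j
    using that l by (auto simp: prv_def mod_Suc split: if_splits)
  have vmem: "v i \<in> e j \<longleftrightarrow> i \<in> ?d j" if "i < l" "j < l" for i j
    unfolding prv_iff[OF that, symmetric] using mem[OF that] v[OF that(1)] by auto
  have "embeds (expansion r (cycle_graph l)) H (\<Union>d\<in>hedges (cycle_graph l). S d)"
  proof (rule embeds_expansion[where v = v])
    show "inj_on v (hverts (cycle_graph l))"
    proof (rule inj_onI)
      fix i j assume "i \<in> hverts (cycle_graph l)" "j \<in> hverts (cycle_graph l)" and eq: "v i = v j"
      then have ij: "i < l" "j < l" by (auto simp: ed)
      have "v i \<in> e i" "v i \<in> e (prv i)" using v[OF ij(1)] by auto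
      then have "i = j \<or> i = prv j" "prv i = j \<or> prv i = prv j"
        using mem[OF ij(2), of i] mem[OF ij(2), of "prv i"] eq ij prvl by auto
      then show "i = j" using ij l by (auto simp: prv_def split: if_splits)
    qed
  next
    fix d assume "d \<in> hedges (cycle_graph l)"
    then obtain i where i: "i < l" "d = ?d i" by (auto simp: ed)
    show "d \<subseteq> hverts (cycle_graph l) \<and> card d = 2"
      using i l by (auto simp: ed mod_Suc)
    show "S d \<in> H \<and> finite (S d) \<and> card (S d) = r" using e S i by simp
    have "(i + 1) mod l < l" using l by simp
    then show "v ` d \<subseteq> S d" using i S vmem[of i i] vmem[of "(i + 1) mod l" i] by simp
  next
    fix d d' assume "d \<in> hedges (cycle_graph l)" "d' \<in> hedges (cycle_graph l)" "d \<noteq> d'"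
    then obtain i j where i: "i < l" "d = ?d i" "j < l" "d' = ?d j" "i \<noteq> j" by (auto simp: ed)
    have "e i \<inter> e j \<subseteq> {v i, v j}"
    proof (cases "i = prv j \<or> j = prv i")
      case True
      then show ?thesis using v[of i] v[of j] i by auto
    next
      case False
      then show ?thesis using nadj[of i j] i by auto
    qed
    then have "e i \<inter> e j \<subseteq> v ` {..<l}" using i by auto
    then show "S d \<inter> S d' \<subseteq> v ` hverts (cycle_graph l)" using i S ed by simp
  next
    fix x d assume "x \<in> hverts (cycle_graph l)" "d \<in> hedges (cycle_graph l)" "v x \<in> S d"
    then show "x \<in> d" using S vmem by (auto simp: ed)
  next
    fix x assume "x \<in> hverts (cycle_graph l)"
    then show "\<exists>d\<in>hedges (cycle_graph l). x \<in> d" by (auto simp: ed)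
  qed
  moreover have "(\<Union>d\<in>hedges (cycle_graph l). S d) = (\<Union>i<l. e i)"
    using S by (simp add: ed(1))
  ultimately show ?thesis by simp
qed

lemma embeds_path:
  assumes l: "l \<ge> 2" and r: "r \<ge> 2"
    and e: "\<And>i. i < l \<Longrightarrow> e i \<in> H \<and> finite (e i) \<and> card (e i) = r"
    and lin: "lin_path e l"
  shows "embeds (expansion r (path_graph l)) H (\<Union>i<l. e i)"
proof -
  have adj: "is_singleton (e i \<inter> e (Suc i))" if "Suc i < l" for i
    using lin that unfolding lin_path_def by auto
  have nadj: "e i \<inter> e j = {}" if "i < l" "j < l" "i \<noteq> j" "i \<noteq> Suc j" "j \<noteq> Suc i" for i j
  proof (cases "i < j")
    case True
    then show ?thesis using lin that unfolding lin_path_def by auto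
  next
    case False
    then have "j < i" using that by simp
    then have "e j \<inter> e i = {}" using lin that unfolding lin_path_def by auto
    then show ?thesis by blast
  qed
  have ex: "\<exists>x. x \<in> e i \<and> x \<notin> e j" if "is_singleton (e i \<inter> e j)" "i < l" for i j
  proof (rule ccontr)
    assume "\<not> ?thesis"
    then have "e i \<inter> e j = e i" by blast
    then have "card (e i) = 1" using that(1) by (metis is_singleton_altdef)
    then show False using e[OF that(2)] r by simp
  qed
  obtain x0 where x0: "x0 \<in> e 0" "x0 \<notin> e 1" using ex[of 0 1] adj[of 0] l by auto
  have "is_singleton (e (l - 1) \<inter> e (l - 2))"
    using adj[of "l - 2"] l by (simp add: Int_commute Suc_diff_Suc numeral_2_eq_2)
  then obtain xl where xl: "xl \<in> e (l - 1)" "xl \<notin> e (l - 2)" using ex[of "l - 1" "l - 2"] l by auto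
  \<comment> \<open>The inner vertices are forced by the intersections. The two ends are vertices of
    the outer hyperedges that miss the adjacent hyperedge; they exist as
    \<open>r \<ge> 2\<close>.\<close>
  define v where "v i = (if i = 0 then x0 else if i = l then xl else the_elem (e (i - 1) \<inter> e i))" for i
  have v: "e (i - 1) \<inter> e i = {v i}" if "0 < i" "i < l" for i
    using adj[of "i - 1"] that by (simp add: v_def is_singleton_the_elem)
  have vmem: "v i \<in> e j \<longleftrightarrow> i \<in> {j, j + 1}" if "i \<le> l" "j < l" for i j
  proof -
    from \<open>i \<le> l\<close> consider "i = 0" | "i = l" | "0 < i" "i < l" by linarith
    then show ?thesis
    proof cases
      case 1
      have "x0 \<in> e j \<longleftrightarrow> j = 0" using x0 nadj[of 0 j] that l by (cases "j = 1") auto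
      then show ?thesis using 1 by (auto simp: v_def)
    next
      case 2
      have "j = l - 1 \<or> j = l - 2 \<or> l - 1 \<noteq> j \<and> l - 1 \<noteq> Suc j \<and> j \<noteq> Suc (l - 1)" using that l by linarith
      then have "xl \<in> e j \<longleftrightarrow> j = l - 1" using xl nadj[of "l - 1" j] that l by auto
      then show ?thesis using 2 l that by (auto simp: v_def)
    next
      case 3
      have a: "v i \<in> e (i - 1)" "v i \<in> e i" using v 3 by auto
      show ?thesis
      proof
        assume "v i \<in> e j"
        then have "e (i - 1) \<inter> e j \<noteq> {}" "e i \<inter> e j \<noteq> {}" using a by auto
        moreover have "i - 1 < l" using 3 by linarith
        ultimately have "i - 1 = j \<or> i - 1 = Suc j \<or> j = Suc (i - 1)"
          using nadj[of "i - 1" j] that(2) by argo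
        moreover have "i = j \<or> i = Suc j \<or> j = Suc i"
          using nadj[of i j] 3 that(2) \<open>e i \<inter> e j \<noteq> {}\<close> by argo
        ultimately show "i \<in> {j, j + 1}" using 3 by auto
      qed (use a in auto)
    qed
  qed
  let ?d = "\<lambda>i. {i, i + 1 :: nat}"
  have inj: "inj_on ?d {..<l}" by (auto simp: inj_on_def doubleton_eq_iff)
  have ed: "hedges (path_graph l) = ?d ` {..<l}" "hverts (path_graph l) = {..l}"
    by (auto simp: path_graph_def)
  define S where "S d = e (inv_into {..<l} ?d d)" for d
  have S: "S (?d i) = e i" if "i < l" for i unfolding S_def
    by (subst inv_into_f_f[OF inj]) (use that in auto)
  have "embeds (expansion r (path_graph l)) H (\<Union>d\<in>hedges (path_graph l). S d)"
  proof (rule embeds_expansion[where v = v])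
    show "inj_on v (hverts (path_graph l))"
    proof (rule inj_onI)
      fix i j assume "i \<in> hverts (path_graph l)" "j \<in> hverts (path_graph l)" and eq: "v i = v j"
      then have ij: "i \<le> l" "j \<le> l" by (auto simp: ed)
      have "v i \<noteq> v j" if "i < j" "j \<le> l" for i j
      proof
        assume eq: "v i = v j"
        have "j = i + 1" using vmem[of i i] vmem[of j i] that eq by auto
        moreover have "i = 0" using vmem[of i "i - 1"] vmem[of j "i - 1"] that eq by (cases i) auto
        ultimately show False using vmem[of 0 1] vmem[of 1 1] that eq l by auto
      qed
      then show "i = j" using eq ij by (metis linorder_neqE_nat)
    qed
  next
    fix d assume "d \<in> hedges (path_graph l)"
    then obtain i where i: "i < l" "d = ?d i" by (auto simp: ed)
    show "d \<subseteq> hverts (path_graph l) \<and> card d = 2"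
      using i l by (auto simp: ed)
    show "S d \<in> H \<and> finite (S d) \<and> card (S d) = r" using e S i by simp
    show "v ` d \<subseteq> S d" using i S vmem[of i i] vmem[of "i + 1" i] by simp
  next
    fix d d' assume "d \<in> hedges (path_graph l)" "d' \<in> hedges (path_graph l)" "d \<noteq> d'"
    then obtain i j where i: "i < l" "d = ?d i" "j < l" "d' = ?d j" "i \<noteq> j" by (auto simp: ed)
    have "e i \<inter> e j \<subseteq> v ` {..l}"
    proof (cases "j = Suc i \<or> i = Suc j")
      case True
      then have "e i \<inter> e j = v ` {i} \<or> e i \<inter> e j = v ` {j}"
      proof
        assume "j = Suc i"
        then show ?thesis using v[of j] i(3) by simp
      next
        assume "i = Suc j"
        then show ?thesis using v[of i] i(1) by (simp add: Int_commute)
      qed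
      moreover have "v ` {m} \<subseteq> v ` {..l}" if "m < l" for m using that by auto
      ultimately show ?thesis using i by metis
    next
      case False
      then show ?thesis using nadj[of i j] i by auto
    qed
    then show "S d \<inter> S d' \<subseteq> v ` hverts (path_graph l)" using i S ed by simp
  next
    fix x d assume A: "x \<in> hverts (path_graph l)" "d \<in> hedges (path_graph l)" "v x \<in> S d"
    then obtain i where "i < l" "d = ?d i" by (auto simp: ed)
    then show "x \<in> d" using A S vmem[of x i] by (simp add: ed)
  next
    fix x assume x: "x \<in> hverts (path_graph l)"
    show "\<exists>d\<in>hedges (path_graph l). x \<in> d"
    proof (cases "x = l")
      case True
      then have "x \<in> ?d (l - 1)" "l - 1 \<in> {..<l}" using l by auto
      then show ?thesis unfolding ed by blast
    next
      case False
      then have "x \<in> ?d x" "x \<in> {..<l}" using x by (auto simp: ed)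
      then show ?thesis unfolding ed by blast
    qed
  qed
  moreover have "(\<Union>d\<in>hedges (path_graph l). S d) = (\<Union>i<l. e i)"
    using S by (simp add: ed(1))
  ultimately show ?thesis by simp
qed

lemma lin_path_prefix: "lin_path e l \<Longrightarrow> l' \<le> l \<Longrightarrow> lin_path e l'"
  unfolding lin_path_def by (meson order_less_le_trans)

text \<open>Dropping the last hyperedge of a cycle drops the wrap-around pair; paths can thus be cut
  out of longer cycles.\<close>

lemma lin_cycle_imp_path: "lin_cycle e (Suc l) \<Longrightarrow> lin_path e l"
  unfolding lin_path_def lin_cycle_def by (fastforce dest: less_SucI)

text \<open>The components of a disjoint union are embedded one after the other; \<open>R i\<close> is the set of
  vertices reserved for the component \<open>i\<close>.\<close>

lemma disjoint_choice:
  fixes R :: "'i \<Rightarrow> 'a set"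
  assumes I: "finite I" and R: "disjoint_family_on R I"
    and Rc: "\<And>i. i \<in> I \<Longrightarrow> finite (R i) \<and> card (R i) \<le> \<rho>"
    and step: "\<And>i X. i \<in> I \<Longrightarrow> finite X \<Longrightarrow> card X \<le> card I * (s + \<rho>) \<Longrightarrow> X \<inter> R i = {} \<Longrightarrow>
        \<exists>S. P i S \<and> S \<inter> X = {} \<and> finite S \<and> card S \<le> s"
  shows "\<exists>S. (\<forall>i\<in>I. P i (S i)) \<and> disjoint_family_on S I"
proof -
  have "\<exists>S. (\<forall>i\<in>J. P i (S i) \<and> finite (S i) \<and> card (S i) \<le> s \<and> (\<forall>j\<in>I - {i}. S i \<inter> R j = {}))
      \<and> disjoint_family_on S J" if "J \<subseteq> I" for J
    using finite_subset[OF that I] that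
  proof (induction J rule: finite_induct)
    case empty
    then show ?case by (simp add: disjoint_family_on_def)
  next
    case (insert m J)
    then obtain S where S: "\<forall>i\<in>J. P i (S i) \<and> finite (S i) \<and> card (S i) \<le> s \<and> (\<forall>j\<in>I - {i}. S i \<inter> R j = {})"
      "disjoint_family_on S J" by blast
    \<comment> \<open>What component \<open>m\<close> must avoid: the sets already chosen and
      everything reserved for the other components. Its own reserved vertices are not included,
      since it will use them.\<close>
    let ?X = "(\<Union>j\<in>J. S j) \<union> (\<Union>j\<in>I - {m}. R j)"
    have "card ?X \<le> card (\<Union>j\<in>J. S j) + card (\<Union>j\<in>I - {m}. R j)" by (rule card_Un_le)
    also have "card (\<Union>j\<in>J. S j) \<le> (\<Sum>j\<in>J. card (S j))" using insert.hyps by (intro card_UN_le)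
    also have "\<dots> \<le> card J * s" using S(1) sum_bounded_above[of J "\<lambda>j. card (S j)" s] by simp
    also have "card (\<Union>j\<in>I - {m}. R j) \<le> (\<Sum>j\<in>I - {m}. card (R j))" using I by (intro card_UN_le) auto
    also have "\<dots> \<le> card (I - {m}) * \<rho>"
      using Rc sum_bounded_above[of "I - {m}" "\<lambda>j. card (R j)" \<rho>] by simp
    also have "card (I - {m}) * \<rho> \<le> card I * \<rho>" by (intro mult_right_mono card_mono I) auto
    also have "card J * s \<le> card I * s" using insert.prems I by (intro mult_right_mono card_mono) auto
    finally have c: "card ?X \<le> card I * (s + \<rho>)" by (simp add: algebra_simps)
    have "S j \<inter> R m = {}" if "j \<in> J" for j using S(1) insert that by auto
    moreover have "R j \<inter> R m = {}" if "j \<in> I - {m}" for j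
      using R insert that by (auto simp: disjoint_family_on_def)
    ultimately have "?X \<inter> R m = {}" by blast
    moreover have "finite ?X" using S(1) Rc insert.hyps I by auto
    ultimately obtain Sm where Sm: "P m Sm" "Sm \<inter> ?X = {}" "finite Sm" "card Sm \<le> s"
      using step[of m ?X] c insert.prems by auto
    have "disjoint_family_on (S(m := Sm)) (insert m J)"
      using S(2) Sm(2) insert.hyps by (auto simp: disjoint_family_on_def)
    moreover have "\<forall>i\<in>insert m J. P i ((S(m := Sm)) i) \<and> finite ((S(m := Sm)) i) \<and> card ((S(m := Sm)) i) \<le> s
        \<and> (\<forall>j\<in>I - {i}. (S(m := Sm)) i \<inter> R j = {})"
      using S(1) Sm insert.hyps by auto
    ultimately show ?case by blast
  qed
  from this[of I] show ?thesis by blast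
qed

section \<open>Codegrees and trimming\<close>

definition nbrs :: "'a set set \<Rightarrow> 'a set \<Rightarrow> 'a set" where
  "nbrs H g = {x. x \<notin> g \<and> insert x g \<in> H}"

text \<open>For an r-uniform \<open>H\<close>: every (r - 1)-set has codegree 0 or at least
  \<open>d\<close>. Such hypergraphs are known as d-full.\<close>

definition full :: "nat \<Rightarrow> 'a set set \<Rightarrow> bool" where
  "full d H \<longleftrightarrow> (\<forall>e\<in>H. \<forall>x\<in>e. d \<le> card (nbrs H (e - {x})))"

definition shadow :: "'a set set \<Rightarrow> 'a set set" where
  "shadow H = {e - {x} | e x. e \<in> H \<and> x \<in> e}"

definition cliques :: "nat \<Rightarrow> 'a set set \<Rightarrow> nat \<Rightarrow> 'a set set" where
  "cliques r H s = {S. card S = s \<and> (\<forall>e\<subseteq>S. card e = r \<longrightarrow> e \<in> H)}"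

definition uniform :: "nat \<Rightarrow> 'a set set \<Rightarrow> bool" where
  "uniform r H \<longleftrightarrow> finite H \<and> (\<forall>e\<in>H. finite e \<and> card e = r)"

lemma finite_nbrs: "uniform r H \<Longrightarrow> finite (nbrs H g)"
  by (rule finite_subset[of _ "\<Union>H"]) (auto simp: nbrs_def uniform_def)

lemma full_replace:
  assumes "full d H" "e \<in> H" "x \<in> e" "finite X" "card X < d"
  shows "\<exists>y. y \<notin> X \<and> y \<notin> e - {x} \<and> insert y (e - {x}) \<in> H"
proof -
  have "\<not> nbrs H (e - {x}) \<subseteq> X"
    using assms card_mono[of X "nbrs H (e - {x})"] unfolding full_def by force
  then show ?thesis by (auto simp: nbrs_def)
qed

text \<open>The vertices of \<open>e\<close> in \<open>X\<close> but outside \<open>K\<close> are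
  exchanged one at a time for vertices outside \<open>X\<close>; each exchange keeps
  \<open>K\<close> and lowers their number.\<close>

lemma full_avoid:
  assumes full: "full d H" and u: "uniform r H" and e: "e \<in> H" "K \<subseteq> e" and X: "finite X" "card X < d"
  shows "\<exists>e'\<in>H. K \<subseteq> e' \<and> e' \<inter> X \<subseteq> K"
  using e
proof (induction "card (e \<inter> X - K)" arbitrary: e rule: less_induct)
  case less
  show ?case
  proof (cases "e \<inter> X \<subseteq> K")
    case False
    then obtain x where x: "x \<in> e" "x \<in> X" "x \<notin> K" by blast
    obtain y where y: "y \<notin> X" "insert y (e - {x}) \<in> H"
      using full_replace[OF full less.prems(1) x(1) X] by blast
    have "insert y (e - {x}) \<inter> X - K = (e \<inter> X - K) - {x}" using y(1) by auto
    moreover have "card ((e \<inter> X - K) - {x}) < card (e \<inter> X - K)"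
      using X x by (intro card_Diff1_less) auto
    moreover have "K \<subseteq> insert y (e - {x})" using less.prems(2) x(3) by auto
    ultimately show ?thesis using y(2) by (intro less.hyps) auto
  qed (use less.prems in blast)
qed

text \<open>Two rounds. The first finds the vertices \<open>v i\<close> in which consecutive
  hyperedges shall meet, the second chooses hyperedges through consecutive pairs that meet nothing
  else. Besides \<open>X\<close> at most \<open>l\<close> vertices \<open>v i\<close> and
  \<open>l * r\<close> vertices of hyperedges are to be avoided, whence
  \<open>l * (r + 1)\<close>.\<close>

lemma full_contains_cycle:
  assumes full: "full d H" and u: "uniform r H" and ne: "H \<noteq> {}" and r: "r \<ge> 3"
    and X: "finite X" "card X + l * (r + 1) < d" and l: "l \<ge> 4"
  shows "\<exists>e. (\<forall>i<l. e i \<in> H \<and> e i \<inter> X = {}) \<and> lin_cycle e l"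
proof -
  \<comment> \<open>Cyclic successor; it depends on \<open>m\<close> because the cycle of vertices
    grows in the induction.\<close>
  define nx where "nx m i = (if Suc i = m then 0 else Suc i)" for m i :: nat
  have "\<exists>v. inj_on v {..<m} \<and> v ` {..<m} \<inter> X = {} \<and> (\<forall>i<m. \<exists>e\<in>H. {v i, v (nx m i)} \<subseteq> e)"
    if "3 \<le> m" "m \<le> l" for m
    using that
  proof (induction m rule: dec_induct)
    case base
    obtain e0 where "e0 \<in> H" using ne by blast
    then obtain e where e: "e \<in> H" "e \<inter> X = {}"
      using full_avoid[OF full u, of e0 "{}" X] X by auto
    \<comment> \<open>A single hyperedge serves all three pairs of the initial triangle.\<close>
    obtain T where "T \<subseteq> e" "card T = 3" using u e r
      by (metis obtain_subset_with_card_n uniform_def)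
    then obtain x y z where T: "{x, y, z} \<subseteq> e" "x \<noteq> y" "y \<noteq> z" "x \<noteq> z" by (metis card_3_iff)
    let ?v = "\<lambda>i::nat. if i = 0 then x else if i = 1 then y else z"
    have "inj_on ?v {..<3}" using T by (auto simp: inj_on_def)
    moreover have "?v i \<in> e" for i using T by auto
    ultimately show ?case using e by (intro exI[of _ ?v]) blast
  next
    case (step m)
    then obtain v where v: "inj_on v {..<m}" "v ` {..<m} \<inter> X = {}"
      "\<forall>i<m. \<exists>e\<in>H. {v i, v (nx m i)} \<subseteq> e" by auto
    have "nx m (m - 1) = 0" using step by (auto simp: nx_def)
    then obtain e where e: "e \<in> H" "{v (m - 1), v 0} \<subseteq> e"
      using v(3) step by (metis diff_less less_le_trans zero_less_numeral zero_less_one)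
    have "\<exists>x. x \<in> e - {v (m - 1), v 0}"
    proof (rule ccontr)
      assume "\<nexists>x. x \<in> e - {v (m - 1), v 0}"
      then have "e \<subseteq> {v (m - 1), v 0}" by blast
      then have "card e \<le> card {v (m - 1), v 0}" by (intro card_mono) auto
      also have "\<dots> \<le> 2" by (simp add: card_insert_if)
      finally show False using e(1) u r by (auto simp: uniform_def)
    qed
    then obtain x where x: "x \<in> e" "x \<noteq> v (m - 1)" "x \<noteq> v 0" by blast
    have "card (X \<union> v ` {..<m}) \<le> card X + m"
      by (metis card_Un_le card_image card_lessThan v(1))
    also have "m \<le> l * (r + 1)" using step by simp
    finally have "card (X \<union> v ` {..<m}) < d" using X by linarith
    \<comment> \<open>The closing pair is subdivided: the new hyperedge contains
      \<open>v (m - 1)\<close>, \<open>y\<close> and \<open>v 0\<close> and so serves both new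
      pairs. The vertex \<open>x\<close> given up for \<open>y\<close> exists because
      \<open>r \<ge> 3\<close>.\<close>
    then obtain y where y: "y \<notin> X \<union> v ` {..<m}" "insert y (e - {x}) \<in> H"
      using full_replace[OF full e(1) x(1), of "X \<union> v ` {..<m}"] X by blast
    let ?v = "v(m := y)"
    have "inj_on ?v {..<Suc m}" using v(1) y(1) by (auto simp: inj_on_def)
    moreover have "?v ` {..<Suc m} \<inter> X = {}"
    proof -
      have "?v ` {..<Suc m} = insert y (v ` {..<m})" by (auto simp: lessThan_Suc)
      then show ?thesis using v(2) y(1) by auto
    qed
    moreover have "\<exists>e\<in>H. {?v i, ?v (nx (Suc m) i)} \<subseteq> e" if "i < Suc m" for i
    proof (cases "i < m - 1")
      case True
      then have "nx m i = Suc i" "nx (Suc m) i = Suc i" "Suc i < m" "i < m" by (auto simp: nx_def)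
      then show ?thesis using v(3)[rule_format, of i] by simp
    next
      case False
      with \<open>i < Suc m\<close> consider "i = m - 1" | "i = m" by linarith
      then have "{?v i, ?v (nx (Suc m) i)} \<subseteq> insert y (e - {x})"
      proof cases
        case 1
        then have "nx (Suc m) i = m" "i \<noteq> m" using step by (auto simp: nx_def)
        then show ?thesis using 1 e x by auto
      next
        case 2
        then have "nx (Suc m) i = 0" "0 \<noteq> m" using step by (auto simp: nx_def)
        then show ?thesis using 2 e x by auto
      qed
      then show ?thesis using y(2) by blast
    qed
    ultimately show ?case by blast
  qed
  from this[of l] l obtain v where v: "inj_on v {..<l}" "v ` {..<l} \<inter> X = {}"
    "\<And>i. i < l \<Longrightarrow> \<exists>e\<in>H. {v i, v (nx l i)} \<subseteq> e" by auto
  \<comment> \<open>Second round: apart from its two prescribed vertices, hyperedge \<open>i\<close>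
    avoids \<open>X\<close>, all the \<open>v j\<close> and all earlier hyperedges.\<close>
  have "\<exists>e. \<forall>i<m. e i \<in> H \<and> {v i, v (nx l i)} \<subseteq> e i \<and>
       e i \<inter> (X \<union> v ` {..<l} \<union> (\<Union>j<i. e j)) \<subseteq> {v i, v (nx l i)}" if "m \<le> l" for m
    using that
  proof (induction m)
    case (Suc m)
    then obtain e where e: "\<forall>i<m. e i \<in> H \<and> {v i, v (nx l i)} \<subseteq> e i \<and>
       e i \<inter> (X \<union> v ` {..<l} \<union> (\<Union>j<i. e j)) \<subseteq> {v i, v (nx l i)}" by auto
    obtain e0 where e0: "e0 \<in> H" "{v m, v (nx l m)} \<subseteq> e0" using v(3)[of m] Suc by auto
    let ?X = "X \<union> v ` {..<l} \<union> (\<Union>j<m. e j)"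
    have "card ?X \<le> card (X \<union> v ` {..<l}) + card (\<Union>j<m. e j)" by (rule card_Un_le)
    also have "card (X \<union> v ` {..<l}) \<le> card X + card (v ` {..<l})" by (rule card_Un_le)
    also have "card (v ` {..<l}) = l" using v(1) by (simp add: card_image)
    also have "card (\<Union>j<m. e j) \<le> (\<Sum>j<m. card (e j))" by (intro card_UN_le) auto
    also have "\<dots> \<le> (\<Sum>j<m. r)" using e u by (intro sum_mono) (auto simp: uniform_def)
    also have "\<dots> \<le> l * r" using Suc by simp
    finally have cX: "card ?X < d" using X by (simp add: algebra_simps)
    have fX: "finite ?X" using X e u by (auto simp: uniform_def)
    obtain e1 where e1: "e1 \<in> H" "{v m, v (nx l m)} \<subseteq> e1" "e1 \<inter> ?X \<subseteq> {v m, v (nx l m)}"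
      using full_avoid[OF full u e0 fX cX] by blast
    have "\<forall>i<Suc m. (e(m := e1)) i \<in> H \<and> {v i, v (nx l i)} \<subseteq> (e(m := e1)) i \<and>
       (e(m := e1)) i \<inter> (X \<union> v ` {..<l} \<union> (\<Union>j<i. (e(m := e1)) j)) \<subseteq> {v i, v (nx l i)}"
    proof (intro allI impI)
      fix i assume i: "i < Suc m"
      have "(\<Union>j<i. (e(m := e1)) j) = (\<Union>j<i. e j)" using i by (intro SUP_cong) auto
      then show "(e(m := e1)) i \<in> H \<and> {v i, v (nx l i)} \<subseteq> (e(m := e1)) i \<and>
       (e(m := e1)) i \<inter> (X \<union> v ` {..<l} \<union> (\<Union>j<i. (e(m := e1)) j)) \<subseteq> {v i, v (nx l i)}"
        using e e1 i by (cases "i = m") (simp_all del: fun_upd_apply add: fun_upd_def)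
    qed
    then show ?case by blast
  qed auto
  from this[of l] obtain e where e0: "\<forall>i<l. e i \<in> H \<and> {v i, v (nx l i)} \<subseteq> e i \<and>
       e i \<inter> (X \<union> v ` {..<l} \<union> (\<Union>j<i. e j)) \<subseteq> {v i, v (nx l i)}" by blast
  then have e: "\<And>i. i < l \<Longrightarrow> e i \<in> H" "\<And>i. i < l \<Longrightarrow> {v i, v (nx l i)} \<subseteq> e i"
    "\<And>i. i < l \<Longrightarrow> e i \<inter> (X \<union> v ` {..<l} \<union> (\<Union>j<i. e j)) \<subseteq> {v i, v (nx l i)}" by metis+
  have nxl: "nx l i < l" if "i < l" for i using that by (auto simp: nx_def)
  have eX: "e i \<inter> X = {}" if "i < l" for i
  proof -
    have "{v i, v (nx l i)} \<inter> X = {}" using v(2) that nxl[OF that] by auto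
    then show ?thesis using e(3)[OF that] by blast
  qed
  have int: "e i \<inter> e j = {v i, v (nx l i)} \<inter> {v j, v (nx l j)}" if "i < j" "j < l" for i j
  proof -
    have "e i \<inter> e j \<subseteq> {v j, v (nx l j)}" using e(3)[of j] that by auto
    moreover have "{v j, v (nx l j)} \<subseteq> v ` {..<l}" using nxl that by auto
    moreover have "e i \<inter> v ` {..<l} \<subseteq> {v i, v (nx l i)}" using e(3)[of i] that by auto
    moreover have "{v i, v (nx l i)} \<subseteq> e i" "{v j, v (nx l j)} \<subseteq> e j" using e(2) that by auto
    ultimately show ?thesis by blast
  qed
  have vi: "v i = v j \<longleftrightarrow> i = j" if "i < l" "j < l" for i j
    using v(1) that by (auto simp: inj_on_def)
  have "lin_cycle e l" unfolding lin_cycle_def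
  proof (intro allI impI)
    fix i j assume ij: "i < j" "j < l"
    have "i < l" using ij by simp
    note vv = vi[OF this ij(2)] vi[OF this nxl[OF ij(2)]] vi[OF nxl[OF this] ij(2)]
      vi[OF nxl[OF this] nxl[OF ij(2)]]
    consider "j = Suc i" | "i = 0" "Suc j = l" | "j \<noteq> Suc i" "\<not> (i = 0 \<and> Suc j = l)" by blast
    then show "if j = Suc i \<or> i = 0 \<and> Suc j = l then is_singleton (e i \<inter> e j) else e i \<inter> e j = {}"
    proof cases
      case 1
      have "e i \<inter> e j = {v j}" unfolding int[OF ij] using vv 1 ij l by (auto simp: nx_def split: if_splits)
      then show ?thesis using 1 by simp
    next
      case 2
      have "e i \<inter> e j = {v i}" unfolding int[OF ij] using vv 2 ij l by (auto simp: nx_def split: if_splits)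
      then show ?thesis using 2 by simp
    next
      case 3
      have "e i \<inter> e j = {}" unfolding int[OF ij] using vv 3 ij l by (auto simp: nx_def split: if_splits)
      then show ?thesis using 3 by auto
    qed
  qed
  then show ?thesis using e(1) eX by blast
qed

text \<open>As \<open>r \<le> s\<close>, every vertex of a clique lies in a hyperedge inside the
  clique, so cliques are subsets of the finite set \<Union>H.\<close>

lemma finite_cliques:
  assumes "uniform r H" "r \<le> s" "1 \<le> r"
  shows "finite (cliques r H s)" "S \<in> cliques r H s \<Longrightarrow> finite S \<and> (\<exists>e\<in>H. e \<subseteq> S)"
proof -
  have *: "S \<subseteq> \<Union>H" "finite S" "\<exists>e\<in>H. e \<subseteq> S" if "S \<in> cliques r H s" for S
  proof -
    show fin: "finite S" using that assms by (intro card_ge_0_finite) (auto simp: cliques_def)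
    have ex: "\<exists>e\<in>H. e \<subseteq> S \<and> x \<in> e" if "x \<in> S" for x
    proof -
      have "r - 1 \<le> card (S - {x})" using \<open>S \<in> cliques r H s\<close> that assms fin
        by (simp add: cliques_def)
      then obtain T where T: "T \<subseteq> S - {x}" "card T = r - 1" "finite T"
        by (rule obtain_subset_with_card_n)
      have "x \<notin> T" using T(1) by auto
      then have "card (insert x T) = r" using assms(3) T by simp
      moreover have "insert x T \<subseteq> S" using T(1) that by auto
      ultimately have "insert x T \<in> H" using \<open>S \<in> cliques r H s\<close> by (auto simp: cliques_def)
      then show ?thesis using \<open>insert x T \<subseteq> S\<close> by (intro bexI[of _ "insert x T"]) auto
    qed
    then show "S \<subseteq> \<Union>H" by blast
    have "S \<noteq> {}" using \<open>S \<in> cliques r H s\<close> assms by (auto simp: cliques_def)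
    then show "\<exists>e\<in>H. e \<subseteq> S" using ex by blast
  qed
  have "finite (\<Union>H)" using assms by (auto simp: uniform_def)
  moreover have "cliques r H s \<subseteq> Pow (\<Union>H)" using *(1) by auto
  ultimately show "finite (cliques r H s)" by (meson finite_Pow_iff finite_subset)
  show "S \<in> cliques r H s \<Longrightarrow> finite S \<and> (\<exists>e\<in>H. e \<subseteq> S)" using * by blast
qed

text \<open>The other s - r + 1 vertices of a clique through \<open>f\<close> all complete
  \<open>f\<close> to a hyperedge.\<close>

lemma card_cliques_through:
  assumes u: "uniform r H" and f: "card f = r - 1" "finite f" and r: "1 \<le> r" "r \<le> s"
  shows "card {S \<in> cliques r H s. f \<subseteq> S} \<le> card (nbrs H f) choose (s - r + 1)"
proof -
  let ?C = "{S \<in> cliques r H s. f \<subseteq> S}"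
  have "inj_on (\<lambda>S. S - f) ?C" by (auto simp: inj_on_def)
  then have "card ?C = card ((\<lambda>S. S - f) ` ?C)" by (simp add: card_image)
  also have "\<dots> \<le> card {T. T \<subseteq> nbrs H f \<and> card T = s - r + 1}"
  proof (intro card_mono finite_subset[OF _ finite_Pow_iff[THEN iffD2, OF finite_nbrs[OF u]]])
    show "(\<lambda>S. S - f) ` ?C \<subseteq> {T. T \<subseteq> nbrs H f \<and> card T = s - r + 1}"
    proof clarify
      fix S assume S: "S \<in> cliques r H s" "f \<subseteq> S"
      have "S - f \<subseteq> nbrs H f"
      proof
        fix x assume x: "x \<in> S - f"
        then have "card (insert x f) = r" using f r by simp
        then show "x \<in> nbrs H f" using S x by (auto simp: nbrs_def cliques_def)
      qed
      moreover have "card (S - f) = s - r + 1"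
        using S f r by (simp add: card_Diff_subset cliques_def)
      ultimately show "S - f \<subseteq> nbrs H f \<and> card (S - f) = s - r + 1" by blast
    qed
  qed auto
  also have "\<dots> = card (nbrs H f) choose (s - r + 1)" by (rule n_subsets[OF finite_nbrs[OF u]])
  finally show ?thesis .
qed

text \<open>Repeatedly delete all hyperedges through an \<open>(r - 1)\<close>-set of codegree at most \<open>t\<close> and, if there is
  none, of codegree less than \<open>d\<close>. The sets of the first kind form \<open>P\<close>, those of the second kind \<open>E\<close>.
  Every clique is charged to the first of these sets whose deletion destroys it.\<close>

lemma trimming:
  assumes "uniform r H" "1 \<le> r" "r \<le> s" "\<And>H'. H' \<subseteq> H \<Longrightarrow> H' \<noteq> {} \<Longrightarrow> \<not> full d H'"
  shows "\<exists>P E. P \<subseteq> shadow H \<and> E \<subseteq> shadow H \<and> finite P \<and> finite E \<and>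
    card (cliques r H s) \<le> (t choose (s - r + 1)) * card P + (d choose (s - r + 1)) * card E \<and>
    (\<forall>f\<in>E. \<exists>H'\<subseteq>H. full (t + 1) H' \<and> f \<in> shadow H')"
  using assms
proof (induction "card H" arbitrary: H rule: less_induct)
  case (less H)
  note u = less.prems(1)
  have fin: "finite H" using u by (simp add: uniform_def)
  show ?case
  proof (cases "H = {}")
    case True
    then have "cliques r H s = {}" using finite_cliques(2)[OF u less.prems(3,2)] by auto
    then show ?thesis by (intro exI[of _ "{}"]) auto
  next
    case False
    define q where "q = s - r + 1"
    \<comment> \<open>Sets of codegree at most \<open>t\<close> have priority. A set of larger
      codegree is deleted only when the whole hypergraph is full at level \<open>t + 1\<close>; this
      is recorded in the conclusion and later supplies the labels.\<close>
    have "\<exists>e x. e \<in> H \<and> x \<in> e \<and> (card (nbrs H (e - {x})) \<le> t \<or> full (t + 1) H \<and> card (nbrs H (e - {x})) \<le> d)"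
    proof (cases "full (t + 1) H")
      case True
      have "\<not> full d H" using less.prems(4)[of H] False by simp
      then obtain e x where "e \<in> H" "x \<in> e" "\<not> d \<le> card (nbrs H (e - {x}))"
        unfolding full_def by blast
      then have "card (nbrs H (e - {x})) \<le> d" by simp
      then show ?thesis using \<open>e \<in> H\<close> \<open>x \<in> e\<close> True by blast
    next
      case False
      then obtain e x where "e \<in> H" "x \<in> e" "\<not> t + 1 \<le> card (nbrs H (e - {x}))"
        unfolding full_def by blast
      then have "card (nbrs H (e - {x})) \<le> t" by simp
      then show ?thesis using \<open>e \<in> H\<close> \<open>x \<in> e\<close> by blast
    qed
    then obtain e x where e: "e \<in> H" "x \<in> e"
      and cases: "card (nbrs H (e - {x})) \<le> t \<or> full (t + 1) H \<and> card (nbrs H (e - {x})) \<le> d" by blast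
    define f where "f = e - {x}"
    have f: "card f = r - 1" "finite f" "f \<in> shadow H"
      using u e by (auto simp: f_def uniform_def shadow_def)
    define H' where "H' = {g\<in>H. \<not> f \<subseteq> g}"
    have sub: "H' \<subseteq> H" "e \<notin> H'" by (auto simp: H'_def f_def)
    have "card H' < card H" using sub e fin by (metis psubset_card_mono psubsetI)
    moreover have "uniform r H'" using u sub by (auto simp: uniform_def intro: finite_subset)
    moreover have "\<not> full d H''" if "H'' \<subseteq> H'" "H'' \<noteq> {}" for H''
      using less.prems(4) that sub(1) by (meson order_trans)
    ultimately obtain P E where PE: "P \<subseteq> shadow H'" "E \<subseteq> shadow H'" "finite P" "finite E"
      "card (cliques r H' s) \<le> (t choose q) * card P + (d choose q) * card E"
      "\<forall>f\<in>E. \<exists>H''\<subseteq>H'. full (t + 1) H'' \<and> f \<in> shadow H''"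
      using less.hyps[of H'] less.prems(2,3) unfolding q_def by blast
    \<comment> \<open>After the deletion \<open>f\<close> has codegree 0 and never returns to a
      shadow. Hence deleted sets are distinct and each deletion adds exactly one to the
      count.\<close>
    have fn: "f \<notin> shadow H'" by (auto simp: shadow_def H'_def)
    have ss: "shadow H' \<subseteq> shadow H" using sub by (auto simp: shadow_def)
    have "cliques r H s \<subseteq> cliques r H' s \<union> {S \<in> cliques r H s. f \<subseteq> S}"
      unfolding cliques_def H'_def by auto
    then have "card (cliques r H s) \<le> card (cliques r H' s \<union> {S \<in> cliques r H s. f \<subseteq> S})"
      using finite_cliques(1)[OF \<open>uniform r H'\<close> less.prems(3,2)] finite_cliques(1)[OF u less.prems(3,2)]
      by (intro card_mono) auto
    also have "\<dots> \<le> card (cliques r H' s) + card {S \<in> cliques r H s. f \<subseteq> S}" by (rule card_Un_le)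
    also have "card {S \<in> cliques r H s. f \<subseteq> S} \<le> card (nbrs H f) choose q"
      unfolding q_def using card_cliques_through[OF u f(1,2)] less.prems by blast
    finally have main: "card (cliques r H s) \<le>
        (t choose q) * card P + (d choose q) * card E + (card (nbrs H f) choose q)" using PE(5) by simp
    from cases show ?thesis
    proof
      assume "card (nbrs H (e - {x})) \<le> t"
      then have "card (nbrs H f) choose q \<le> t choose q" unfolding f_def by (rule binomial_right_mono)
      moreover have "card (insert f P) = Suc (card P)" using PE fn by (intro card_insert_disjoint) auto
      ultimately have "card (cliques r H s) \<le> (t choose q) * card (insert f P) + (d choose q) * card E"
        using main by simp
      moreover have "insert f P \<subseteq> shadow H" "E \<subseteq> shadow H" "finite (insert f P)" using PE f ss by auto
      moreover have "\<forall>g\<in>E. \<exists>H''\<subseteq>H. full (t + 1) H'' \<and> g \<in> shadow H''" using PE(6) sub(1) by (meson order_trans)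
      ultimately show ?thesis using PE(4) unfolding q_def by blast
    next
      assume A: "full (t + 1) H \<and> card (nbrs H (e - {x})) \<le> d"
      then have "card (nbrs H f) choose q \<le> d choose q" unfolding f_def by (intro binomial_right_mono) auto
      moreover have "card (insert f E) = Suc (card E)" using PE fn by (intro card_insert_disjoint) auto
      ultimately have "card (cliques r H s) \<le> (t choose q) * card P + (d choose q) * card (insert f E)"
        using main by simp
      moreover have "insert f E \<subseteq> shadow H" "P \<subseteq> shadow H" "finite (insert f E)" using PE f ss by auto
      moreover have "\<forall>g\<in>insert f E. \<exists>H''\<subseteq>H. full (t + 1) H'' \<and> g \<in> shadow H''"
        using PE(6) sub(1) A f(3) by (metis insertE order_refl order_trans)
      ultimately show ?thesis using PE(3) unfolding q_def by blast
    qed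
  qed
qed

section \<open>Sunflowers and canonical labellings\<close>

lemma card_UN_le_mult:
  assumes "finite I" "\<And>i. i \<in> I \<Longrightarrow> card (S i) \<le> k"
  shows "card (\<Union>i\<in>I. S i) \<le> card I * k"
proof -
  have "card (\<Union>i\<in>I. S i) \<le> (\<Sum>i\<in>I. card (S i))" by (rule card_UN_le[OF assms(1)])
  also have "\<dots> \<le> (\<Sum>i\<in>I. k)" using assms by (intro sum_mono)
  finally show ?thesis by simp
qed

lemma pigeonhole_constant:
  assumes "finite I" "(d + 1) * m \<le> card I" "\<And>i. i \<in> I \<Longrightarrow> g i \<le> (d::nat)" "m \<ge> 1"
  shows "\<exists>J\<subseteq>I. card J = m \<and> (\<exists>x. \<forall>i\<in>J. g i = x)"
proof -
  have "\<exists>x. m \<le> card {i\<in>I. g i = x}"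
  proof (rule ccontr)
    assume "\<nexists>x. m \<le> card {i\<in>I. g i = x}"
    then have "card {i\<in>I. g i = x} \<le> m - 1" for x using assms(4)
      by (metis Suc_le_eq Suc_pred' less_Suc_eq_le not_le order_less_le_trans zero_less_one)
    then have "card (\<Union>x\<in>{..d}. {i\<in>I. g i = x}) \<le> card {..d} * (m - 1)" by (intro card_UN_le_mult) auto
    moreover have "(\<Union>x\<in>{..d}. {i\<in>I. g i = x}) = I" using assms(3) by auto
    ultimately have "card I \<le> (d + 1) * (m - 1)" by simp
    also have "\<dots> < (d + 1) * m" using assms(4) by (intro mult_strict_left_mono) auto
    finally show False using assms(2) by simp
  qed
  then obtain x where "m \<le> card {i\<in>I. g i = x}" by blast
  then obtain J where "J \<subseteq> {i\<in>I. g i = x}" "card J = m" by (metis obtain_subset_with_card_n)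
  then have "J \<subseteq> I" "\<forall>i\<in>J. g i = x" by auto
  then show ?thesis using \<open>card J = m\<close> by blast
qed

text \<open>Greedy argument in a directed graph: out-degrees at most \<open>d\<close> give average
  in-degree at most \<open>d\<close>, so some vertex has at most \<open>2 * d\<close> neighbours in
  both directions together. Keep it, discard them, and repeat.\<close>

lemma independent_subset:
  assumes "finite I" "\<And>i. i \<in> I \<Longrightarrow> card {j\<in>I. j \<noteq> i \<and> R i j} \<le> d" "(2 * d + 1) * k \<le> card I"
  shows "\<exists>J\<subseteq>I. card J = k \<and> (\<forall>i\<in>J. \<forall>j\<in>J. i \<noteq> j \<longrightarrow> \<not> R i j)"
  using assms
proof (induction k arbitrary: I)
  case 0
  then show ?case by (intro exI[of _ "{}"]) auto
next
  case (Suc k)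
  have "\<exists>i\<in>I. card {j\<in>I. j \<noteq> i \<and> R j i} \<le> d"
  proof (rule ccontr)
    assume "\<not> ?thesis"
    then have big: "d + 1 \<le> card {j\<in>I. j \<noteq> i \<and> R j i}" if "i \<in> I" for i
      using that by (simp add: not_le Suc_le_eq)
    have "card I * (d + 1) \<le> (\<Sum>i\<in>I. card {j\<in>I. j \<noteq> i \<and> R j i})"
      using sum_mono[of I "\<lambda>_. d + 1"] big by simp
    also have "\<dots> = (\<Sum>i\<in>I. \<Sum>j\<in>I. if j \<noteq> i \<and> R j i then 1 else 0)"
      using Suc.prems(1) by (intro sum.cong refl) (simp only: card_eq_sum sum.inter_filter)
    also have "\<dots> = (\<Sum>j\<in>I. \<Sum>i\<in>I. if j \<noteq> i \<and> R j i then 1 else 0)" by (rule sum.swap)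
    also have "\<dots> = (\<Sum>j\<in>I. card {i\<in>I. j \<noteq> i \<and> R j i})"
      using Suc.prems(1) by (intro sum.cong refl) (simp only: card_eq_sum sum.inter_filter)
    also have "\<dots> = (\<Sum>j\<in>I. card {i\<in>I. i \<noteq> j \<and> R j i})"
      by (intro sum.cong refl arg_cong[of _ _ card]) auto
    also have "\<dots> \<le> card I * d" using sum_mono[of I _ "\<lambda>_. d"] Suc.prems(2) by simp
    finally have "card I * (d + 1) \<le> card I * d" .
    moreover have "card I \<noteq> 0" using Suc.prems(3) by auto
    ultimately show False by simp
  qed
  then obtain i where i: "i \<in> I" "card {j\<in>I. j \<noteq> i \<and> R j i} \<le> d" by blast
  let ?D = "insert i ({j\<in>I. j \<noteq> i \<and> R j i} \<union> {j\<in>I. j \<noteq> i \<and> R i j})"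
  have "card ?D \<le> Suc (card ({j\<in>I. j \<noteq> i \<and> R j i} \<union> {j\<in>I. j \<noteq> i \<and> R i j}))"
    using Suc.prems(1) by (simp add: card_insert_if)
  also have "\<dots> \<le> Suc (card {j\<in>I. j \<noteq> i \<and> R j i} + card {j\<in>I. j \<noteq> i \<and> R i j})"
    using card_Un_le by blast
  also have "\<dots> \<le> 2 * d + 1" using i Suc.prems(2)[OF i(1)] by simp
  finally have "card ?D \<le> 2 * d + 1" .
  moreover have "card I - card ?D \<le> card (I - ?D)"
    using Suc.prems(1) by (intro diff_card_le_card_Diff) auto
  ultimately have "card (I - ?D) \<ge> card I - (2 * d + 1)" by linarith
  then have "(2 * d + 1) * k \<le> card (I - ?D)" using Suc.prems(3) by (simp add: algebra_simps)
  moreover have "card {j\<in>I - ?D. j \<noteq> i' \<and> R i' j} \<le> d" if "i' \<in> I - ?D" for i'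
  proof -
    have "card {j\<in>I - ?D. j \<noteq> i' \<and> R i' j} \<le> card {j\<in>I. j \<noteq> i' \<and> R i' j}"
      using Suc.prems(1) by (intro card_mono) auto
    then show ?thesis using Suc.prems(2)[of i'] that by simp
  qed
  ultimately obtain J where J: "J \<subseteq> I - ?D" "card J = k" "\<forall>i\<in>J. \<forall>j\<in>J. i \<noteq> j \<longrightarrow> \<not> R i j"
    using Suc.IH[of "I - ?D"] Suc.prems(1) by blast
  have "finite J" using J(1) Suc.prems(1) by (meson finite_Diff finite_subset)
  moreover have "i \<notin> J" using J(1) by blast
  ultimately have "card (insert i J) = Suc k" using J(2) by simp
  moreover have "\<forall>a\<in>insert i J. \<forall>b\<in>insert i J. a \<noteq> b \<longrightarrow> \<not> R a b" using J by blast
  moreover have "insert i J \<subseteq> I" using J(1) i by blast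
  ultimately show ?case by blast
qed

text \<open>If some element lies in \<open>sunflower_bound d m\<close> sets, it joins the kernel and
  these sets shrink. Otherwise each set meets at most \<open>Suc d * sunflower_bound d m\<close>
  others, and the second equation is what \<open>independent_subset\<close> then asks for.\<close>

fun sunflower_bound :: "nat \<Rightarrow> nat \<Rightarrow> nat" where
  "sunflower_bound 0 m = m"
| "sunflower_bound (Suc d) m = (2 * (Suc d * sunflower_bound d m) + 1) * m"

text \<open>The family is indexed and the sizes are only bounded, so sets may repeat and petals may
  be empty; both occur for labels of cells.\<close>

lemma sunflower:
  assumes "finite I" "sunflower_bound d m \<le> card I" "\<And>i. i \<in> I \<Longrightarrow> finite (L i) \<and> card (L i) \<le> d"
  shows "\<exists>J C. J \<subseteq> I \<and> card J = m \<and> (\<forall>j\<in>J. C \<subseteq> L j) \<and> disjoint_family_on (\<lambda>j. L j - C) J"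
  using assms
proof (induction d arbitrary: I L)
  case 0
  then obtain J where J: "J \<subseteq> I" "card J = m" by (metis obtain_subset_with_card_n sunflower_bound.simps(1))
  have "L j = {}" if "j \<in> J" for j
  proof -
    have "j \<in> I" using J(1) that by blast
    then show ?thesis using 0(3)[of j] by auto
  qed
  then show ?case using J by (intro exI[of _ J] exI[of _ "{}"]) (auto simp: disjoint_family_on_def)
next
  case (Suc d)
  show ?case
  proof (cases "\<exists>v. sunflower_bound d m \<le> card {i\<in>I. v \<in> L i}")
    case True
    then obtain v where v: "sunflower_bound d m \<le> card {i\<in>I. v \<in> L i}" by blast
    have "finite (L i - {v}) \<and> card (L i - {v}) \<le> d" if "i \<in> {i\<in>I. v \<in> L i}" for i
      using Suc.prems(3)[of i] that by auto
    then obtain J C where J: "J \<subseteq> {i\<in>I. v \<in> L i}" "card J = m" "\<forall>j\<in>J. C \<subseteq> L j - {v}"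
      "disjoint_family_on (\<lambda>j. L j - {v} - C) J"
      using Suc.IH[of "{i\<in>I. v \<in> L i}" "\<lambda>i. L i - {v}"] v Suc.prems(1) by auto
    have "L j - {v} - C = L j - insert v C" for j by blast
    then have "disjoint_family_on (\<lambda>j. L j - insert v C) J" using J(4) by simp
    moreover have "\<forall>j\<in>J. insert v C \<subseteq> L j" using J(1,3) by blast
    moreover have "J \<subseteq> I" using J(1) by blast
    ultimately show ?thesis using J(2) by blast
  next
    case False
    have "card {j\<in>I. j \<noteq> i \<and> L i \<inter> L j \<noteq> {}} \<le> Suc d * sunflower_bound d m" if i: "i \<in> I" for i
    proof -
      have "{j\<in>I. j \<noteq> i \<and> L i \<inter> L j \<noteq> {}} \<subseteq> (\<Union>v\<in>L i. {j\<in>I. v \<in> L j})" by auto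
      then have "card {j\<in>I. j \<noteq> i \<and> L i \<inter> L j \<noteq> {}} \<le> card (\<Union>v\<in>L i. {j\<in>I. v \<in> L j})"
        using Suc.prems(1,3) i by (intro card_mono) auto
      also have "\<dots> \<le> card (L i) * sunflower_bound d m"
        using False Suc.prems(3)[OF i] by (intro card_UN_le_mult) (auto intro: less_imp_le simp: not_le)
      also have "\<dots> \<le> Suc d * sunflower_bound d m" using Suc.prems(3)[OF i] by (intro mult_right_mono) auto
      finally show ?thesis .
    qed
    then obtain J where "J \<subseteq> I" "card J = m" "\<forall>i\<in>J. \<forall>j\<in>J. i \<noteq> j \<longrightarrow> \<not> L i \<inter> L j \<noteq> {}"
      using independent_subset[of I "\<lambda>i j. L i \<inter> L j \<noteq> {}" "Suc d * sunflower_bound d m" m] Suc.prems by auto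
    then show ?thesis by (intro exI[of _ J] exI[of _ "{}"]) (auto simp: disjoint_family_on_def)
  qed
qed

text \<open>The sunflower lemma is applied row after row to the surviving columns, hence the
  iterated bound; passing to fewer columns preserves the sunflowers already found.\<close>

lemma simultaneous_sunflower:
  assumes "finite A" "finite B" "(sunflower_bound d ^^ card A) m \<le> card B"
    "\<And>a b. a \<in> A \<Longrightarrow> b \<in> B \<Longrightarrow> finite (L a b) \<and> card (L a b) \<le> d"
  shows "\<exists>J C. J \<subseteq> B \<and> card J = m \<and>
    (\<forall>a\<in>A. (\<forall>b\<in>J. C a \<subseteq> L a b) \<and> disjoint_family_on (\<lambda>b. L a b - C a) J)"
  using assms
proof (induction A arbitrary: B rule: finite_induct)
  case empty
  then obtain J where "J \<subseteq> B" "card J = m" by (metis card.empty funpow_0 obtain_subset_with_card_n)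
  then show ?case by blast
next
  case (insert a A)
  let ?m = "(sunflower_bound d ^^ card A) m"
  have "sunflower_bound d ?m \<le> card B" using insert.prems(2) insert.hyps by simp
  then obtain J C where J: "J \<subseteq> B" "card J = ?m" "\<forall>b\<in>J. C \<subseteq> L a b" "disjoint_family_on (\<lambda>b. L a b - C) J"
    using sunflower[of B d ?m "L a"] insert.prems by blast
  have "finite J" using J(1) insert.prems(1) finite_subset by blast
  then obtain J' C' where J': "J' \<subseteq> J" "card J' = m"
      "\<forall>a\<in>A. (\<forall>b\<in>J'. C' a \<subseteq> L a b) \<and> disjoint_family_on (\<lambda>b. L a b - C' a) J'"
  proof -
    have "finite (L x b) \<and> card (L x b) \<le> d" if "x \<in> A" "b \<in> J" for x b
      using insert.prems(3)[of x b] that J(1) by auto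
    then show thesis using insert.IH[OF \<open>finite J\<close>] J(2) that by auto
  qed
  have "disjoint_family_on (\<lambda>b. L a b - C) J'" using J(4) J'(1) by (rule disjoint_family_on_mono[rotated])
  moreover have "\<forall>b\<in>J'. C \<subseteq> L a b" using J(3) J'(1) by blast
  ultimately have "\<forall>x\<in>insert a A. (\<forall>b\<in>J'. (C'(a := C)) x \<subseteq> L x b) \<and>
      disjoint_family_on (\<lambda>b. L x b - (C'(a := C)) x) J'"
    using J'(3) insert.hyps(2) by auto
  moreover have "J' \<subseteq> B" using J(1) J'(1) by blast
  ultimately show ?case using J'(2) by blast
qed

text \<open>Labels of the cells of a grid: \<open>T\<close> is common to all cells, \<open>\<Phi> a\<close> depends on the row only,
  \<open>\<Psi> b\<close> on the column only, and the labels in \<open>U a b\<close> occur in a single cell.\<close>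

definition canonical :: "'a set \<Rightarrow> 'a set \<Rightarrow> ('a \<Rightarrow> 'a \<Rightarrow> 'a set) \<Rightarrow> 'a set \<Rightarrow>
    ('a \<Rightarrow> 'a set) \<Rightarrow> ('a \<Rightarrow> 'a set) \<Rightarrow> ('a \<Rightarrow> 'a \<Rightarrow> 'a set) \<Rightarrow> bool" where
  "canonical A B L T \<Phi> \<Psi> U \<longleftrightarrow>
     (\<forall>a\<in>A. \<forall>b\<in>B. L a b = T \<union> \<Phi> a \<union> \<Psi> b \<union> U a b \<and> T \<inter> \<Phi> a = {} \<and> T \<inter> \<Psi> b = {} \<and> T \<inter> U a b = {} \<and>
        \<Phi> a \<inter> \<Psi> b = {}) \<and>
     (\<forall>a\<in>A. \<forall>a'\<in>A. a \<noteq> a' \<longrightarrow> \<Phi> a \<inter> \<Phi> a' = {}) \<and>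
     (\<forall>b\<in>B. \<forall>b'\<in>B. b \<noteq> b' \<longrightarrow> \<Psi> b \<inter> \<Psi> b' = {}) \<and>
     (\<forall>a\<in>A. \<forall>a'\<in>A. \<forall>b\<in>B. \<Phi> a \<inter> U a' b = {}) \<and>
     (\<forall>a\<in>A. \<forall>b\<in>B. \<forall>b'\<in>B. \<Psi> b \<inter> U a b' = {}) \<and>
     (\<forall>a\<in>A. \<forall>a'\<in>A. \<forall>b\<in>B. \<forall>b'\<in>B. (a, b) \<noteq> (a', b') \<longrightarrow> U a b \<inter> U a' b' = {})"

lemma canonical_mono:
  "canonical A B L T \<Phi> \<Psi> U \<Longrightarrow> A' \<subseteq> A \<Longrightarrow> B' \<subseteq> B \<Longrightarrow> canonical A' B' L T \<Phi> \<Psi> U"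
  unfolding canonical_def by (meson subsetD)

lemma canonical_transpose:
  assumes "canonical A B L T \<Phi> \<Psi> U"
  shows "canonical B A (\<lambda>b a. L a b) T \<Psi> \<Phi> (\<lambda>b a. U a b)"
proof -
  note c = assms[unfolded canonical_def]
  show ?thesis unfolding canonical_def
  proof (intro conjI ballI impI)
    fix b a assume ab: "b \<in> B" "a \<in> A"
    then have "L a b = T \<union> \<Phi> a \<union> \<Psi> b \<union> U a b \<and> T \<inter> \<Phi> a = {} \<and> T \<inter> \<Psi> b = {} \<and> T \<inter> U a b = {} \<and>
        \<Phi> a \<inter> \<Psi> b = {}" using c by simp
    then show "L a b = T \<union> \<Psi> b \<union> \<Phi> a \<union> U a b" "T \<inter> \<Psi> b = {}" "T \<inter> \<Phi> a = {}" "T \<inter> U a b = {}"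
      "\<Psi> b \<inter> \<Phi> a = {}" by auto
  next
    fix b b' a a' assume "b \<in> B" "b' \<in> B" "a \<in> A" "a' \<in> A" "(b, a) \<noteq> (b', a')"
    moreover have "\<forall>a\<in>A. \<forall>a'\<in>A. \<forall>b\<in>B. \<forall>b'\<in>B. (a, b) \<noteq> (a', b') \<longrightarrow> U a b \<inter> U a' b' = {}"
      using c by (elim conjE)
    ultimately show "U a b \<inter> U a' b' = {}" by blast
  qed (use c in auto)
qed

text \<open>Sunflowers along the rows isolate the labels \<open>C a\<close> that stay constant in a
  row, and a sunflower among these kernels splits them into \<open>T\<close> and
  \<open>\<Phi> a\<close>. For the remaining labels, sunflowers along the columns split off
  \<open>\<Psi> b\<close> and leave \<open>U a b\<close>. Accidental coincidences of private labels
  with others affect few columns and are removed by discarding columns.\<close>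

lemma canonical_exists:
  fixes d m :: nat
  assumes m: "m \<ge> 1"
  shows "\<exists>N. \<forall>(A::'a set) B L. finite A \<longrightarrow> finite B \<longrightarrow> N \<le> card A \<longrightarrow> N \<le> card B \<longrightarrow>
    (\<forall>a\<in>A. \<forall>b\<in>B. finite (L a b) \<and> card (L a b) \<le> d) \<longrightarrow>
    (\<exists>A' B' T \<Phi> \<Psi> U x y. A' \<subseteq> A \<and> B' \<subseteq> B \<and> card A' = m \<and> card B' = m \<and>
       canonical A' B' L T \<Phi> \<Psi> U \<and> (\<forall>a\<in>A'. card (\<Phi> a) = x) \<and> (\<forall>b\<in>B'. card (\<Psi> b) = y))"
proof -
  \<comment> \<open>Sizes in reverse order of use: \<open>\<mu>\<close> serves the final pigeonhole
    on cardinalities in \<open>{0..d}\<close>, \<open>D\<close> bounds both the columns lost to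
    \<open>bad\<close> and the conflicts of a column, and \<open>m3\<close>, \<open>m2\<close>,
    \<open>m1\<close>, \<open>N\<close> are what the successive sunflower steps consume.\<close>
  define \<mu> where "\<mu> = (d + 1) * m"
  define D where "D = \<mu> * \<mu> * d"
  define m3 where "m3 = D + (2 * D + 1) * \<mu>"
  define m2 where "m2 = (sunflower_bound d ^^ m3) \<mu>"
  define m1 where "m1 = sunflower_bound d m2"
  define N where "N = max m1 ((sunflower_bound d ^^ m1) m3)"
  have \<mu>: "\<mu> \<ge> 1" using m by (simp add: \<mu>_def)
  have main: "\<exists>A' B' T \<Phi> \<Psi> U x y. A' \<subseteq> A \<and> B' \<subseteq> B \<and> card A' = m \<and> card B' = m \<and>
       canonical A' B' L T \<Phi> \<Psi> U \<and> (\<forall>a\<in>A'. card (\<Phi> a) = x) \<and> (\<forall>b\<in>B'. card (\<Psi> b) = y)"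
    if fin: "finite A" "finite B" and N: "N \<le> card A" "N \<le> card B"
      and L: "\<And>a b. a \<in> A \<Longrightarrow> b \<in> B \<Longrightarrow> finite (L a b) \<and> card (L a b) \<le> d" for A B :: "'a set" and L
  proof -
    obtain I1 where I1: "I1 \<subseteq> A" "card I1 = m1" "finite I1"
    proof -
      have "m1 \<le> card A" using N(1) by (simp add: N_def)
      then show thesis using obtain_subset_with_card_n[of m1 A] that by blast
    qed
    obtain J3 C where J3: "J3 \<subseteq> B" "card J3 = m3"
      and C: "\<forall>a\<in>I1. (\<forall>b\<in>J3. C a \<subseteq> L a b) \<and> disjoint_family_on (\<lambda>b. L a b - C a) J3"
    proof -
      have "(sunflower_bound d ^^ card I1) m3 \<le> card B" using N(2) I1(2) by (simp add: N_def)
      moreover have "finite (L a b) \<and> card (L a b) \<le> d" if "a \<in> I1" "b \<in> B" for a b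
        using L[of a b] that I1(1) by auto
      ultimately have "\<exists>J C. J \<subseteq> B \<and> card J = m3 \<and>
          (\<forall>a\<in>I1. (\<forall>b\<in>J. C a \<subseteq> L a b) \<and> disjoint_family_on (\<lambda>b. L a b - C a) J)"
        by (intro simultaneous_sunflower[OF I1(3) fin(2)]) auto
      then show thesis using that by blast
    qed
    have finJ3: "finite J3" using J3(1) fin finite_subset by blast
    have J3ne: "J3 \<noteq> {}" using J3(2) \<mu> by (auto simp: m3_def)
    have Cfin: "finite (C a) \<and> card (C a) \<le> d" if "a \<in> I1" for a
    proof -
      obtain b where b: "b \<in> J3" using J3ne by blast
      then have "C a \<subseteq> L a b" using C that by blast
      moreover have "finite (L a b) \<and> card (L a b) \<le> d" using L I1 J3 that b by blast
      ultimately show ?thesis by (meson card_mono finite_subset order_trans)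
    qed
    have "sunflower_bound d m2 \<le> card I1" using I1(2) by (simp add: m1_def)
    then have "\<exists>J T. J \<subseteq> I1 \<and> card J = m2 \<and> (\<forall>j\<in>J. T \<subseteq> C j) \<and> disjoint_family_on (\<lambda>j. C j - T) J"
      by (rule sunflower[OF I1(3)]) (rule Cfin)
    then obtain I2 T where I2: "I2 \<subseteq> I1" "card I2 = m2" "\<forall>a\<in>I2. T \<subseteq> C a"
        "disjoint_family_on (\<lambda>a. C a - T) I2"
      by (elim exE conjE) (rule that)
    have finI2: "finite I2" using I2(1) I1(3) finite_subset by blast
    define \<Phi> where "\<Phi> a = C a - T" for a
    define P where "P a b = L a b - C a" for a b
    have PL: "finite (P a b) \<and> card (P a b) \<le> d" if "a \<in> I1" "b \<in> J3" for a b
    proof -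
      have "finite (L a b) \<and> card (L a b) \<le> d" using L I1 J3 that by blast
      then show ?thesis unfolding P_def by (meson card_mono finite_Diff Diff_subset order_trans)
    qed
    obtain I3 \<Psi> where I3: "I3 \<subseteq> I2" "card I3 = \<mu>"
      and \<Psi>: "\<forall>b\<in>J3. (\<forall>a\<in>I3. \<Psi> b \<subseteq> P a b) \<and> disjoint_family_on (\<lambda>a. P a b - \<Psi> b) I3"
    proof -
      have "(sunflower_bound d ^^ card J3) \<mu> \<le> card I2" using I2(2) J3(2) by (simp add: m2_def)
      moreover have "finite (P a b) \<and> card (P a b) \<le> d" if "b \<in> J3" "a \<in> I2" for a b
        using PL[of a b] that I2(1) by auto
      ultimately have "\<exists>I \<Psi>. I \<subseteq> I2 \<and> card I = \<mu> \<and>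
          (\<forall>b\<in>J3. (\<forall>a\<in>I. \<Psi> b \<subseteq> P a b) \<and> disjoint_family_on (\<lambda>a. P a b - \<Psi> b) I)"
        by (intro simultaneous_sunflower[OF finJ3 finI2]) auto
      then show thesis using that by blast
    qed
    have finI3: "finite I3" using I3(1) finI2 finite_subset by blast
    have I3A: "I3 \<subseteq> I1" using I3 I2 by blast
    define U where "U a b = P a b - \<Psi> b" for a b
    obtain a0 where a0: "a0 \<in> I3" using I3(2) \<mu> by fastforce
    have Pdis: "P a b \<inter> P a b' = {}" if "a \<in> I3" "b \<in> J3" "b' \<in> J3" "b \<noteq> b'" for a b b'
      using C that I3A unfolding P_def disjoint_family_on_def by (meson subsetD)
    have UP: "U a b \<subseteq> P a b" for a b by (auto simp: U_def)
    have \<Psi>P: "\<Psi> b \<subseteq> P a b" if "a \<in> I3" "b \<in> J3" for a b using \<Psi> that by blast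
    \<comment> \<open>In a fixed row the sets \<open>P a b\<close> are petals of a sunflower, so a
      label is private in at most one column.\<close>
    have one: "card {b\<in>J3. v \<in> U a b} \<le> 1" if "a \<in> I3" for a v
    proof -
      have "b = b'" if "b \<in> {b\<in>J3. v \<in> U a b}" "b' \<in> {b\<in>J3. v \<in> U a b}" for b b'
        using Pdis[OF \<open>a \<in> I3\<close>, of b b'] UP that by blast
      then show ?thesis using finJ3 by (simp add: card_le_Suc0_iff_eq)
    qed
    define V where "V = (\<Union>a\<in>I3. \<Phi> a)"
    have \<Phi>d: "card (\<Phi> a) \<le> d" if "a \<in> I3" for a
    proof -
      have "finite (C a) \<and> card (C a) \<le> d" using Cfin I3A that by blast
      then show ?thesis unfolding \<Phi>_def by (meson card_mono Diff_subset order_trans)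
    qed
    have V: "card V \<le> \<mu> * d" unfolding V_def I3(2)[symmetric] by (intro card_UN_le_mult finI3 \<Phi>d)
    have Vfin: "finite V" unfolding V_def \<Phi>_def using finI3 Cfin I3A by blast
    \<comment> \<open>Columns in which a row label reappears as a private label.\<close>
    define bad where "bad = (\<Union>a\<in>I3. \<Union>v\<in>V. {b\<in>J3. v \<in> U a b})"
    have "card bad \<le> card I3 * (card V * 1)" unfolding bad_def
      by (intro card_UN_le_mult finI3 Vfin one)
    also have "\<dots> \<le> D" unfolding D_def I3(2) using V by (simp add: mult.assoc)
    finally have "card bad \<le> D" .
    define J4 where "J4 = J3 - bad"
    have finJ4: "finite J4" using finJ3 by (simp add: J4_def)
    have "finite bad" unfolding bad_def using finI3 Vfin finJ3 by auto
    then have J4: "(2 * D + 1) * \<mu> \<le> card J4" using \<open>card bad \<le> D\<close> J3(2) diff_card_le_card_Diff[of bad J3]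
      unfolding J4_def m3_def by linarith
    \<comment> \<open>Columns conflict if they share a private label. Within one column there is
      nothing to check, because the sets \<open>U a b\<close> of a column are petals.\<close>
    define R where "R b b' \<longleftrightarrow> (\<exists>a\<in>I3. \<exists>a'\<in>I3. U a b \<inter> U a' b' \<noteq> {})" for b b'
    have Ufin: "finite (U a b) \<and> card (U a b) \<le> d" if "a \<in> I3" "b \<in> J3" for a b
    proof -
      have "finite (P a b) \<and> card (P a b) \<le> d" using PL I3A that by blast
      then show ?thesis using UP by (meson card_mono finite_subset order_trans)
    qed
    have deg: "card {b'\<in>J4. b' \<noteq> b \<and> R b b'} \<le> D" if b: "b \<in> J4" for b
    proof -
      have bJ: "b \<in> J3" using b by (simp add: J4_def)
      have "{b'\<in>J4. b' \<noteq> b \<and> R b b'} \<subseteq> (\<Union>a\<in>I3. \<Union>v\<in>U a b. \<Union>a'\<in>I3. {b'\<in>J3. v \<in> U a' b'})"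
        unfolding R_def J4_def by blast
      then have "card {b'\<in>J4. b' \<noteq> b \<and> R b b'} \<le> card (\<Union>a\<in>I3. \<Union>v\<in>U a b. \<Union>a'\<in>I3. {b'\<in>J3. v \<in> U a' b'})"
        using finJ3 finI3 Ufin bJ by (intro card_mono finite_UN_I) auto
      also have "\<dots> \<le> card I3 * (d * (card I3 * 1))"
      proof (intro card_UN_le_mult finI3)
        fix a assume a: "a \<in> I3"
        have "card (\<Union>v\<in>U a b. \<Union>a'\<in>I3. {b'\<in>J3. v \<in> U a' b'}) \<le> card (U a b) * (card I3 * 1)"
          using Ufin[OF a bJ] one by (intro card_UN_le_mult finI3) auto
        also have "\<dots> \<le> d * (card I3 * 1)" using Ufin[OF a bJ] by (intro mult_right_mono) auto
        finally show "card (\<Union>v\<in>U a b. \<Union>a'\<in>I3. {b'\<in>J3. v \<in> U a' b'}) \<le> d * (card I3 * 1)" .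
      qed
      also have "\<dots> = D" unfolding I3(2) D_def by simp
      finally show ?thesis .
    qed
    have "\<exists>J\<subseteq>J4. card J = \<mu> \<and> (\<forall>i\<in>J. \<forall>j\<in>J. i \<noteq> j \<longrightarrow> \<not> R i j)"
      by (rule independent_subset[OF finJ4 _ J4]) (rule deg)
    then obtain J5 where J5: "J5 \<subseteq> J4" "card J5 = \<mu>" "\<forall>b\<in>J5. \<forall>b'\<in>J5. b \<noteq> b' \<longrightarrow> \<not> R b b'"
      by blast
    have J53: "J5 \<subseteq> J3" using J5 J4_def by blast
    have can: "canonical I3 J5 L T \<Phi> \<Psi> U" unfolding canonical_def
    proof (intro conjI ballI impI)
      fix a b assume ab: "a \<in> I3" "b \<in> J5"
      then have b: "b \<in> J3" using J53 by blast
      have T: "T \<subseteq> C a" using I2 I3 ab by blast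
      have CL: "C a \<subseteq> L a b" using C I3A ab b by blast
      note \<Psi>P[OF ab(1) b]
      then show "L a b = T \<union> \<Phi> a \<union> \<Psi> b \<union> U a b" "T \<inter> \<Phi> a = {}" "T \<inter> \<Psi> b = {}" "T \<inter> U a b = {}"
        "\<Phi> a \<inter> \<Psi> b = {}"
        using T CL unfolding \<Phi>_def U_def P_def by blast+
    next
      fix a a' assume "a \<in> I3" "a' \<in> I3" "a \<noteq> a'"
      then show "\<Phi> a \<inter> \<Phi> a' = {}" using I2(4) I3(1) unfolding \<Phi>_def disjoint_family_on_def by blast
    next
      fix b b' assume "b \<in> J5" "b' \<in> J5" "b \<noteq> b'"
      then show "\<Psi> b \<inter> \<Psi> b' = {}" using Pdis[OF a0, of b b'] \<Psi>P[OF a0] J53 by blast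
    next
      fix a a' b assume A: "a \<in> I3" "a' \<in> I3" "b \<in> J5"
      then have "b \<notin> bad" "b \<in> J3" using J5 J4_def by blast+
      then show "\<Phi> a \<inter> U a' b = {}" using A unfolding bad_def V_def by blast
    next
      fix a b b' assume A: "a \<in> I3" "b \<in> J5" "b' \<in> J5"
      show "\<Psi> b \<inter> U a b' = {}"
      proof (cases "b = b'")
        case True
        then show ?thesis by (auto simp: U_def)
      next
        case False
        then show ?thesis using Pdis[of a b b'] \<Psi>P[of a b] UP[of a b'] A J53 by blast
      qed
    next
      fix a a' b b' assume A: "a \<in> I3" "a' \<in> I3" "b \<in> J5" "b' \<in> J5" "(a, b) \<noteq> (a', b')"
      show "U a b \<inter> U a' b' = {}"
      proof (cases "b = b'")
        case True
        then have "a \<noteq> a'" using A by simp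
        moreover have "b \<in> J3" using A J53 by blast
        ultimately show ?thesis using \<Psi> A True unfolding U_def disjoint_family_on_def by blast
      next
        case False
        then have "\<not> R b b'" using J5(3) A by blast
        then show ?thesis using A unfolding R_def by blast
      qed
    qed
    have \<Psi>d: "card (\<Psi> b) \<le> d" if "b \<in> J5" for b
    proof -
      have "finite (P a0 b) \<and> card (P a0 b) \<le> d" "\<Psi> b \<subseteq> P a0 b" using PL \<Psi>P[OF a0] a0 I3A that J53 by blast+
      then show ?thesis by (meson card_mono order_trans)
    qed
    have finJ5: "finite J5" using J53 finJ3 finite_subset by blast
    have sz: "(d + 1) * m \<le> card J5" "(d + 1) * m \<le> card I3" using J5(2) I3(2) by (simp_all add: \<mu>_def)
    have "\<exists>J\<subseteq>J5. card J = m \<and> (\<exists>y. \<forall>b\<in>J. card (\<Psi> b) = y)"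
      by (rule pigeonhole_constant[OF finJ5 sz(1) _ m]) (rule \<Psi>d)
    then obtain B' y where B': "B' \<subseteq> J5" "card B' = m" "\<forall>b\<in>B'. card (\<Psi> b) = y" by blast
    have "\<exists>J\<subseteq>I3. card J = m \<and> (\<exists>x. \<forall>a\<in>J. card (\<Phi> a) = x)"
      by (rule pigeonhole_constant[OF finI3 sz(2) _ m]) (rule \<Phi>d)
    then obtain A' x where A': "A' \<subseteq> I3" "card A' = m" "\<forall>a\<in>A'. card (\<Phi> a) = x" by blast
    have "canonical A' B' L T \<Phi> \<Psi> U" using canonical_mono[OF can A'(1) B'(1)] .
    moreover have "A' \<subseteq> A" "B' \<subseteq> B" using A' B' I3A I1 J53 J3 by blast+
    ultimately show ?thesis using A'(2,3) B'(2,3) by blast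
  qed
  show ?thesis
  proof (intro exI[of _ N] allI impI, rule main)
    fix A B :: "'a set" and L a b
    assume "\<forall>a\<in>A. \<forall>b\<in>B. finite (L a b) \<and> card (L a b) \<le> d" "a \<in> A" "b \<in> B"
    then show "finite (L a b) \<and> card (L a b) \<le> d" by blast
  qed assumption+
qed

section \<open>Paths in labelled grids\<close>

definition cell :: "('a \<Rightarrow> 'a \<Rightarrow> 'a set) \<Rightarrow> 'a \<Rightarrow> 'a \<Rightarrow> 'a \<Rightarrow> 'a set" where
  "cell Z a b c = insert a (insert b (insert c (Z a b)))"

text \<open>The filler \<open>Z a b\<close> brings a cell up to r vertices. Fillers are pairwise
  disjoint and labels stay off rows, columns and fillers, so two cells can meet only in a common
  row, column or label.\<close>

definition grid :: "'a set set \<Rightarrow> 'a set \<Rightarrow> 'a set \<Rightarrow> ('a \<Rightarrow> 'a \<Rightarrow> 'a set) \<Rightarrow> ('a \<Rightarrow> 'a \<Rightarrow> 'a set) \<Rightarrow> bool" where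
  "grid H A B Z L \<longleftrightarrow> finite A \<and> finite B \<and> A \<inter> B = {} \<and>
     (\<forall>a\<in>A. \<forall>b\<in>B. Z a b \<inter> (A \<union> B) = {}) \<and>
     (\<forall>a\<in>A. \<forall>b\<in>B. \<forall>a'\<in>A. \<forall>b'\<in>B. (a, b) \<noteq> (a', b') \<longrightarrow> Z a b \<inter> Z a' b' = {}) \<and>
     (\<forall>a\<in>A. \<forall>b\<in>B. \<forall>c\<in>L a b. c \<notin> A \<union> B \<and> (\<forall>a'\<in>A. \<forall>b'\<in>B. c \<notin> Z a' b') \<and> cell Z a b c \<in> H)"

lemma gridD:
  assumes "grid H A B Z L"
  shows "finite A" "finite B" "A \<inter> B = {}"
    "a \<in> A \<Longrightarrow> b \<in> B \<Longrightarrow> Z a b \<inter> (A \<union> B) = {}"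
    "a \<in> A \<Longrightarrow> b \<in> B \<Longrightarrow> a' \<in> A \<Longrightarrow> b' \<in> B \<Longrightarrow> (a, b) \<noteq> (a', b') \<Longrightarrow> Z a b \<inter> Z a' b' = {}"
    "a \<in> A \<Longrightarrow> b \<in> B \<Longrightarrow> c \<in> L a b \<Longrightarrow> c \<notin> A \<union> B"
    "a \<in> A \<Longrightarrow> b \<in> B \<Longrightarrow> c \<in> L a b \<Longrightarrow> a' \<in> A \<Longrightarrow> b' \<in> B \<Longrightarrow> c \<notin> Z a' b'"
    "a \<in> A \<Longrightarrow> b \<in> B \<Longrightarrow> c \<in> L a b \<Longrightarrow> cell Z a b c \<in> H"
  using assms unfolding grid_def by blast+

lemma grid_mono:
  assumes "grid H A B Z L" "A' \<subseteq> A" "B' \<subseteq> B" "\<And>a b. a \<in> A' \<Longrightarrow> b \<in> B' \<Longrightarrow> L' a b \<subseteq> L a b"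
  shows "grid H A' B' Z L'"
proof -
  note g = gridD[OF assms(1)]
  show ?thesis unfolding grid_def
  proof (intro conjI ballI impI)
    show "finite A'" "finite B'" using g(1,2) assms(2,3) finite_subset by blast+
    show "A' \<inter> B' = {}" using g(3) assms(2,3) by blast
  next
    fix a b assume "a \<in> A'" "b \<in> B'"
    then show "Z a b \<inter> (A' \<union> B') = {}" using g(4)[of a b] assms(2,3) by blast
  next
    fix a b a' b' assume "a \<in> A'" "b \<in> B'" "a' \<in> A'" "b' \<in> B'" "(a, b) \<noteq> (a', b')"
    then show "Z a b \<inter> Z a' b' = {}" using g(5)[of a b a' b'] assms(2,3) by blast
  next
    fix a b c assume "a \<in> A'" "b \<in> B'" "c \<in> L' a b"
    then have *: "a \<in> A" "b \<in> B" "c \<in> L a b" using assms(2-4) by blast+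
    show "c \<notin> A' \<union> B'" using g(6)[OF *] assms(2,3) by blast
    show "cell Z a b c \<in> H" using g(8)[OF *] .
    fix a' b' assume "a' \<in> A'" "b' \<in> B'"
    then show "c \<notin> Z a' b'" using g(7)[OF *, of a' b'] assms(2,3) by blast
  qed
qed

lemma cell_transpose: "cell (\<lambda>b a. Z a b) b a c = cell Z a b c"
  by (auto simp: cell_def)

lemma grid_transpose:
  assumes "grid H A B Z L"
  shows "grid H B A (\<lambda>b a. Z a b) (\<lambda>b a. L a b)"
proof -
  note g = gridD[OF assms]
  show ?thesis unfolding grid_def
  proof (intro conjI ballI impI)
    show "finite A" "finite B" using g(1,2) .
    show "B \<inter> A = {}" using g(3) by blast
  next
    fix b a assume "a \<in> A" "b \<in> B"
    then show "Z a b \<inter> (B \<union> A) = {}" using g(4)[of a b] by blast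
  next
    fix b a b' a' assume "a \<in> A" "b \<in> B" "a' \<in> A" "b' \<in> B" "(b, a) \<noteq> (b', a')"
    then show "Z a b \<inter> Z a' b' = {}" using g(5)[of a b a' b'] by blast
  next
    fix b a c assume *: "b \<in> B" "a \<in> A" "c \<in> L a b"
    show "c \<notin> B \<union> A" using g(6)[OF *(2,1,3)] by blast
    show "cell (\<lambda>b a. Z a b) b a c \<in> H" using g(8)[OF *(2,1,3)] unfolding cell_transpose[of Z b a c] .
    fix b' a' assume "a' \<in> A" "b' \<in> B"
    then show "c \<notin> Z a' b'" using g(7)[OF *(2,1,3), of a' b'] by blast
  qed
qed

lemma cell_inter:
  assumes "grid H A B Z L" "a \<in> A" "b \<in> B" "c \<in> L a b" "a' \<in> A" "b' \<in> B" "c' \<in> L a' b'" "(a, b) \<noteq> (a', b')"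
  shows "cell Z a b c \<inter> cell Z a' b' c' =
    (if a = a' then {a} else {}) \<union> (if b = b' then {b} else {}) \<union> (if c = c' then {c} else {})"
proof -
  note g = gridD[OF assms(1)]
  have "a \<notin> B" "a' \<notin> B" using g(3) assms by auto
  moreover have "Z a b \<inter> (A \<union> B) = {}" "Z a' b' \<inter> (A \<union> B) = {}" using g(4) assms by blast+
  moreover have "c \<notin> A \<union> B" "c' \<notin> A \<union> B" using g(6) assms by blast+
  moreover have "c \<notin> Z a b" "c \<notin> Z a' b'" "c' \<notin> Z a b" "c' \<notin> Z a' b'" using g(7) assms by blast+
  moreover have "Z a b \<inter> Z a' b' = {}" using g(5) assms by blast
  ultimately show ?thesis using assms(2,3,5,6) unfolding cell_def by auto
qed

text \<open>Two ways of choosing a label in every cell. The conditions say that along a path of cells that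
  turns at every step and takes the labels \<open>lam\<close> and \<open>mu\<close> alternately, all labels are distinct.\<close>

definition label_pair :: "'a set \<Rightarrow> 'a set \<Rightarrow> ('a \<Rightarrow> 'a \<Rightarrow> 'a set) \<Rightarrow> ('a \<Rightarrow> 'a \<Rightarrow> 'a) \<Rightarrow> ('a \<Rightarrow> 'a \<Rightarrow> 'a) \<Rightarrow> bool" where
  "label_pair A B L lam mu \<longleftrightarrow>
     (\<forall>a\<in>A. \<forall>b\<in>B. lam a b \<in> L a b \<and> mu a b \<in> L a b) \<and>
     (\<forall>a\<in>A. \<forall>b\<in>B. \<forall>a'\<in>A. \<forall>b'\<in>B. a \<noteq> a' \<longrightarrow> b \<noteq> b' \<longrightarrow> {lam a b, mu a b} \<inter> {lam a' b', mu a' b'} = {}) \<and>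
     (\<forall>a\<in>A. \<forall>b\<in>B. \<forall>a'\<in>A. a \<noteq> a' \<longrightarrow> lam a b \<noteq> mu a' b) \<and>
     (\<forall>a\<in>A. \<forall>b\<in>B. \<forall>b'\<in>B. b \<noteq> b' \<longrightarrow> lam a b \<noteq> mu a b')"

lemma label_pairD:
  assumes "label_pair A B L lam mu" "a \<in> A" "b \<in> B"
  shows "lam a b \<in> L a b" "mu a b \<in> L a b"
    "a' \<in> A \<Longrightarrow> b' \<in> B \<Longrightarrow> a \<noteq> a' \<Longrightarrow> b \<noteq> b' \<Longrightarrow> {lam a b, mu a b} \<inter> {lam a' b', mu a' b'} = {}"
    "a' \<in> A \<Longrightarrow> a \<noteq> a' \<Longrightarrow> lam a b \<noteq> mu a' b"
    "b' \<in> B \<Longrightarrow> b \<noteq> b' \<Longrightarrow> lam a b \<noteq> mu a b'"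
  using assms unfolding label_pair_def by blast+

text \<open>\<open>n\<close> is the index of the last hyperedge, so there are \<open>n + 1\<close>.
  \<open>X\<close> is going to contain the closing hyperedges, which the path may touch in its end
  vertices \<open>a\<close> and \<open>b\<close> only.\<close>

definition lin_path_between :: "'a set set \<Rightarrow> (nat \<Rightarrow> 'a set) \<Rightarrow> nat \<Rightarrow> 'a \<Rightarrow> 'a \<Rightarrow> 'a set \<Rightarrow> bool" where
  "lin_path_between H e n a b X \<longleftrightarrow> (\<forall>i\<le>n. e i \<in> H \<and> e i \<inter> X \<subseteq> {a, b}) \<and> lin_path e (Suc n) \<and>
     (\<forall>i\<le>n. a \<in> e i \<longleftrightarrow> i = 0) \<and> (\<forall>i\<le>n. b \<in> e i \<longleftrightarrow> i = n)"

text \<open>A staircase: with rows \<rho> 0 = a0, ..., \<rho> h and columns \<kappa> 0, ...,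
  \<kappa> h = b0 the cells (0, 0), (1, 0), (1, 1), (2, 1), ..., (h, h) turn at every step, and
  non-consecutive ones share neither row nor column. Only the first cell lies in row
  \<open>a0\<close> and only the last in column \<open>b0\<close>.\<close>

lemma path_between:
  assumes G: "grid H A B Z L" and lp: "label_pair A B L lam mu" and ab: "a0 \<in> A" "b0 \<in> B"
    and X: "finite X" and bA: "card {a\<in>A. mu a b0 \<in> X} \<le> card X" and bB: "card {b\<in>B. mu a0 b \<in> X} \<le> card X"
    and cA: "4 * card X + h + 1 \<le> card A" and cB: "4 * card X + h + 1 \<le> card B" and h: "h \<ge> 1"
  shows "\<exists>e. lin_path_between H e (2 * h) a0 b0 X"
proof -
  note g = gridD[OF G] and l = label_pairD[OF lp]
  \<comment> \<open>One witness cell per vertex is enough: by \<open>label_pair\<close> two cells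
    with a common label share a row or a column, and fillers are disjoint. A cell off the row and
    the column of the witness therefore avoids the vertex.\<close>
  define pl where "pl x = (SOME p. fst p \<in> A \<and> snd p \<in> B \<and> x \<in> {lam (fst p) (snd p), mu (fst p) (snd p)})" for x
  define pz where "pz x = (SOME p. fst p \<in> A \<and> snd p \<in> B \<and> x \<in> Z (fst p) (snd p))" for x
  have pl: "fst (pl x) \<in> A \<and> snd (pl x) \<in> B \<and> x \<in> {lam (fst (pl x)) (snd (pl x)), mu (fst (pl x)) (snd (pl x))}"
    if "a \<in> A" "b \<in> B" "x \<in> {lam a b, mu a b}" for x a b
    unfolding pl_def by (rule someI[of _ "(a, b)"]) (use that in simp)
  have pz: "fst (pz x) \<in> A \<and> snd (pz x) \<in> B \<and> x \<in> Z (fst (pz x)) (snd (pz x))"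
    if "a \<in> A" "b \<in> B" "x \<in> Z a b" for x a b
    unfolding pz_def by (rule someI[of _ "(a, b)"]) (use that in simp)
  \<comment> \<open>Besides \<open>a0\<close>, at most \<open>card X\<close> rows each come from
    \<open>X\<close>, from witnesses for labels, from witnesses for fillers, and from the label of
    the last cell, which lies in the prescribed column \<open>b0\<close>. This is the origin of
    \<open>4 * card X + 1\<close>.\<close>
  define BA where "BA = insert a0 (X \<union> (fst \<circ> pl) ` X \<union> (fst \<circ> pz) ` X \<union> {a\<in>A. mu a b0 \<in> X})"
  define BB where "BB = insert b0 (X \<union> (snd \<circ> pl) ` X \<union> (snd \<circ> pz) ` X \<union> {b\<in>B. mu a0 b \<in> X})"
  have cc: "card (insert y (X \<union> f ` X \<union> g ` X \<union> S)) \<le> 4 * card X + 1" if "card S \<le> card X"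
    for f g :: "'a \<Rightarrow> 'a" and y S
  proof -
    have "card (insert y (X \<union> f ` X \<union> g ` X \<union> S)) \<le> Suc (card (X \<union> f ` X \<union> g ` X \<union> S))"
      by (metis card_insert_le_m1 diff_Suc_1 order_refl zero_less_Suc)
    also have "card (X \<union> f ` X \<union> g ` X \<union> S) \<le> card X + card (f ` X) + card (g ` X) + card S"
      by (intro order_trans[OF card_Un_le] add_mono order_refl)
    also have "\<dots> \<le> 4 * card X" using card_image_le[OF X, of f] card_image_le[OF X, of g] that by linarith
    finally show ?thesis by simp
  qed
  have finBA: "finite BA" "finite BB" using X g(1,2) by (auto simp: BA_def BB_def)
  have "card BA \<le> 4 * card X + 1" "card BB \<le> 4 * card X + 1"
    unfolding BA_def BB_def using cc bA bB by blast+
  then have "h \<le> card (A - BA)" "h \<le> card (B - BB)"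
    using cA cB diff_card_le_card_Diff[OF finBA(1), of A] diff_card_le_card_Diff[OF finBA(2), of B] by linarith+
  then obtain R C where RC: "R ` {1..h} \<subseteq> A - BA" "inj_on R {1..h}" "C ` {..<h} \<subseteq> B - BB" "inj_on C {..<h}"
    using card_le_inj[of "{1..h}" "A - BA"] card_le_inj[of "{..<h}" "B - BB"] g(1,2) by auto
  define \<rho> where "\<rho> i = (if i = 0 then a0 else R i)" for i
  define \<kappa> where "\<kappa> i = (if i = h then b0 else C i)" for i
  have \<rho>A: "\<rho> i \<in> A" if "i \<le> h" for i using RC(1) ab that by (auto simp: \<rho>_def image_subset_iff)
  have \<kappa>B: "\<kappa> i \<in> B" if "i \<le> h" for i using RC(3) ab that by (auto simp: \<kappa>_def image_subset_iff)
  have a0BA: "a0 \<in> BA" "b0 \<in> BB" by (auto simp: BA_def BB_def)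
  have \<rho>f: "\<rho> i \<notin> BA" if "0 < i" "i \<le> h" for i using RC(1) that by (auto simp: \<rho>_def image_subset_iff)
  have \<kappa>f: "\<kappa> i \<notin> BB" if "i < h" for i using RC(3) that by (auto simp: \<kappa>_def image_subset_iff)
  have \<rho>inj: "\<rho> i = \<rho> j \<longleftrightarrow> i = j" if "i \<le> h" "j \<le> h" for i j
  proof (cases "i = 0 \<or> j = 0")
    case True
    then show ?thesis using \<rho>f[of i] \<rho>f[of j] that a0BA by (auto simp: \<rho>_def)
  next
    case False
    then show ?thesis using inj_on_eq_iff[OF RC(2), of i j] that by (simp add: \<rho>_def)
  qed
  have \<kappa>inj: "\<kappa> i = \<kappa> j \<longleftrightarrow> i = j" if "i \<le> h" "j \<le> h" for i j
  proof (cases "i = h \<or> j = h")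
    case True
    then show ?thesis using \<kappa>f[of i] \<kappa>f[of j] that a0BA by (auto simp: \<kappa>_def)
  next
    case False
    then show ?thesis using inj_on_eq_iff[OF RC(4), of i j] that by (simp add: \<kappa>_def)
  qed
  \<comment> \<open>Row and column index of the cell \<open>i\<close>; exactly one of them advances
    at each step.\<close>
  define rr where "rr i = (i + 1) div 2" for i :: nat
  define ck where "ck i = i div 2" for i :: nat
  have rrck: "rr i + ck i = i" for i
    by (cases "even i") (auto simp: rr_def ck_def elim!: evenE oddE)
  \<comment> \<open>Even cells, in particular both end cells, take \<open>mu\<close>. So only
    occurrences of \<open>mu\<close> in the row \<open>a0\<close> and the column \<open>b0\<close>
    have to be bounded, and neighbouring cells always compare a \<open>lam\<close> with a
    \<open>mu\<close>.\<close>
  define lab where "lab i = (if even i then mu (\<rho> (rr i)) (\<kappa> (ck i)) else lam (\<rho> (rr i)) (\<kappa> (ck i)))" for i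
  define e where "e i = cell Z (\<rho> (rr i)) (\<kappa> (ck i)) (lab i)" for i
  have idx: "rr i \<le> h" "ck i \<le> h" if "i \<le> 2 * h" for i
    using that by (auto simp: rr_def ck_def)
  have labL: "lab i \<in> L (\<rho> (rr i)) (\<kappa> (ck i))" if "i \<le> 2 * h" for i
    unfolding lab_def using l(1,2) \<rho>A \<kappa>B idx[OF that] by simp
  have labs: "lab i \<in> {lam (\<rho> (rr i)) (\<kappa> (ck i)), mu (\<rho> (rr i)) (\<kappa> (ck i))}" for i
    by (simp add: lab_def)
  have eH: "e i \<in> H" if "i \<le> 2 * h" for i
    unfolding e_def using g(8) \<rho>A \<kappa>B idx[OF that] labL[OF that] by blast
  have eX: "e i \<inter> X \<subseteq> {a0, b0}" if i: "i \<le> 2 * h" for i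
  proof
    fix x assume x: "x \<in> e i \<inter> X"
    let ?a = "\<rho> (rr i)" and ?b = "\<kappa> (ck i)"
    have aA: "?a \<in> A" and bB: "?b \<in> B" using \<rho>A \<kappa>B idx[OF i] by blast+
    have fresh: "?a \<notin> BA \<or> ?a = a0 \<and> i = 0" "?b \<notin> BB \<or> ?b = b0 \<and> i = 2 * h"
    proof -
      show "?a \<notin> BA \<or> ?a = a0 \<and> i = 0" using \<rho>f[of "rr i"] idx[OF i]
        by (cases "i = 0") (auto simp: \<rho>_def rr_def)
      show "?b \<notin> BB \<or> ?b = b0 \<and> i = 2 * h"
      proof (cases "i = 2 * h")
        case False
        then have "ck i < h" using i by (auto simp: ck_def)
        then show ?thesis using \<kappa>f by blast
      qed (simp add: \<kappa>_def ck_def)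
    qed
    have fresh': "?a \<notin> BA \<or> ?b \<notin> BB" using fresh h by auto
    consider "x = ?a" | "x = ?b" | "x = lab i" | "x \<in> Z ?a ?b" using x unfolding e_def cell_def by blast
    then show "x \<in> {a0, b0}"
    proof cases
      case 1
      then show ?thesis using fresh(1) x by (auto simp: BA_def)
    next
      case 2
      then show ?thesis using fresh(2) x by (auto simp: BB_def)
    next
      case 3
      have p: "fst (pl x) \<in> A" "snd (pl x) \<in> B" "x \<in> {lam (fst (pl x)) (snd (pl x)), mu (fst (pl x)) (snd (pl x))}"
        using pl[OF aA bB, of x] labs[of i] 3 by auto
      have "fst (pl x) \<in> BA" "snd (pl x) \<in> BB" using x by (auto simp: BA_def BB_def)
      show ?thesis
      proof (cases "?a \<notin> BA \<and> ?b \<notin> BB")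
        case True
        then have "?a \<noteq> fst (pl x)" "?b \<noteq> snd (pl x)" using \<open>fst (pl x) \<in> BA\<close> \<open>snd (pl x) \<in> BB\<close> by auto
        then have False using l(3)[OF aA bB p(1,2)] p(3) labs[of i] 3 by blast
        then show ?thesis ..
      next
        case False
        then consider "i = 0" "?a = a0" "?b \<notin> BB" | "i = 2 * h" "?b = b0" "?a \<notin> BA" using fresh fresh' by blast
        then have False
        proof cases
          case 1
          then have "mu a0 ?b \<in> X" using 3 x unfolding lab_def by simp
          then show False using 1 bB by (auto simp: BB_def)
        next
          case 2
          then have "mu ?a b0 \<in> X" using 3 x by (simp add: lab_def)
          then show False using 2 aA by (auto simp: BA_def)
        qed
        then show ?thesis ..
      qed
    next
      case 4
      have p: "fst (pz x) \<in> A" "snd (pz x) \<in> B" "x \<in> Z (fst (pz x)) (snd (pz x))"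
        using pz[OF aA bB 4] by auto
      have "fst (pz x) \<in> BA" "snd (pz x) \<in> BB" using x by (auto simp: BA_def BB_def)
      then have "(?a, ?b) \<noteq> (fst (pz x), snd (pz x))"
        using fresh' unfolding prod.inject by auto
      then have False using g(5)[OF aA bB p(1,2)] p(3) 4 by blast
      then show ?thesis ..
    qed
  qed
  have int: "e i \<inter> e j = (if rr i = rr j then {\<rho> (rr i)} else {}) \<union>
      (if ck i = ck j then {\<kappa> (ck i)} else {})" if ij: "i < j" "j \<le> 2 * h" for i j
  proof -
    have i: "i \<le> 2 * h" using ij by simp
    note ii = idx[OF i] idx[OF ij(2)]
    have ne: "(\<rho> (rr i), \<kappa> (ck i)) \<noteq> (\<rho> (rr j), \<kappa> (ck j))"
    proof -
      have "rr i \<noteq> rr j \<or> ck i \<noteq> ck j" using ij(1) rrck[of i] rrck[of j] by auto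
      then show ?thesis using \<rho>inj[OF ii(1,3)] \<kappa>inj[OF ii(2,4)] by auto
    qed
    have "lab i \<noteq> lab j"
    proof -
      consider "j = Suc i" "even i" | "j = Suc i" "odd i" | "Suc i < j" using ij by linarith
      then show ?thesis
      proof cases
        case 1
        then have d: "ck j = ck i" "rr j \<noteq> rr i" "odd j" by (auto simp: rr_def ck_def elim!: evenE)
        then have "\<rho> (rr j) \<noteq> \<rho> (rr i)" using \<rho>inj[OF ii(3,1)] by auto
        then have "lam (\<rho> (rr j)) (\<kappa> (ck i)) \<noteq> mu (\<rho> (rr i)) (\<kappa> (ck i))"
          using l(4) \<rho>A \<kappa>B ii by blast
        then show ?thesis using 1 d by (simp add: lab_def)
      next
        case 2
        then have d: "rr j = rr i" "ck j \<noteq> ck i" "even j" by (auto simp: rr_def ck_def elim!: oddE)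
        then have "\<kappa> (ck j) \<noteq> \<kappa> (ck i)" using \<kappa>inj[OF ii(4,2)] by auto
        then have "lam (\<rho> (rr i)) (\<kappa> (ck i)) \<noteq> mu (\<rho> (rr i)) (\<kappa> (ck j))"
          using l(5) \<rho>A \<kappa>B ii by metis
        then show ?thesis using 2 d by (simp add: lab_def)
      next
        case 3
        then have "rr i \<noteq> rr j" "ck i \<noteq> ck j" unfolding rr_def ck_def by linarith+
        then have "\<rho> (rr i) \<noteq> \<rho> (rr j)" "\<kappa> (ck i) \<noteq> \<kappa> (ck j)"
          using \<rho>inj[OF ii(1,3)] \<kappa>inj[OF ii(2,4)] by auto
        then show ?thesis
          using l(3)[OF \<rho>A[OF ii(1)] \<kappa>B[OF ii(2)] \<rho>A[OF ii(3)] \<kappa>B[OF ii(4)]] labs[of i] labs[of j] by auto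
      qed
    qed
    then show ?thesis unfolding e_def
      using cell_inter[OF G \<rho>A[OF ii(1)] \<kappa>B[OF ii(2)] labL[OF i] \<rho>A[OF ii(3)] \<kappa>B[OF ii(4)] labL[OF ij(2)] ne]
        \<rho>inj[OF ii(1,3)] \<kappa>inj[OF ii(2,4)] by simp
  qed
  have "lin_path e (Suc (2 * h))" unfolding lin_path_def
  proof (intro allI impI)
    fix i j assume ij: "i < j" "j < Suc (2 * h)"
    show "if j = Suc i then is_singleton (e i \<inter> e j) else e i \<inter> e j = {}"
    proof (cases "j = Suc i")
      case True
      then have "rr i = rr j \<longleftrightarrow> ck i \<noteq> ck j"
        by (cases "even i") (auto simp: rr_def ck_def elim!: evenE oddE)
      then show ?thesis using int[of i j] ij True by auto
    next
      case False
      then have "rr i \<noteq> rr j" "ck i \<noteq> ck j" using ij unfolding rr_def ck_def by linarith+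
      then show ?thesis using int[of i j] ij False by auto
    qed
  qed
  moreover have "a0 \<in> e i \<longleftrightarrow> i = 0" if i: "i \<le> 2 * h" for i
  proof -
    have "a0 \<in> e i \<longleftrightarrow> a0 = \<rho> (rr i)"
      using g(3) g(4)[OF \<rho>A[OF idx(1)[OF i]] \<kappa>B[OF idx(2)[OF i]]]
        g(6)[OF \<rho>A[OF idx(1)[OF i]] \<kappa>B[OF idx(2)[OF i]] labL[OF i]] \<kappa>B[OF idx(2)[OF i]] ab unfolding e_def cell_def by blast
    also have "\<dots> \<longleftrightarrow> rr i = 0" using \<rho>inj[of 0 "rr i"] idx[OF i] by (auto simp: \<rho>_def)
    also have "\<dots> \<longleftrightarrow> i = 0" unfolding rr_def by linarith
    finally show ?thesis .
  qed
  moreover have "b0 \<in> e i \<longleftrightarrow> i = 2 * h" if i: "i \<le> 2 * h" for i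
  proof -
    have "b0 \<in> e i \<longleftrightarrow> b0 = \<kappa> (ck i)"
      using g(3) g(4)[OF \<rho>A[OF idx(1)[OF i]] \<kappa>B[OF idx(2)[OF i]]]
        g(6)[OF \<rho>A[OF idx(1)[OF i]] \<kappa>B[OF idx(2)[OF i]] labL[OF i]] \<rho>A[OF idx(1)[OF i]] ab unfolding e_def cell_def by blast
    also have "\<dots> \<longleftrightarrow> ck i = h" using \<kappa>inj[of h "ck i"] idx[OF i] by (auto simp: \<kappa>_def)
    also have "\<dots> \<longleftrightarrow> i = 2 * h" using i unfolding ck_def by linarith
    finally show ?thesis .
  qed
  ultimately have "lin_path_between H e (2 * h) a0 b0 X" unfolding lin_path_between_def using eH eX by simp
  then show ?thesis by (intro exI[of _ e])
qed

section \<open>Closing paths of cells to cycles\<close>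

text \<open>\<open>g\<close> lies in the avoided set \<open>X\<close>, so the path meets it in
  \<open>a\<close> and \<open>b\<close> only. The paths available have even \<open>n\<close>, so
  this yields the even lengths.\<close>

lemma even_cycle_closing:
  assumes p: "lin_path_between H e n a b X" and g: "g \<in> H" "g \<subseteq> X" "a \<in> g" "b \<in> g" and n: "n \<ge> 2"
  shows "lin_cycle (e(Suc n := g)) (n + 2)"
proof -
  have eg: "e i \<inter> g = (if i = 0 then {a} else if i = n then {b} else {})" if "i \<le> n" for i
  proof -
    have "e i \<inter> X \<subseteq> {a, b}" "a \<in> e i \<longleftrightarrow> i = 0" "b \<in> e i \<longleftrightarrow> i = n"
      using p that unfolding lin_path_between_def by simp_all
    then show ?thesis using g n by auto
  qed
  show ?thesis unfolding lin_cycle_def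
  proof (intro allI impI)
    fix i j assume ij: "i < j" "j < n + 2"
    show "if j = Suc i \<or> i = 0 \<and> Suc j = n + 2 then is_singleton ((e(Suc n := g)) i \<inter> (e(Suc n := g)) j)
        else (e(Suc n := g)) i \<inter> (e(Suc n := g)) j = {}"
    proof (cases "j = Suc n")
      case True
      then show ?thesis using eg[of i] ij n by auto
    next
      case False
      then have "j < Suc n" using ij by simp
      then have "if j = Suc i then is_singleton (e i \<inter> e j) else e i \<inter> e j = {}"
        using p ij unfolding lin_path_between_def lin_path_def by blast
      then show ?thesis using \<open>j < Suc n\<close> ij by auto
    qed
  qed
qed

text \<open>Closing by two hyperedges instead of one changes the parity of the length.\<close>

lemma odd_cycle_closing:
  assumes p: "lin_path_between H e n a b X" and g: "g \<in> H" "g \<subseteq> X" "b \<in> g" "a \<notin> g"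
    and g': "g' \<in> H" "g' \<subseteq> X" "a \<in> g'" "b \<notin> g'" and gg: "is_singleton (g \<inter> g')" and n: "n \<ge> 2"
  shows "lin_cycle (e(Suc n := g, n + 2 := g')) (n + 3)"
proof -
  have eg: "e i \<inter> g = (if i = n then {b} else {})" "e i \<inter> g' = (if i = 0 then {a} else {})" if "i \<le> n" for i
  proof -
    have "e i \<inter> X \<subseteq> {a, b}" "a \<in> e i \<longleftrightarrow> i = 0" "b \<in> e i \<longleftrightarrow> i = n"
      using p that unfolding lin_path_between_def by simp_all
    then show "e i \<inter> g = (if i = n then {b} else {})" "e i \<inter> g' = (if i = 0 then {a} else {})"
      using g g' by auto
  qed
  let ?e = "e(Suc n := g, n + 2 := g')"
  show ?thesis unfolding lin_cycle_def
  proof (intro allI impI)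
    fix i j assume ij: "i < j" "j < n + 3"
    show "if j = Suc i \<or> i = 0 \<and> Suc j = n + 3 then is_singleton (?e i \<inter> ?e j) else ?e i \<inter> ?e j = {}"
    proof -
      consider "j = n + 2" "i = Suc n" | "j = n + 2" "i \<le> n" | "j = Suc n" "i \<le> n" | "j \<le> n" using ij by linarith
      then show ?thesis
      proof cases
        case 1
        then show ?thesis using gg by simp
      next
        case 2
        then show ?thesis using eg[of i] ij n by auto
      next
        case 3
        then show ?thesis using eg[of i] ij n by auto
      next
        case 4
        then have "if j = Suc i then is_singleton (e i \<inter> e j) else e i \<inter> e j = {}"
          using p ij unfolding lin_path_between_def lin_path_def by (meson less_Suc_eq_le)
        then show ?thesis using 4 ij by auto
      qed
    qed
  qed
qed

lemma embeds_component:
  assumes "uniform r H" "r \<ge> 3" "l \<ge> 5" "\<And>i. i < l \<Longrightarrow> e i \<in> H"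
    and "Q = expansion r (path_graph l) \<and> lin_path e l \<or> Q = expansion r (cycle_graph l) \<and> lin_cycle e l"
  shows "embeds Q H (\<Union>i<l. e i) \<and> finite (\<Union>i<l. e i) \<and> card (\<Union>i<l. e i) \<le> l * r"
proof -
  have e: "e i \<in> H \<and> finite (e i) \<and> card (e i) = r" if "i < l" for i
    using assms that by (auto simp: uniform_def)
  have "embeds Q H (\<Union>i<l. e i)"
    using assms(5)
  proof
    assume "Q = expansion r (path_graph l) \<and> lin_path e l"
    then show ?thesis using embeds_path[of l r e H] e assms by simp
  next
    assume "Q = expansion r (cycle_graph l) \<and> lin_cycle e l"
    then show ?thesis using embeds_cycle[of l e H r] e assms by simp
  qed
  moreover have "card (\<Union>i<l. e i) \<le> card {..<l} * r" using e by (intro card_UN_le_mult) auto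
  ultimately show ?thesis using e by auto
qed

text \<open>A component with no limit on the number of labels used: \<open>g\<close> and \<open>g'\<close> close a path of cells to an
  odd cycle, \<open>cell Z a0 b0 (lam a0 b0)\<close> closes it to an even cycle.\<close>

lemma light_component:
  assumes G: "grid H A B Z L" and lp: "label_pair A B L lam mu" and ab: "a0 \<in> A" "b0 \<in> B"
    and u: "uniform r H" and r: "r \<ge> 3" and l: "l \<ge> 5"
    and Q: "Q \<in> {expansion r (path_graph l), expansion r (cycle_graph l)}"
    and g: "g \<in> H" "b0 \<in> g" "a0 \<notin> g" and g': "g' \<in> H" "a0 \<in> g'" "b0 \<notin> g'" and gg: "is_singleton (g \<inter> g')"
    and R: "cell Z a0 b0 (lam a0 b0) \<union> g \<union> g' \<subseteq> R"
    and bnd: "\<And>Y. finite Y \<Longrightarrow> Y \<inter> R \<subseteq> cell Z a0 b0 (lam a0 b0) \<or> Y \<inter> R \<subseteq> g \<union> g' \<Longrightarrow>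
        card {a\<in>A. mu a b0 \<in> Y} \<le> card Y \<and> card {b\<in>B. mu a0 b \<in> Y} \<le> card Y"
    and X: "finite X" "X \<inter> R = {}" and cA: "4 * (card X + 2 * r) + l + 1 \<le> card A"
    and cB: "4 * (card X + 2 * r) + l + 1 \<le> card B"
  shows "\<exists>S. embeds Q H S \<and> S \<inter> X = {} \<and> finite S \<and> card S \<le> l * r"
proof -
  define g0 where "g0 = cell Z a0 b0 (lam a0 b0)"
  have g0: "g0 \<in> H" "a0 \<in> g0" "b0 \<in> g0"
    using gridD(8)[OF G ab] label_pairD(1)[OF lp ab] by (auto simp: g0_def cell_def)
  \<comment> \<open>\<open>Y\<close> consists of the closing hyperedges; adding it to the avoided
    set makes the path touch it only in \<open>a0\<close> and \<open>b0\<close>.\<close>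
  have path: "\<exists>e. lin_path_between H e (2 * h) a0 b0 (X \<union> Y)" if "Y = g0 \<or> Y = g \<union> g'" "1 \<le> h" "h \<le> l" for h Y
  proof (rule path_between[OF G lp ab])
    have finY: "finite Y" using that g g' g0 u by (auto simp: uniform_def)
    then show "finite (X \<union> Y)" using X by simp
    have "card g + card g' \<le> 2 * r" "card g0 \<le> 2 * r" using g g' g0 u by (auto simp: uniform_def)
    moreover have "card (g \<union> g') \<le> card g + card g'" by (rule card_Un_le)
    ultimately have "card Y \<le> 2 * r" using that(1) by auto
    then have "card (X \<union> Y) \<le> card X + 2 * r" using card_Un_le[of X Y] by linarith
    then show "4 * card (X \<union> Y) + h + 1 \<le> card A" "4 * card (X \<union> Y) + h + 1 \<le> card B"
      using cA cB that(3) by simp_all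
    have "(X \<union> Y) \<inter> R \<subseteq> cell Z a0 b0 (lam a0 b0) \<or> (X \<union> Y) \<inter> R \<subseteq> g \<union> g'"
      using that(1) X(2) unfolding g0_def by blast
    then show "card {a \<in> A. mu a b0 \<in> X \<union> Y} \<le> card (X \<union> Y)" "card {b \<in> B. mu a0 b \<in> X \<union> Y} \<le> card (X \<union> Y)"
      using bnd[of "X \<union> Y"] finY X by auto
  qed (use that in auto)
  have X0: "a0 \<notin> X" "b0 \<notin> X" "g \<inter> X = {}" "g' \<inter> X = {}" "g0 \<inter> X = {}"
    using X(2) R g g' unfolding g0_def by blast+
  have av: "e i \<in> H \<and> e i \<inter> X = {}" if "lin_path_between H e n a0 b0 (X \<union> Y)" "i \<le> n" for e n Y i
  proof -
    have "e i \<in> H" "e i \<inter> (X \<union> Y) \<subseteq> {a0, b0}" using that unfolding lin_path_between_def by simp_all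
    then show ?thesis using X0(1,2) by auto
  qed
  have "\<exists>e. (\<forall>i<l. e i \<in> H \<and> e i \<inter> X = {}) \<and>
     (Q = expansion r (path_graph l) \<and> lin_path e l \<or> Q = expansion r (cycle_graph l) \<and> lin_cycle e l)"
  proof (cases "Q = expansion r (path_graph l)")
    case True
    \<comment> \<open>A path requires no closing: the first \<open>l\<close> of the
      \<open>2 * l + 1\<close> cells suffice.\<close>
    obtain e where e: "lin_path_between H e (2 * l) a0 b0 (X \<union> g0)" using path[of g0 l] l by auto
    have "lin_path e l" using e lin_path_prefix[of e "Suc (2 * l)" l] by (simp add: lin_path_between_def)
    moreover have "e i \<in> H \<and> e i \<inter> X = {}" if "i < l" for i
      using av[OF e, of i] that by simp
    ultimately show ?thesis using True by blast
  next
    case False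
    then have Qc: "Q = expansion r (cycle_graph l)" using Q by simp
    show ?thesis
    proof (cases "even l")
      case True
      \<comment> \<open>\<open>2 * h + 1\<close> cells and one closing hyperedge.\<close>
      define h where "h = (l - 2) div 2"
      have h: "l = 2 * h + 2" "1 \<le> h" "h \<le> l" using True l by (auto simp: h_def elim!: evenE)
      obtain e where e: "lin_path_between H e (2 * h) a0 b0 (X \<union> g0)" using path[of g0 h] h by auto
      have "lin_cycle (e(Suc (2 * h) := g0)) l" unfolding h(1)
        by (rule even_cycle_closing[OF e]) (use g0 h in auto)
      moreover have "(e(Suc (2 * h) := g0)) i \<in> H \<and> (e(Suc (2 * h) := g0)) i \<inter> X = {}" if "i < l" for i
      proof (cases "i = Suc (2 * h)")
        case True
        then show ?thesis using g0 X0 by simp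
      next
        case False
        then have "i \<le> 2 * h" using that h by simp
        then show ?thesis using False av[OF e, of i] by simp
      qed
      ultimately show ?thesis using Qc by blast
    next
      case False
      \<comment> \<open>\<open>2 * h + 1\<close> cells and two closing hyperedges;
        \<open>l \<ge> 5\<close> ensures \<open>h \<ge> 1\<close>.\<close>
      define h where "h = (l - 3) div 2"
      have h: "l = 2 * h + 3" "1 \<le> h" "h \<le> l" using False l by (auto simp: h_def elim!: oddE)
      obtain e where e: "lin_path_between H e (2 * h) a0 b0 (X \<union> (g \<union> g'))" using path[of "g \<union> g'" h] h by auto
      let ?e = "e(Suc (2 * h) := g, 2 * h + 2 := g')"
      have "lin_cycle ?e l" unfolding h(1)
        by (rule odd_cycle_closing[OF e]) (use g g' gg h in auto)
      moreover have "?e i \<in> H \<and> ?e i \<inter> X = {}" if "i < l" for i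
      proof (cases "i = Suc (2 * h) \<or> i = 2 * h + 2")
        case True
        then show ?thesis using g g' X0 by auto
      next
        case False
        then have "i \<le> 2 * h" using that h by auto
        then show ?thesis using False av[OF e, of i] by simp
      qed
      ultimately show ?thesis using Qc by blast
    qed
  qed
  then obtain e where e: "\<And>i. i < l \<Longrightarrow> e i \<in> H \<and> e i \<inter> X = {}"
     "Q = expansion r (path_graph l) \<and> lin_path e l \<or> Q = expansion r (cycle_graph l) \<and> lin_cycle e l" by blast
  have "embeds Q H (\<Union>i<l. e i) \<and> finite (\<Union>i<l. e i) \<and> card (\<Union>i<l. e i) \<le> l * r"
    by (rule embeds_component[OF u r l _ e(2)]) (use e(1) in blast)
  moreover have "(\<Union>i<l. e i) \<inter> X = {}" using e(1) by blast
  ultimately show ?thesis by blast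
qed

section \<open>Embeddings with common labels\<close>

lemma div2_eq_iff: "n < m \<Longrightarrow> n div 2 = m div 2 \<longleftrightarrow> even n \<and> m = Suc (n::nat)"
  by (cases "even n"; cases "even m") (auto elim!: evenE oddE)

lemma Suc_div2_eq_iff: "n < m \<Longrightarrow> Suc n div 2 = Suc m div 2 \<longleftrightarrow> odd n \<and> m = Suc (n::nat)"
  using div2_eq_iff[of "Suc n" "Suc m"] by auto

text \<open>By \<open>cell_inter\<close>, linearity can be read off from the index functions:
  exactly one of row, column and label agrees for neighbours, none for other pairs.\<close>

lemma cells_linear:
  assumes G: "grid H A B Z L"
    and mem: "\<And>n. n < l \<Longrightarrow> \<rho> n \<in> A \<and> \<kappa> n \<in> B \<and> lab n \<in> L (\<rho> n) (\<kappa> n)"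
    and nm: "n < l" "m < l"
    and adj: "P \<Longrightarrow> \<rho> n = \<rho> m \<and> \<kappa> n \<noteq> \<kappa> m \<and> lab n \<noteq> lab m \<or> \<rho> n \<noteq> \<rho> m \<and> \<kappa> n = \<kappa> m \<and> lab n \<noteq> lab m \<or>
        \<rho> n \<noteq> \<rho> m \<and> \<kappa> n \<noteq> \<kappa> m \<and> lab n = lab m"
    and nadj: "\<not> P \<Longrightarrow> \<rho> n \<noteq> \<rho> m \<and> \<kappa> n \<noteq> \<kappa> m \<and> lab n \<noteq> lab m"
  shows "if P then is_singleton (cell Z (\<rho> n) (\<kappa> n) (lab n) \<inter> cell Z (\<rho> m) (\<kappa> m) (lab m))
    else cell Z (\<rho> n) (\<kappa> n) (lab n) \<inter> cell Z (\<rho> m) (\<kappa> m) (lab m) = {}"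
proof -
  have "(\<rho> n, \<kappa> n) \<noteq> (\<rho> m, \<kappa> m)" using adj nadj by auto
  then have *: "cell Z (\<rho> n) (\<kappa> n) (lab n) \<inter> cell Z (\<rho> m) (\<kappa> m) (lab m) =
    (if \<rho> n = \<rho> m then {\<rho> n} else {}) \<union> (if \<kappa> n = \<kappa> m then {\<kappa> n} else {}) \<union> (if lab n = lab m then {lab n} else {})"
    using mem[OF nm(1)] mem[OF nm(2)] by (intro cell_inter[OF G]) auto
  show ?thesis
  proof (cases P)
    case True
    from adj[OF True] show ?thesis unfolding * using True by (elim disjE) auto
  next
    case False
    from nadj[OF False] show ?thesis unfolding * using False by auto
  qed
qed

text \<open>A component whose cover consists of the \<open>\<tau> - 1\<close> common labels \<open>s i\<close> and of one more vertex: a further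
  common label if \<open>c\<close> holds, and otherwise a column (the labels \<open>\<omega> a\<close> then only fill up the hyperedges).\<close>

lemma heavy_component:
  assumes G: "grid H A B Z L" and u: "uniform r H" and r: "r \<ge> 3" and l: "l \<ge> 5" and \<tau>: "\<tau> = (l + 1) div 2"
    and Q: "Q \<in> {expansion r (path_graph l), expansion r (cycle_graph l)}"
    and s: "inj_on s {..<\<tau> - 1}" "\<And>i a b. i < \<tau> - 1 \<Longrightarrow> a \<in> A \<Longrightarrow> b \<in> B \<Longrightarrow> s i \<in> L a b"
    and \<omega>: "\<And>a b. a \<in> A \<Longrightarrow> b \<in> B \<Longrightarrow> \<omega> a \<in> L a b" "\<And>a i. a \<in> A \<Longrightarrow> i < \<tau> - 1 \<Longrightarrow> \<omega> a \<noteq> s i"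
    and c: "c \<and> (\<forall>a\<in>A. \<omega> a = w) \<or> \<not> c \<and> inj_on \<omega> A"
    and X: "finite X" "\<And>i. i < \<tau> - 1 \<Longrightarrow> s i \<notin> X" "c \<Longrightarrow> w \<notin> X"
    and cA: "3 * card X + \<tau> + 1 \<le> card A" and cB: "card X + 2 * \<tau> \<le> card B"
  shows "\<exists>S. embeds Q H S \<and> S \<inter> X = {} \<and> finite S \<and> card S \<le> l * r"
proof -
  note g = gridD[OF G]
  define pz where "pz x = (SOME p. fst p \<in> A \<and> snd p \<in> B \<and> x \<in> Z (fst p) (snd p))" for x
  have pz: "fst (pz x) \<in> A \<and> snd (pz x) \<in> B \<and> x \<in> Z (fst (pz x)) (snd (pz x))"
    if "a \<in> A" "b \<in> B" "x \<in> Z a b" for x a b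
    unfolding pz_def by (rule someI[of _ "(a, b)"]) (use that in simp)
  \<comment> \<open>A vertex lies in the filler of at most one cell, so it spoils one row through
    fillers and at most one through \<open>\<omega>\<close>. Once these rows are avoided, columns
    only have to avoid \<open>X\<close> itself.\<close>
  define BA where "BA = X \<union> (fst \<circ> pz) ` X \<union> {a\<in>A. \<omega> a \<in> X}"
  have "card {a\<in>A. \<omega> a \<in> X} \<le> card X"
  proof (cases c)
    case True
    then have "{a\<in>A. \<omega> a \<in> X} = {}" using c X(3) by auto
    then show ?thesis by (metis card.empty le0)
  next
    case False
    then have "inj_on \<omega> {a\<in>A. \<omega> a \<in> X}" using c by (auto intro: inj_on_subset)
    then show ?thesis using X(1) by (intro card_inj_on_le[of \<omega>]) auto
  qed
  moreover have "card BA \<le> card X + card ((fst \<circ> pz) ` X) + card {a\<in>A. \<omega> a \<in> X}"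
    unfolding BA_def by (intro order_trans[OF card_Un_le] add_mono order_refl)
  moreover have "card ((fst \<circ> pz) ` X) \<le> card X" using X(1) by (rule card_image_le)
  ultimately have "card BA \<le> 3 * card X" by linarith
  moreover have "finite BA" using X(1) g(1) by (simp add: BA_def)
  ultimately have "\<tau> + 1 \<le> card (A - BA)" using cA diff_card_le_card_Diff[of BA A] by linarith
  then obtain Rw where Rw: "Rw ` {..\<tau>} \<subseteq> A - BA" "inj_on Rw {..\<tau>}"
    using card_le_inj[of "{..\<tau>}" "A - BA"] g(1) by auto
  have "2 * \<tau> \<le> card (B - X)" using cB diff_card_le_card_Diff[OF X(1), of B] by linarith
  then obtain Cl where Cl: "Cl ` {..<2 * \<tau>} \<subseteq> B - X" "inj_on Cl {..<2 * \<tau>}"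
    using card_le_inj[of "{..<2 * \<tau>}" "B - X"] g(2) by auto
  have RwA: "Rw i \<in> A" "Rw i \<notin> BA" if "i \<le> \<tau>" for i using Rw(1) that by (auto simp: image_subset_iff)
  have ClB: "Cl i \<in> B" "Cl i \<notin> X" if "i < 2 * \<tau>" for i using Cl(1) that by (auto simp: image_subset_iff)
  have Rwi: "Rw i = Rw j \<longleftrightarrow> i = j" if "i \<le> \<tau>" "j \<le> \<tau>" for i j
    using inj_on_eq_iff[OF Rw(2)] that by simp
  have Cli: "Cl i = Cl j \<longleftrightarrow> i = j" if "i < 2 * \<tau>" "j < 2 * \<tau>" for i j
    using inj_on_eq_iff[OF Cl(2)] that by simp
  \<comment> \<open>The \<open>\<tau> - 1\<close> labels \<open>s i\<close> cover \<open>q\<close>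
    cells, two each; one or two cells remain, according to the parity of \<open>l\<close>.\<close>
  define q where "q = 2 * \<tau> - 2"
  have \<tau>3: "\<tau> \<ge> 3" and l\<tau>: "l = q + 1 \<or> l = q + 2" using l \<tau> by (auto simp: q_def)
  have q: "2 * \<tau> = q + 2" "even q" "q \<ge> 4" using \<tau>3 by (auto simp: q_def)
  \<comment> \<open>Cells \<open>2 * i\<close> and \<open>2 * i + 1\<close> share the label
    \<open>s i\<close>. The last cells take \<open>\<omega>\<close> of their row, which is the
    common label \<open>w\<close> if \<open>c\<close> holds.\<close>
  define lab where "lab ri n = (if n < q then s (n div 2) else \<omega> (Rw (ri n)))" for ri :: "nat \<Rightarrow> nat" and n
  define e where "e ri ci n = cell Z (Rw (ri n)) (Cl (ci n)) (lab ri n)" for ri ci :: "nat \<Rightarrow> nat" and n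
  have lt: "n div 2 < \<tau> - 1" if "n < q" for n using that q by linarith
  have labL: "lab ri n \<in> L (Rw (ri n)) (Cl (ci n))" if "ri n \<le> \<tau>" "ci n < 2 * \<tau>" for ri ci n
    unfolding lab_def using s(2)[OF lt RwA(1)[OF that(1)] ClB(1)[OF that(2)]]
      \<omega>(1)[OF RwA(1)[OF that(1)] ClB(1)[OF that(2)]] by (cases "n < q") simp_all
  have eH: "e ri ci n \<in> H" if "ri n \<le> \<tau>" "ci n < 2 * \<tau>" for ri ci n
    unfolding e_def using g(8)[OF RwA(1)[OF that(1)] ClB(1)[OF that(2)] labL[where ri = ri and ci = ci and n = n, OF that]] .
  have eX: "e ri ci n \<inter> X = {}" if "ri n \<le> \<tau>" "ci n < 2 * \<tau>" for ri ci n
  proof -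
    let ?a = "Rw (ri n)" and ?b = "Cl (ci n)"
    note ab = RwA[OF that(1)] ClB[OF that(2)]
    have "lab ri n \<notin> X" unfolding lab_def using X(2)[OF lt[of n]] ab by (cases "n < q") (auto simp: BA_def)
    moreover have "x \<notin> Z ?a ?b" if x: "x \<in> X" for x
    proof
      assume xz: "x \<in> Z ?a ?b"
      have p: "fst (pz x) \<in> A" "snd (pz x) \<in> B" "x \<in> Z (fst (pz x)) (snd (pz x))"
        using pz[OF ab(1,3) xz] by auto
      have "fst (pz x) \<in> BA" using x by (auto simp: BA_def)
      then have "?a \<noteq> fst (pz x)" using ab(2) by auto
      then have "Z ?a ?b \<inter> Z (fst (pz x)) (snd (pz x)) = {}" using g(5)[OF ab(1,3) p(1,2)] unfolding prod.inject by simp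
      then show False using p(3) xz by auto
    qed
    moreover have "?a \<notin> X" "?b \<notin> X" using ab by (auto simp: BA_def)
    ultimately show ?thesis unfolding e_def cell_def by auto
  qed
  have labeq: "lab ri n = lab ri m \<longleftrightarrow> even n \<and> m = Suc n \<and> (n < q \<or> c \<or> ri n = ri m)"
    if "n < m" "m < q + 2" "ri n \<le> \<tau>" "ri m \<le> \<tau>" for n m ri
  proof -
    consider "m < q" | "n < q" "q \<le> m" | "n = q" "m = Suc q" using \<open>n < m\<close> \<open>m < q + 2\<close> by linarith
    then show ?thesis
    proof cases
      case 1
      have "lab ri n = lab ri m \<longleftrightarrow> n div 2 = m div 2"
        using inj_on_eq_iff[OF s(1), of "n div 2" "m div 2"] lt[of n] lt[of m] 1 that unfolding lab_def by simp
      then show ?thesis using div2_eq_iff[OF that(1)] 1 that by auto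
    next
      case 2
      have "lab ri n \<noteq> lab ri m" using \<omega>(2)[OF RwA(1)[OF that(4)] lt[of n]] 2 unfolding lab_def by auto
      moreover have "\<not> (even n \<and> m = Suc n)" using 2 q(2) by (metis le_Suc_eq even_Suc not_le)
      ultimately show ?thesis by blast
    next
      case 3
      have "lab ri n = lab ri m \<longleftrightarrow> \<omega> (Rw (ri n)) = \<omega> (Rw (ri m))" using 3 by (simp add: lab_def)
      also have "\<dots> \<longleftrightarrow> c \<or> ri n = ri m"
      proof (cases c)
        case True
        then show ?thesis using c RwA(1)[OF that(3)] RwA(1)[OF that(4)] by simp
      next
        case False
        then have "inj_on \<omega> A" using c by simp
        then show ?thesis using inj_on_eq_iff[OF _ RwA(1)[OF that(3)] RwA(1)[OF that(4)]] Rwi[OF that(3,4)] False by simp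
      qed
      finally show ?thesis using 3 q(2) by simp
    qed
  qed
  have cells: "if P then is_singleton (e ri ci n \<inter> e ri ci m) else e ri ci n \<inter> e ri ci m = {}"
    if "\<And>n. n < l' \<Longrightarrow> ri n \<le> \<tau> \<and> ci n < 2 * \<tau>" "n < l'" "m < l'"
      "P \<Longrightarrow> ri n = ri m \<and> ci n \<noteq> ci m \<and> lab ri n \<noteq> lab ri m \<or> ri n \<noteq> ri m \<and> ci n = ci m \<and> lab ri n \<noteq> lab ri m \<or>
        ri n \<noteq> ri m \<and> ci n \<noteq> ci m \<and> lab ri n = lab ri m"
      "\<not> P \<Longrightarrow> ri n \<noteq> ri m \<and> ci n \<noteq> ci m \<and> lab ri n \<noteq> lab ri m" for P ri ci n m l'
    unfolding e_def
  proof (rule cells_linear[OF G, where l = l'])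
    fix n assume "n < l'"
    then have "ri n \<le> \<tau>" "ci n < 2 * \<tau>" using that(1) by auto
    then show "Rw (ri n) \<in> A \<and> Cl (ci n) \<in> B \<and> lab ri n \<in> L (Rw (ri n)) (Cl (ci n))"
      using RwA(1) ClB(1) labL by blast
  next
    have b: "ri n \<le> \<tau>" "ci n < 2 * \<tau>" "ri m \<le> \<tau>" "ci m < 2 * \<tau>" using that(1)[OF that(2)] that(1)[OF that(3)] by auto
    show "Rw (ri n) = Rw (ri m) \<and> Cl (ci n) \<noteq> Cl (ci m) \<and> lab ri n \<noteq> lab ri m \<or>
      Rw (ri n) \<noteq> Rw (ri m) \<and> Cl (ci n) = Cl (ci m) \<and> lab ri n \<noteq> lab ri m \<or>
      Rw (ri n) \<noteq> Rw (ri m) \<and> Cl (ci n) \<noteq> Cl (ci m) \<and> lab ri n = lab ri m" if P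
      using \<open>P \<Longrightarrow> _\<close>[OF that] unfolding Rwi[OF b(1,3)] Cli[OF b(2,4)] .
    show "Rw (ri n) \<noteq> Rw (ri m) \<and> Cl (ci n) \<noteq> Cl (ci m) \<and> lab ri n \<noteq> lab ri m" if "\<not> P"
      using \<open>\<not> P \<Longrightarrow> _\<close>[OF that] unfolding Rwi[OF b(1,3)] Cli[OF b(2,4)] .
  qed (use that in auto)
  have "\<exists>ri ci. (\<forall>n<l. ri n \<le> \<tau> \<and> ci n < 2 * \<tau>) \<and>
     (Q = expansion r (path_graph l) \<and> lin_path (e ri ci) l \<or> Q = expansion r (cycle_graph l) \<and> lin_cycle (e ri ci) l)"
  proof (cases "Q = expansion r (path_graph l)")
    case True
    \<comment> \<open>The links alternate: cells \<open>n\<close> and \<open>n + 1\<close> share a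
      label for even \<open>n\<close> and a row for odd \<open>n\<close>, while columns differ.
      Without \<open>c\<close> the link between the cells \<open>q\<close> and \<open>q + 1\<close>
      is a common column instead of a label.\<close>
    define ri where "ri n = Suc n div 2" for n
    define ci where "ci n = (if n = Suc q \<and> \<not> c then q else n)" for n
    have rc: "ri n \<le> \<tau> \<and> ci n < 2 * \<tau>" if "n < q + 2" for n using that q by (auto simp: ri_def ci_def)
    have "lin_path (e ri ci) (q + 2)" unfolding lin_path_def
    proof (intro allI impI)
      fix n m assume nm: "n < m" "m < q + 2"
      then have n: "n < q + 2" by simp
      have re: "ri n = ri m \<longleftrightarrow> odd n \<and> m = Suc n" unfolding ri_def by (rule Suc_div2_eq_iff[OF nm(1)])
      have ce: "ci n = ci m \<longleftrightarrow> n = q \<and> m = Suc q \<and> \<not> c" using nm by (auto simp: ci_def)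
      have le: "lab ri n = lab ri m \<longleftrightarrow> even n \<and> m = Suc n \<and> (n < q \<or> c)"
        using labeq[OF nm, of ri] rc[OF n] rc[OF nm(2)] re by auto
      show "if m = Suc n then is_singleton (e ri ci n \<inter> e ri ci m) else e ri ci n \<inter> e ri ci m = {}"
      proof (rule cells[where l' = "q + 2"])
        assume "m = Suc n"
        then show "ri n = ri m \<and> ci n \<noteq> ci m \<and> lab ri n \<noteq> lab ri m \<or> ri n \<noteq> ri m \<and> ci n = ci m \<and> lab ri n \<noteq> lab ri m \<or>
          ri n \<noteq> ri m \<and> ci n \<noteq> ci m \<and> lab ri n = lab ri m"
          unfolding re ce le using q(2) nm by auto
      next
        assume "m \<noteq> Suc n"
        then show "ri n \<noteq> ri m \<and> ci n \<noteq> ci m \<and> lab ri n \<noteq> lab ri m" unfolding re ce le by auto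
      qed (use rc n nm in auto)
    qed
    then have "lin_path (e ri ci) l" using lin_path_prefix[of "e ri ci" "q + 2" l] l\<tau> by auto
    moreover have "\<forall>n<l. ri n \<le> \<tau> \<and> ci n < 2 * \<tau>" using rc l\<tau> by auto
    ultimately show ?thesis using True by blast
  next
    case False
    then have Qc: "Q = expansion r (cycle_graph l)" using Q by simp
    from l\<tau> show ?thesis
    proof
      assume lq: "l = q + 2"
      \<comment> \<open>The last cell \<open>q + 1\<close> returns to the row of cell 0 and so
        closes the cycle.\<close>
      define ri where "ri n = (if n = Suc q then 0 else Suc n div 2)" for n
      define ci where "ci n = (if n = Suc q \<and> \<not> c then q else n)" for n
      have rc: "ri n \<le> \<tau> \<and> ci n < 2 * \<tau>" if "n < q + 2" for n using that q by (auto simp: ri_def ci_def)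
      have "lin_cycle (e ri ci) (q + 2)" unfolding lin_cycle_def
      proof (intro allI impI)
        fix n m assume nm: "n < m" "m < q + 2"
        then have n: "n < q + 2" by simp
        have re: "ri n = ri m \<longleftrightarrow> odd n \<and> m = Suc n \<or> n = 0 \<and> m = Suc q"
        proof (cases "m = Suc q")
          case True
          then have "ri m = 0" "n \<noteq> Suc q" using nm by (auto simp: ri_def)
          then have "ri n = ri m \<longleftrightarrow> n = 0" by (cases n) (auto simp: ri_def)
          then show ?thesis using True q by auto
        next
          case False
          then have "ri n = Suc n div 2" "ri m = Suc m div 2" using nm by (auto simp: ri_def)
          then show ?thesis using Suc_div2_eq_iff[OF nm(1)] False by auto
        qed
        have ce: "ci n = ci m \<longleftrightarrow> n = q \<and> m = Suc q \<and> \<not> c" using nm by (auto simp: ci_def)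
        have le: "lab ri n = lab ri m \<longleftrightarrow> even n \<and> m = Suc n \<and> (n < q \<or> c)"
          using labeq[OF nm, of ri] rc[OF n] rc[OF nm(2)] re q by auto
        show "if m = Suc n \<or> n = 0 \<and> Suc m = q + 2 then is_singleton (e ri ci n \<inter> e ri ci m) else e ri ci n \<inter> e ri ci m = {}"
        proof (rule cells[where l' = "q + 2"])
          assume "m = Suc n \<or> n = 0 \<and> Suc m = q + 2"
          then show "ri n = ri m \<and> ci n \<noteq> ci m \<and> lab ri n \<noteq> lab ri m \<or> ri n \<noteq> ri m \<and> ci n = ci m \<and> lab ri n \<noteq> lab ri m \<or>
            ri n \<noteq> ri m \<and> ci n \<noteq> ci m \<and> lab ri n = lab ri m"
            unfolding re ce le using q(2,3) nm by auto
        next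
          assume "\<not> (m = Suc n \<or> n = 0 \<and> Suc m = q + 2)"
          then show "ri n \<noteq> ri m \<and> ci n \<noteq> ci m \<and> lab ri n \<noteq> lab ri m" unfolding re ce le by auto
        qed (use rc n nm in auto)
      qed
      moreover have "\<forall>n<l. ri n \<le> \<tau> \<and> ci n < 2 * \<tau>" using rc lq by auto
      ultimately show ?thesis using Qc lq by blast
    next
      assume lq: "l = q + 1"
      define ri where "ri n = Suc n div 2" for n
      \<comment> \<open>The last cell \<open>q\<close> has no partner for its label; it closes the
        cycle through the column of cell 0.\<close>
      define ci where "ci n = (if n = q then 0 else n)" for n
      have rc: "ri n \<le> \<tau> \<and> ci n < 2 * \<tau>" if "n < q + 1" for n using that q by (auto simp: ri_def ci_def)
      have "lin_cycle (e ri ci) (q + 1)" unfolding lin_cycle_def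
      proof (intro allI impI)
        fix n m assume nm: "n < m" "m < q + 1"
        then have n: "n < q + 1" "m < q + 2" by auto
        have re: "ri n = ri m \<longleftrightarrow> odd n \<and> m = Suc n" unfolding ri_def by (rule Suc_div2_eq_iff[OF nm(1)])
        have ce: "ci n = ci m \<longleftrightarrow> n = 0 \<and> m = q" using nm by (auto simp: ci_def)
        have le: "lab ri n = lab ri m \<longleftrightarrow> even n \<and> m = Suc n"
          using labeq[OF nm(1) n(2), of ri] rc[OF n(1)] rc[OF nm(2)] re nm by auto
        show "if m = Suc n \<or> n = 0 \<and> Suc m = q + 1 then is_singleton (e ri ci n \<inter> e ri ci m) else e ri ci n \<inter> e ri ci m = {}"
        proof (rule cells[where l' = "q + 1"])
          assume "m = Suc n \<or> n = 0 \<and> Suc m = q + 1"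
          then show "ri n = ri m \<and> ci n \<noteq> ci m \<and> lab ri n \<noteq> lab ri m \<or> ri n \<noteq> ri m \<and> ci n = ci m \<and> lab ri n \<noteq> lab ri m \<or>
            ri n \<noteq> ri m \<and> ci n \<noteq> ci m \<and> lab ri n = lab ri m"
            unfolding re ce le using q(2,3) nm by auto
        next
          assume "\<not> (m = Suc n \<or> n = 0 \<and> Suc m = q + 1)"
          then show "ri n \<noteq> ri m \<and> ci n \<noteq> ci m \<and> lab ri n \<noteq> lab ri m" unfolding re ce le by auto
        qed (use rc n nm in auto)
      qed
      moreover have "\<forall>n<l. ri n \<le> \<tau> \<and> ci n < 2 * \<tau>" using rc lq by auto
      ultimately show ?thesis using Qc lq by blast
    qed
  qed
  then obtain ri ci where rc: "\<And>n. n < l \<Longrightarrow> ri n \<le> \<tau> \<and> ci n < 2 * \<tau>"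
    and lin: "Q = expansion r (path_graph l) \<and> lin_path (e ri ci) l \<or> Q = expansion r (cycle_graph l) \<and> lin_cycle (e ri ci) l"
    by blast
  have "embeds Q H (\<Union>i<l. e ri ci i) \<and> finite (\<Union>i<l. e ri ci i) \<and> card (\<Union>i<l. e ri ci i) \<le> l * r"
    by (rule embeds_component[OF u r l _ lin]) (use rc eH in simp)
  moreover have "e ri ci n \<inter> X = {}" if "n < l" for n using eX[of ri n ci] rc[OF that] by simp
  then have "(\<Union>i<l. e ri ci i) \<inter> X = {}" by auto
  ultimately show ?thesis by blast
qed

lemma partition_into_sizes:
  assumes "finite I" "finite T" "(\<Sum>i\<in>I. n i) \<le> card T"
  shows "\<exists>P. (\<forall>i\<in>I. P i \<subseteq> T \<and> card (P i) = n i) \<and> disjoint_family_on P I"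
  using assms
proof (induction I arbitrary: T rule: finite_induct)
  case empty
  then show ?case by (simp add: disjoint_family_on_def)
next
  case (insert i I)
  then have "n i \<le> card T" by simp
  then obtain S where S: "S \<subseteq> T" "card S = n i" "finite S" by (rule obtain_subset_with_card_n)
  have "(\<Sum>i\<in>I. n i) \<le> card (T - S)" using insert S by (simp add: card_Diff_subset)
  then obtain P where P: "\<forall>i\<in>I. P i \<subseteq> T - S \<and> card (P i) = n i" "disjoint_family_on P I"
    using insert.IH[of "T - S"] insert.prems by auto
  have "disjoint_family_on (P(i := S)) (insert i I)"
    using P insert.hyps by (fastforce simp: disjoint_family_on_def)
  moreover have "\<forall>j\<in>insert i I. (P(i := S)) j \<subseteq> T \<and> card ((P(i := S)) j) = n j"
    using P(1) S insert.hyps by auto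
  ultimately show ?case by blast
qed

text \<open>The common labels are dealt out, \<open>(l i + 1) div 2\<close> to each component, and
  stay reserved while the components are embedded one by one. If one label is missing, a single
  component goes with one label less and uses a column in its place.\<close>

lemma heavy_embedding:
  assumes G: "grid H A B Z L" and u: "uniform r H" and r: "r \<ge> 3" and I: "finite I"
    and l: "\<And>i. i \<in> I \<Longrightarrow> 5 \<le> l i \<and> l i \<le> lm"
    and Q: "\<And>i. i \<in> I \<Longrightarrow> Q i \<in> {expansion r (path_graph (l i)), expansion r (cycle_graph (l i))}"
    and T: "finite T" "\<And>a b. a \<in> A \<Longrightarrow> b \<in> B \<Longrightarrow> T \<subseteq> L a b"
    and cT: "(\<Sum>i\<in>I. (l i + 1) div 2) = card T \<or> (\<Sum>i\<in>I. (l i + 1) div 2) = card T + 1 \<and>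
        inj_on \<omega> A \<and> (\<forall>a\<in>A. \<forall>b\<in>B. \<omega> a \<in> L a b - T)"
    and cA: "3 * (card I * (lm * r + lm)) + 2 * lm + 1 \<le> card A"
    and cB: "3 * (card I * (lm * r + lm)) + 2 * lm + 1 \<le> card B"
  shows "\<exists>S. (\<forall>i\<in>I. embeds (Q i) H (S i)) \<and> disjoint_family_on S I"
proof -
  define \<tau> where "\<tau> i = (l i + 1) div 2" for i
  have \<tau>: "3 \<le> \<tau> i" "\<tau> i \<le> lm" "\<tau> i * 2 \<le> lm + 1" if "i \<in> I" for i using l[OF that] by (auto simp: \<tau>_def)
  have "\<exists>n. (\<Sum>i\<in>I. n i) \<le> card T \<and> (\<forall>i\<in>I. n i = \<tau> i \<or> n i = \<tau> i - 1 \<and> inj_on \<omega> A \<and> (\<forall>a\<in>A. \<forall>b\<in>B. \<omega> a \<in> L a b - T))"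
    using cT
  proof
    assume "(\<Sum>i\<in>I. (l i + 1) div 2) = card T"
    then show ?thesis by (intro exI[of _ \<tau>]) (simp add: \<tau>_def)
  next
    assume A: "(\<Sum>i\<in>I. (l i + 1) div 2) = card T + 1 \<and> inj_on \<omega> A \<and> (\<forall>a\<in>A. \<forall>b\<in>B. \<omega> a \<in> L a b - T)"
    then have s: "(\<Sum>i\<in>I. \<tau> i) = card T + 1" by (simp add: \<tau>_def)
    have "I \<noteq> {}" using s by auto
    then obtain j where j: "j \<in> I" by blast
    have "(\<Sum>i\<in>I. \<tau> i) = \<tau> j + (\<Sum>i\<in>I - {j}. \<tau> i)" using I j by (simp add: sum.remove)
    moreover have "(\<Sum>i\<in>I. (\<tau>(j := \<tau> j - 1)) i) = (\<tau> j - 1) + (\<Sum>i\<in>I - {j}. (\<tau>(j := \<tau> j - 1)) i)"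
      using I j by (simp add: sum.remove)
    moreover have "(\<Sum>i\<in>I - {j}. (\<tau>(j := \<tau> j - 1)) i) = (\<Sum>i\<in>I - {j}. \<tau> i)" by (intro sum.cong) auto
    ultimately have "(\<Sum>i\<in>I. (\<tau>(j := \<tau> j - 1)) i) \<le> card T" using s \<tau>(1)[OF j] by linarith
    then show ?thesis using A by (intro exI[of _ "\<tau>(j := \<tau> j - 1)"]) auto
  qed
  then obtain n where n: "(\<Sum>i\<in>I. n i) \<le> card T"
    "\<And>i. i \<in> I \<Longrightarrow> n i = \<tau> i \<or> n i = \<tau> i - 1 \<and> inj_on \<omega> A \<and> (\<forall>a\<in>A. \<forall>b\<in>B. \<omega> a \<in> L a b - T)" by blast
  obtain P where P: "\<forall>i\<in>I. P i \<subseteq> T \<and> card (P i) = n i" "disjoint_family_on P I"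
    using partition_into_sizes[OF I T(1) n(1)] by blast
  show ?thesis
  proof (rule disjoint_choice[OF I P(2), where s = "lm * r" and \<rho> = lm])
    show "finite (P i) \<and> card (P i) \<le> lm" if "i \<in> I" for i
      using P(1) T(1) that n(2)[OF that] \<tau>(2)[OF that] by (metis diff_le_self finite_subset order_trans)
  next
    fix i X assume i: "i \<in> I" and X: "finite X" "card X \<le> card I * (lm * r + lm)" "X \<inter> P i = {}"
    have fP: "finite (P i)" "P i \<subseteq> T" "card (P i) = n i" using P(1) T(1) i finite_subset by blast+
    have "\<tau> i - 1 \<le> card (P i)" using fP(3) n(2)[OF i] by auto
    from fP(1) obtain s where s: "bij_betw s {..<card (P i)} (P i)"
      using ex_bij_betw_nat_finite by (metis atLeast0LessThan)
    have sP: "s j \<in> P i" if "j < card (P i)" for j using s that by (auto simp: bij_betw_def)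
    have sinj: "inj_on s {..<\<tau> i - 1}" using s \<open>\<tau> i - 1 \<le> card (P i)\<close> by (auto simp: bij_betw_def intro: inj_on_subset)
    have sL: "s j \<in> L a b" "s j \<notin> X" "s j \<in> T" if "j < card (P i)" "a \<in> A" "b \<in> B" for j a b
      using sP[OF that(1)] T(2)[OF that(2,3)] fP(2) X(3) by auto
    have Ane: "A \<noteq> {}" "B \<noteq> {}" using cA cB by auto
    have sizes: "3 * card X + \<tau> i + 1 \<le> card A" "card X + 2 * \<tau> i \<le> card B"
      using X(2) cA cB \<tau>[OF i] by linarith+
    have "\<exists>S. embeds (Q i) H S \<and> S \<inter> X = {} \<and> finite S \<and> card S \<le> l i * r"
    proof (cases "n i = \<tau> i")
      case True
      have lt: "\<tau> i - 1 < card (P i)" using True fP(3) \<tau>(1)[OF i] by simp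
      show ?thesis
      \<comment> \<open>The last of the \<open>\<tau> i\<close> labels of the component plays the
        part of a constant \<open>\<omega>\<close>.\<close>
      proof (rule heavy_component[OF G u r _ \<tau>_def Q[OF i] sinj, where \<omega> = "\<lambda>_. s (\<tau> i - 1)" and c = True and w = "s (\<tau> i - 1)"])
        fix a j assume "a \<in> A" "j < \<tau> i - 1"
        then show "s (\<tau> i - 1) \<noteq> s j" using s lt by (auto simp: bij_betw_def dest!: inj_onD)
      qed (use sL lt Ane l[OF i] X(1) sizes in \<open>auto\<close>)
    next
      case False
      then have ni: "n i = \<tau> i - 1" and \<omega>: "inj_on \<omega> A" "\<And>a b. a \<in> A \<Longrightarrow> b \<in> B \<Longrightarrow> \<omega> a \<in> L a b - T" using n(2)[OF i] by auto
      have lt: "j < card (P i)" if "j < \<tau> i - 1" for j using that ni fP(3) by simp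
      show ?thesis
      proof (rule heavy_component[OF G u r _ \<tau>_def Q[OF i] sinj, where \<omega> = \<omega> and c = False and w = undefined])
        fix a j assume a: "a \<in> A" and j: "j < \<tau> i - 1"
        obtain b where "b \<in> B" using Ane by blast
        then show "\<omega> a \<noteq> s j" using \<omega>(2)[OF a, of b] sL(3)[OF lt[OF j] a, of b] by auto
      next
        fix j assume "j < \<tau> i - 1"
        then show "s j \<notin> X" using sL(2)[OF lt] Ane by blast
      qed (use sL lt \<omega> l[OF i] X(1) sizes in \<open>auto\<close>)
    qed
    moreover have "l i * r \<le> lm * r" using l[OF i] by simp
    ultimately show "\<exists>S. embeds (Q i) H S \<and> S \<inter> X = {} \<and> finite S \<and> card S \<le> lm * r" by (meson order_trans)
  qed
qed

section \<open>Embeddings without common labels\<close>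

text \<open>Greedy choice: each \<open>F i\<close> is at least as large as the index set, so the
  earlier choices cannot exhaust it.\<close>

lemma distinct_representatives:
  assumes "finite I" "\<And>i. i \<in> I \<Longrightarrow> finite (F i) \<and> card I \<le> card (F i)"
  shows "\<exists>\<alpha>. inj_on \<alpha> I \<and> (\<forall>i\<in>I. \<alpha> i \<in> F i)"
proof -
  have "\<exists>\<alpha>. inj_on \<alpha> J \<and> (\<forall>i\<in>J. \<alpha> i \<in> F i)" if "J \<subseteq> I" for J
    using finite_subset[OF that assms(1)] that
  proof (induction J rule: finite_induct)
    case (insert j J)
    then obtain \<alpha> where \<alpha>: "inj_on \<alpha> J" "\<forall>i\<in>J. \<alpha> i \<in> F i" by auto
    have "card (\<alpha> ` J) < card I"
      using insert card_image_le[of J \<alpha>] psubset_card_mono[of I J] assms(1) by force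
    then have "card (\<alpha> ` J) < card (F j)" using assms(2)[of j] insert.prems by simp
    then have "\<not> F j \<subseteq> \<alpha> ` J" using card_mono[of "\<alpha> ` J" "F j"] insert.hyps(1) by auto
    then obtain x where x: "x \<in> F j" "x \<notin> \<alpha> ` J" by blast
    have "inj_on (\<alpha>(j := x)) (insert j J)" using \<alpha>(1) x(2) insert.hyps(2) by (auto simp: inj_on_def)
    moreover have "\<forall>i\<in>insert j J. (\<alpha>(j := x)) i \<in> F i" using \<alpha>(2) x(1) insert.hyps(2) by auto
    ultimately show ?case by blast
  qed auto
  from this[of I] show ?thesis by simp
qed

text \<open>In a disjoint family a vertex of \<open>X\<close> meets at most one member.\<close>

lemma card_meeting_le:
  assumes "disjoint_family_on F A" "finite X"
  shows "card {a\<in>A. F a \<inter> X \<noteq> {}} \<le> card X"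
proof -
  have "\<exists>f. \<forall>a\<in>{a\<in>A. F a \<inter> X \<noteq> {}}. f a \<in> F a \<inter> X" by (rule bchoice) blast
  then obtain f where f: "\<And>a. a \<in> {a\<in>A. F a \<inter> X \<noteq> {}} \<Longrightarrow> f a \<in> F a \<inter> X" by blast
  have "inj_on f {a\<in>A. F a \<inter> X \<noteq> {}}"
  proof (rule inj_onI)
    fix a b assume "a \<in> {a\<in>A. F a \<inter> X \<noteq> {}}" "b \<in> {a\<in>A. F a \<inter> X \<noteq> {}}" "f a = f b"
    then have "f a \<in> F a \<inter> F b" "a \<in> A" "b \<in> A" using f[of a] f[of b] by auto
    then show "a = b" using assms(1) unfolding disjoint_family_on_def by blast
  qed
  then show ?thesis by (rule card_inj_on_le) (use f assms(2) in auto)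
qed

text \<open>A vertex of \<open>F n\<close> lies in at most one set \<open>S m\<close>, so the
  relation that \<open>F n\<close> meets \<open>S m\<close> has out-degree at most \<open>d\<close>
  and \<open>independent_subset\<close> applies.\<close>

lemma select_independent:
  assumes S: "disjoint_family_on S N" and F: "\<And>n. n \<in> N \<Longrightarrow> finite (F n) \<and> card (F n) \<le> d"
    and N: "finite N" "(2 * d + 1) * card I \<le> card N" and I: "finite I"
  shows "\<exists>\<nu>. inj_on \<nu> I \<and> \<nu> ` I \<subseteq> N \<and> (\<forall>i\<in>I. \<forall>j\<in>I. i \<noteq> j \<longrightarrow> F (\<nu> i) \<inter> S (\<nu> j) = {})"
proof -
  have "card {m\<in>N. m \<noteq> n \<and> F n \<inter> S m \<noteq> {}} \<le> d" if "n \<in> N" for n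
  proof -
    have "card {m\<in>N. m \<noteq> n \<and> F n \<inter> S m \<noteq> {}} \<le> card {m\<in>N. S m \<inter> F n \<noteq> {}}"
      using N(1) by (intro card_mono) auto
    also have "\<dots> \<le> card (F n)" using F[OF that] by (intro card_meeting_le[OF S]) auto
    finally show ?thesis using F[OF that] by simp
  qed
  then have "\<exists>J\<subseteq>N. card J = card I \<and> (\<forall>i\<in>J. \<forall>j\<in>J. i \<noteq> j \<longrightarrow> \<not> F i \<inter> S j \<noteq> {})"
    by (intro independent_subset[OF N(1) _ N(2)])
  then obtain J where J: "J \<subseteq> N" "card J = card I" "\<And>i j. i \<in> J \<Longrightarrow> j \<in> J \<Longrightarrow> i \<noteq> j \<Longrightarrow> F i \<inter> S j = {}" by blast
  have "finite J" using J(1) N(1) finite_subset by blast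
  then obtain \<nu> where \<nu>: "bij_betw \<nu> I J" using finite_same_card_bij[OF I] J(2) by metis
  have "F (\<nu> i) \<inter> S (\<nu> j) = {}" if "i \<in> I" "j \<in> I" "i \<noteq> j" for i j
    using J(3)[of "\<nu> i" "\<nu> j"] \<nu> that unfolding bij_betw_def inj_on_def by blast
  then show ?thesis using \<nu> J(1) unfolding bij_betw_def by blast
qed

text \<open>The first summands are the demand of \<open>light_component\<close> for the largest
  \<open>X\<close> that \<open>disjoint_choice\<close> produces with \<open>s = lm * r\<close> and
  at most \<open>3 * r + 1\<close> reserved vertices per component. The last one, with
  \<open>4 * t + 1\<close> equal to \<open>2 * (2 * t) + 1\<close>, provides the candidate base
  cells for \<open>select_independent\<close>.\<close>

definition grid_size :: "nat \<Rightarrow> nat \<Rightarrow> nat \<Rightarrow> nat \<Rightarrow> nat" where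
  "grid_size t k lm r = 4 * (k * (lm * r + (3 * r + 1)) + 2 * r) + lm + 1 + (4 * t + 1) * k"

lemma grid_sizeD:
  assumes "x \<le> k * (lm * r + (3 * r + 1))" "l \<le> lm" "grid_size t k lm r \<le> N"
  shows "4 * (x + 2 * r) + l + 1 \<le> N"
proof -
  have "4 * (x + 2 * r) + l + 1 \<le> 4 * (k * (lm * r + (3 * r + 1)) + 2 * r) + lm + 1"
    using assms(1,2) by (intro add_mono mult_mono) auto
  also have "\<dots> \<le> grid_size t k lm r" unfolding grid_size_def by (rule le_add1)
  finally show ?thesis using assms(3) by simp
qed

definition grid_full :: "'a set set \<Rightarrow> nat \<Rightarrow> 'a set \<Rightarrow> 'a set \<Rightarrow> ('a \<Rightarrow> 'a \<Rightarrow> 'a set) \<Rightarrow> ('a \<Rightarrow> 'a \<Rightarrow> 'a set) \<Rightarrow> bool" where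
  "grid_full H t A B Z L \<longleftrightarrow> (\<forall>a\<in>A. \<forall>b\<in>B. \<forall>c\<in>L a b.
     t + 1 \<le> card (nbrs H (cell Z a b c - {a})) \<and> t + 1 \<le> card (nbrs H (cell Z a b c - {b})))"

lemma cell_finite_card:
  assumes "grid H A B Z L" "uniform r H" "a \<in> A" "b \<in> B" "c \<in> L a b"
  shows "finite (cell Z a b c)" "card (cell Z a b c) = r"
  using gridD(8)[OF assms(1,3-5)] assms(2) by (auto simp: uniform_def)

text \<open>The label \<phi> a belongs to all cells of its row. For odd cycles one closing hyperedge
  is the base cell with its row vertex exchanged for \<alpha>, the other is a cell of the same row
  in a fresh column \<beta>. Both contain the row label, and the exchange removes the row vertex as
  a second common vertex.\<close>

lemma light_embedding_rows:
  assumes G: "grid H A B Z L" and lp: "label_pair A B L (\<lambda>a b. \<phi> a) mu"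
    and muA: "\<And>b. b \<in> B \<Longrightarrow> inj_on (\<lambda>a. mu a b) A \<or> (\<forall>a\<in>A. \<forall>a'\<in>A. mu a b = mu a' b)"
    and muB: "\<And>a. a \<in> A \<Longrightarrow> inj_on (mu a) B \<or> (\<forall>b\<in>B. \<forall>b'\<in>B. mu a b = mu a b')"
    and muphi: "\<And>a b. a \<in> A \<Longrightarrow> b \<in> B \<Longrightarrow> mu a b \<noteq> \<phi> a"
    and full: "grid_full H t A B Z L"
    and u: "uniform r H" and r: "r \<ge> 3" and I: "finite I" "card I + 1 \<le> t"
    and l: "\<And>i. i \<in> I \<Longrightarrow> 5 \<le> l i \<and> l i \<le> lm"
    and Q: "\<And>i. i \<in> I \<Longrightarrow> Q i \<in> {expansion r (path_graph (l i)), expansion r (cycle_graph (l i))}"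
    and cA: "grid_size t (card I) lm r \<le> card A" and cB: "grid_size t (card I) lm r \<le> card B"
  shows "\<exists>S. (\<forall>i\<in>I. embeds (Q i) H (S i)) \<and> disjoint_family_on S I"
proof -
  note g = gridD[OF G] and lpD = label_pairD[OF lp]
  \<comment> \<open>Of \<open>t + 1\<close> neighbours the old row vertex and the reserved label
    \<open>\<omega> n\<close> are excluded. The \<open>t - 1\<close> left allow distinct choices
    because \<open>card I + 1 \<le> t\<close>.\<close>
  define d where "d = t - 1"
  define N where "N = (2 * d + 1) * card I"
  have "N \<le> card A" "N \<le> card B"
  proof -
    have "N \<le> (4 * t + 1) * card I" unfolding N_def d_def by (intro mult_right_mono) auto
    then show "N \<le> card A" "N \<le> card B" using cA cB unfolding grid_size_def by linarith+
  qed
  then obtain p q where p: "p ` {..<N} \<subseteq> A" "inj_on p {..<N}" and q: "q ` {..<N} \<subseteq> B" "inj_on q {..<N}"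
    using card_le_inj[of "{..<N}" A] card_le_inj[of "{..<N}" B] g(1,2) by auto
  have pA: "p n \<in> A" and qB: "q n \<in> B" if "n < N" for n using p(1) q(1) that by auto
  have pq: "p n \<noteq> p m" "q n \<noteq> q m" if "n < N" "m < N" "n \<noteq> m" for n m
    using p(2) q(2) that by (auto simp: inj_on_def)
  \<comment> \<open>If \<open>mu\<close> is constant along the row or the column of the base cell, a
    single vertex of \<open>X\<close> could block that whole line. Reserving the \<open>mu\<close>
    label of the base cell keeps it out of \<open>X\<close>.\<close>
  define \<omega> where "\<omega> n = mu (p n) (q n)" for n
  define K where "K n = cell Z (p n) (q n) (\<phi> (p n))" for n
  define S where "S n = insert (\<omega> n) (K n)" for n
  have \<phi>L: "\<phi> a \<in> L a b" if "a \<in> A" "b \<in> B" for a b using lpD(1)[OF that] .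
  have \<omega>L: "\<omega> n \<in> L (p n) (q n)" if "n < N" for n unfolding \<omega>_def using lpD(2) pA[OF that] qB[OF that] by blast
  have lab_notin: "x \<notin> A" "x \<notin> B" "x \<notin> Z a' b'" if "a \<in> A" "b \<in> B" "x \<in> L a b" "a' \<in> A" "b' \<in> B" for x a b a' b'
    using g(6)[OF that(1-3)] g(7)[OF that] by auto
  have Kfin: "finite (K n)" "card (K n) = r" "K n \<in> H" if "n < N" for n
    unfolding K_def using cell_finite_card[OF G u pA[OF that] qB[OF that] \<phi>L] g(8)[OF pA[OF that] qB[OF that] \<phi>L] pA[OF that] qB[OF that] by auto
  have Sdis: "disjoint_family_on S {..<N}"
  proof (unfold disjoint_family_on_def, intro ballI impI)
    fix n m assume nm: "n \<in> {..<N}" "m \<in> {..<N}" "n \<noteq> m"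
    then have nm': "n < N" "m < N" by auto
    note ab = pA[OF nm'(1)] qB[OF nm'(1)] pA[OF nm'(2)] qB[OF nm'(2)]
    have "{\<phi> (p n), \<omega> n} \<inter> {\<phi> (p m), \<omega> m} = {}"
      unfolding \<omega>_def using lpD(3)[OF ab] pq[OF nm' nm(3)] by blast
    moreover have "K n \<inter> K m = {}" unfolding K_def
      using cell_inter[OF G ab(1,2) \<phi>L[OF ab(1,2)] ab(3,4) \<phi>L[OF ab(3,4)]] pq[OF nm' nm(3)] calculation by auto
    moreover have "\<omega> n \<notin> K m" unfolding K_def cell_def
      using lab_notin[OF ab(1,2) \<omega>L[OF nm'(1)] ab(3,4)] ab calculation(1) by auto
    moreover have "\<omega> m \<notin> K n" unfolding K_def cell_def
      using lab_notin[OF ab(3,4) \<omega>L[OF nm'(2)] ab(1,2)] ab calculation(1) by auto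
    ultimately show "S n \<inter> S m = {}" unfolding S_def by auto
  qed
  have "\<exists>F. \<forall>n\<in>{..<N}. F n \<subseteq> nbrs H (K n - {p n}) - {p n, \<omega> n} \<and> card (F n) = d"
  proof (rule bchoice, rule ballI)
    fix n assume "n \<in> {..<N}"
    then have n: "n < N" by simp
    have "t + 1 \<le> card (nbrs H (K n - {p n}))"
      using full pA[OF n] qB[OF n] \<phi>L[OF pA[OF n] qB[OF n]] unfolding grid_full_def K_def by blast
    moreover have "card (nbrs H (K n - {p n})) - card {p n, \<omega> n} \<le> card (nbrs H (K n - {p n}) - {p n, \<omega> n})"
      by (intro diff_card_le_card_Diff) auto
    moreover have "card {p n, \<omega> n} \<le> 2" by (simp add: card_insert_if)
    ultimately have "d \<le> card (nbrs H (K n - {p n}) - {p n, \<omega> n})" unfolding d_def by linarith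
    then show "\<exists>F. F \<subseteq> nbrs H (K n - {p n}) - {p n, \<omega> n} \<and> card F = d"
      by (metis obtain_subset_with_card_n)
  qed
  then obtain F where F: "\<And>n. n < N \<Longrightarrow> F n \<subseteq> nbrs H (K n - {p n}) - {p n, \<omega> n}" "\<And>n. n < N \<Longrightarrow> card (F n) = d" by auto
  have Ffin: "finite (F n)" if "n < N" for n using F(1)[OF that] finite_nbrs[OF u] by (meson finite_Diff finite_subset)
  \<comment> \<open>Base cells are selected so that the candidates for an exchange in one of them
    avoid all the others.\<close>
  have "\<exists>\<nu>. inj_on \<nu> I \<and> \<nu> ` I \<subseteq> {..<N} \<and> (\<forall>i\<in>I. \<forall>j\<in>I. i \<noteq> j \<longrightarrow> F (\<nu> i) \<inter> S (\<nu> j) = {})"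
    by (rule select_independent[OF Sdis, where d = d]) (use Ffin F(2) I N_def in auto)
  then obtain \<nu> where \<nu>: "inj_on \<nu> I" "\<nu> ` I \<subseteq> {..<N}" "\<forall>i\<in>I. \<forall>j\<in>I. i \<noteq> j \<longrightarrow> F (\<nu> i) \<inter> S (\<nu> j) = {}" by blast
  have \<nu>N: "\<nu> i < N" if "i \<in> I" for i using \<nu>(2) that by auto
  have \<nu>inj: "\<nu> i \<noteq> \<nu> j" if "i \<in> I" "j \<in> I" "i \<noteq> j" for i j using \<nu>(1) that by (auto simp: inj_on_def)
  have "\<exists>\<alpha>. inj_on \<alpha> I \<and> (\<forall>i\<in>I. \<alpha> i \<in> F (\<nu> i))"
    by (rule distinct_representatives) (use I Ffin F(2) \<nu>N d_def in auto)
  then obtain \<alpha> where \<alpha>: "inj_on \<alpha> I" "\<forall>i\<in>I. \<alpha> i \<in> F (\<nu> i)" by blast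
  define Y where "Y = (\<Union>i\<in>I. insert (\<alpha> i) (S (\<nu> i)))"
  have Yfin: "finite Y" unfolding Y_def S_def using I(1) Kfin(1) \<nu>N by auto
  have "card Y \<le> card I * (r + 2)" unfolding Y_def
  proof (rule card_UN_le_mult[OF I(1)])
    fix i assume "i \<in> I"
    then show "card (insert (\<alpha> i) (S (\<nu> i))) \<le> r + 2" unfolding S_def using Kfin(1,2)[OF \<nu>N] by (simp add: card_insert_if)
  qed
  \<comment> \<open>Columns that meet \<open>Y\<close> themselves or in a filler; any other column
    is fresh enough for the second closing cell.\<close>
  define bad where "bad = {b\<in>B. {b} \<inter> Y \<noteq> {}} \<union> {b\<in>B. (\<Union>a\<in>A. Z a b) \<inter> Y \<noteq> {}}"
  have "disjoint_family_on (\<lambda>b. \<Union>a\<in>A. Z a b) B" unfolding disjoint_family_on_def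
  proof (intro ballI impI)
    fix b b' assume "b \<in> B" "b' \<in> B" "b \<noteq> b'"
    then have "Z a b \<inter> Z a' b' = {}" if "a \<in> A" "a' \<in> A" for a a' using g(5)[of a b a' b'] that by auto
    then show "(\<Union>a\<in>A. Z a b) \<inter> (\<Union>a\<in>A. Z a b') = {}" by blast
  qed
  then have "card {b\<in>B. (\<Union>a\<in>A. Z a b) \<inter> Y \<noteq> {}} \<le> card Y" by (rule card_meeting_le[OF _ Yfin])
  moreover have "card {b\<in>B. {b} \<inter> Y \<noteq> {}} \<le> card Y" by (rule card_meeting_le[OF _ Yfin]) (auto simp: disjoint_family_on_def)
  ultimately have "card bad \<le> 2 * card Y" unfolding bad_def using card_Un_le[of "{b\<in>B. {b} \<inter> Y \<noteq> {}}"] by (smt (verit) add_mono mult_2 order_trans)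
  moreover have "finite bad" unfolding bad_def using g(2) by auto
  moreover have "2 * (card I * (r + 2)) + card I \<le> card B"
  proof -
    have e1: "card I * (r + 2) \<le> card I * (lm * r + (3 * r + 1))" using r by (intro mult_left_mono) auto
    have e2: "card I \<le> (4 * t + 1) * card I" by simp
    have ar: "2 * x + y \<le> c" if "x \<le> E" "y \<le> z" "4 * (E + 2 * r) + lm + 1 + z \<le> c" for x y z E c :: nat
      using that by simp
    show ?thesis by (rule ar[OF e1 e2 cB[unfolded grid_size_def]])
  qed
  ultimately have "card I \<le> card (B - bad)"
    using \<open>card Y \<le> card I * (r + 2)\<close> diff_card_le_card_Diff[of bad B] by linarith
  then obtain \<beta> where \<beta>: "\<beta> ` I \<subseteq> B - bad" "inj_on \<beta> I" using card_le_inj[of I "B - bad"] I(1) g(2) by auto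
  have \<beta>B: "\<beta> i \<in> B" "\<beta> i \<notin> Y" "a \<in> A \<Longrightarrow> Z a (\<beta> i) \<inter> Y = {}" if "i \<in> I" for i a
    using \<beta>(1) that unfolding bad_def by auto
  define g1 where "g1 i = insert (\<alpha> i) (K (\<nu> i) - {p (\<nu> i)})" for i
  define g2 where "g2 i = cell Z (p (\<nu> i)) (\<beta> i) (\<phi> (p (\<nu> i)))" for i
  define R where "R i = S (\<nu> i) \<union> g1 i \<union> g2 i" for i
  have \<alpha>F: "\<alpha> i \<in> nbrs H (K (\<nu> i) - {p (\<nu> i)})" "\<alpha> i \<noteq> p (\<nu> i)" "\<alpha> i \<noteq> \<omega> (\<nu> i)" if "i \<in> I" for i
    using \<alpha>(2) F(1)[OF \<nu>N[OF that]] that by auto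
  have SY: "S (\<nu> i) \<subseteq> Y" "\<alpha> i \<in> Y" if "i \<in> I" for i using that unfolding Y_def by auto
  have Kmem: "p n \<in> K n" "q n \<in> K n" "\<phi> (p n) \<in> K n" for n unfolding K_def cell_def by auto
  have KS: "K n \<subseteq> S n" for n unfolding S_def by auto
  have Req: "R i = insert (\<alpha> i) (S (\<nu> i)) \<union> insert (\<beta> i) (Z (p (\<nu> i)) (\<beta> i))" for i
    unfolding R_def g1_def g2_def cell_def using KS Kmem by blast
  have \<alpha>S: "\<alpha> i \<notin> S (\<nu> j)" if "i \<in> I" "j \<in> I" "i \<noteq> j" for i j using \<alpha>(2) \<nu>(3) that by blast
  have Rdis: "disjoint_family_on R I" unfolding disjoint_family_on_def
  proof (intro ballI impI)
    fix i j assume ij: "i \<in> I" "j \<in> I" "i \<noteq> j"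
    have "S (\<nu> i) \<inter> S (\<nu> j) = {}" using Sdis \<nu>N \<nu>inj[OF ij] ij unfolding disjoint_family_on_def by auto
    moreover have "\<alpha> i \<noteq> \<alpha> j" using \<alpha>(1) ij by (auto simp: inj_on_def)
    ultimately have 1: "insert (\<alpha> i) (S (\<nu> i)) \<inter> insert (\<alpha> j) (S (\<nu> j)) = {}"
      using \<alpha>S[OF ij] \<alpha>S[of j i] ij by auto
    have 2: "insert (\<beta> i') (Z (p (\<nu> i')) (\<beta> i')) \<inter> Y = {}" if "i' \<in> I" for i'
      using \<beta>B(2)[OF that] \<beta>B(3)[OF that pA[OF \<nu>N[OF that]]] by auto
    have "\<beta> i \<noteq> \<beta> j" using \<beta>(2) ij by (auto simp: inj_on_def)
    then have 3: "insert (\<beta> i) (Z (p (\<nu> i)) (\<beta> i)) \<inter> insert (\<beta> j) (Z (p (\<nu> j)) (\<beta> j)) = {}"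
      using g(4)[OF pA[OF \<nu>N[OF ij(1)]] \<beta>B(1)[OF ij(1)]] g(4)[OF pA[OF \<nu>N[OF ij(2)]] \<beta>B(1)[OF ij(2)]]
        g(5)[OF pA[OF \<nu>N[OF ij(1)]] \<beta>B(1)[OF ij(1)] pA[OF \<nu>N[OF ij(2)]] \<beta>B(1)[OF ij(2)]] \<beta>B(1)[OF ij(1)] \<beta>B(1)[OF ij(2)]
      by auto
    have 4: "insert (\<alpha> i') (S (\<nu> i')) \<subseteq> Y" if "i' \<in> I" for i' using SY[OF that] by auto
    have "(P \<union> W) \<inter> (P' \<union> W') = {}" if "P \<inter> P' = {}" "W \<inter> Y = {}" "W' \<inter> Y = {}" "W \<inter> W' = {}" "P \<subseteq> Y" "P' \<subseteq> Y"
      for P W P' W' :: "'a set" using that by blast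
    from this[OF 1 2[OF ij(1)] 2[OF ij(2)] 3 4[OF ij(1)] 4[OF ij(2)]]
    show "R i \<inter> R j = {}" unfolding Req .
  qed
  show ?thesis
  proof (rule disjoint_choice[OF I(1) Rdis, where s = "lm * r" and \<rho> = "3 * r + 1"])
    fix i assume i: "i \<in> I"
    note n = \<nu>N[OF i]
    have c2: "finite (g2 i)" "card (g2 i) = r"
      unfolding g2_def using cell_finite_card[OF G u pA[OF n] \<beta>B(1)[OF i] \<phi>L[OF pA[OF n] \<beta>B(1)[OF i]]] by auto
    have c1: "finite (g1 i)" "card (g1 i) = r"
    proof -
      have "g1 i \<in> H" unfolding g1_def using \<alpha>F(1)[OF i] by (simp add: nbrs_def)
      then show "finite (g1 i)" "card (g1 i) = r" using u by (auto simp: uniform_def)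
    qed
    have "card (R i) \<le> card (S (\<nu> i)) + card (g1 i) + card (g2 i)"
      unfolding R_def by (intro order_trans[OF card_Un_le] add_mono order_refl)
    moreover have "card (S (\<nu> i)) \<le> r + 1" unfolding S_def using Kfin(1,2)[OF n] by (simp add: card_insert_if)
    ultimately show "finite (R i) \<and> card (R i) \<le> 3 * r + 1"
      unfolding R_def using c1 c2 Kfin(1)[OF n] by (simp add: S_def)
  next
    fix i X assume i: "i \<in> I" and X: "finite X" "card X \<le> card I * (lm * r + (3 * r + 1))" "X \<inter> R i = {}"
    note n = \<nu>N[OF i]
    let ?a = "p (\<nu> i)" and ?b = "q (\<nu> i)"
    note ab = pA[OF n] qB[OF n]
    have nab: "?a \<notin> B" "?b \<notin> A" "\<beta> i \<notin> A" using ab \<beta>B(1)[OF i] g(3) by auto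
    have Zab: "?a \<notin> Z ?a b" "?b \<notin> Z ?a b" if "b \<in> B" for b using g(4)[OF ab(1) that] ab by auto
    note ln = lab_notin[OF ab \<phi>L[OF ab]] lab_notin[OF ab \<omega>L[OF n]]
    have "?b \<in> Y" using SY(1)[OF i] KS[of "\<nu> i"] Kmem(2)[of "\<nu> i"] by auto
    then have b\<beta>: "?b \<noteq> \<beta> i" using \<beta>B(2)[OF i] by auto
    have \<omega>\<phi>: "\<omega> (\<nu> i) \<noteq> \<phi> ?a" unfolding \<omega>_def using muphi[OF ab] .
    have \<omega>K: "\<omega> (\<nu> i) \<notin> K (\<nu> i)" unfolding K_def cell_def using ln(4-6)[OF ab] ab \<omega>\<phi> by auto
    have \<omega>g2: "\<omega> (\<nu> i) \<notin> g2 i" unfolding g2_def cell_def using ln(4-6)[OF ab(1) \<beta>B(1)[OF i]] ab \<beta>B(1)[OF i] \<omega>\<phi> by auto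
    have \<alpha>K: "\<alpha> i \<notin> K (\<nu> i)" using \<alpha>F(1,2)[OF i] by (auto simp: nbrs_def)
    have "\<exists>S. embeds (Q i) H S \<and> S \<inter> X = {} \<and> finite S \<and> card S \<le> l i * r"
    proof (rule light_component[OF G lp ab u r _ Q[OF i], where g = "g1 i" and g' = "g2 i" and R = "R i"])
      show "g1 i \<in> H" unfolding g1_def using \<alpha>F(1)[OF i] by (simp add: nbrs_def)
      show "?b \<in> g1 i" unfolding g1_def using Kmem(2) nab ab by auto
      show "?a \<notin> g1 i" unfolding g1_def using \<alpha>F(2)[OF i] by auto
      show "g2 i \<in> H" unfolding g2_def using g(8)[OF ab(1) \<beta>B(1)[OF i] \<phi>L[OF ab(1) \<beta>B(1)[OF i]]] .
      show "?a \<in> g2 i" unfolding g2_def cell_def by simp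
      show "?b \<notin> g2 i" unfolding g2_def cell_def using nab ab b\<beta> ln(1-3)[OF ab] Zab[OF \<beta>B(1)[OF i]] by auto
      have "K (\<nu> i) \<inter> g2 i = {?a, \<phi> ?a}" unfolding K_def g2_def
        using cell_inter[OF G ab \<phi>L[OF ab] ab(1) \<beta>B(1)[OF i] \<phi>L[OF ab(1) \<beta>B(1)[OF i]]] b\<beta> by auto
      moreover have "\<alpha> i \<notin> g2 i"
      proof -
        have "\<alpha> i \<noteq> \<beta> i" "\<alpha> i \<notin> Z ?a (\<beta> i)" using \<beta>B(2)[OF i] \<beta>B(3)[OF i ab(1)] SY(2)[OF i] by auto
        moreover have "\<alpha> i \<noteq> ?a" "\<alpha> i \<noteq> \<phi> ?a" using \<alpha>F(2)[OF i] \<alpha>K Kmem(3)[of "\<nu> i"] by auto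
        ultimately show ?thesis unfolding g2_def cell_def by auto
      qed
      moreover have "\<phi> ?a \<noteq> ?a" using ln(1)[OF ab] ab by auto
      ultimately have "g1 i \<inter> g2 i = {\<phi> ?a}" unfolding g1_def by auto
      then show "is_singleton (g1 i \<inter> g2 i)" by simp
      show "cell Z ?a ?b (\<phi> ?a) \<union> g1 i \<union> g2 i \<subseteq> R i" unfolding R_def S_def K_def by auto
      show "finite X" "X \<inter> R i = {}" using X by auto
      show "5 \<le> l i" using l[OF i] by simp
      show "4 * (card X + 2 * r) + l i + 1 \<le> card A" "4 * (card X + 2 * r) + l i + 1 \<le> card B"
        using grid_sizeD[OF X(2) _ cA] grid_sizeD[OF X(2) _ cB] l[OF i] by blast+
    next
      fix Y assume Y: "finite Y" "Y \<inter> R i \<subseteq> cell Z ?a ?b (\<phi> ?a) \<or> Y \<inter> R i \<subseteq> g1 i \<union> g2 i"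
      \<comment> \<open>Inside the reserved set \<open>Y\<close> stays within the closing
        hyperedges, which miss the reserved label. So a constant \<open>mu\<close> never takes a
        value in \<open>Y\<close> on the line concerned, and an injective one takes at most
        \<open>card Y\<close>.\<close>
      have "\<omega> (\<nu> i) \<in> R i" unfolding R_def S_def by simp
      moreover have "\<omega> (\<nu> i) \<notin> g1 i" unfolding g1_def using \<omega>K \<alpha>F(3)[OF i] by auto
      ultimately have \<omega>Y: "mu ?a ?b \<notin> Y" using Y(2) \<omega>K \<omega>g2 unfolding K_def \<omega>_def by auto
      have "card {a\<in>A. mu a ?b \<in> Y} \<le> card Y"
        using muA[OF ab(2)]
      proof
        assume "inj_on (\<lambda>a. mu a ?b) A"
        then have "inj_on (\<lambda>a. mu a ?b) {a\<in>A. mu a ?b \<in> Y}" by (rule inj_on_subset) auto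
        then show ?thesis by (rule card_inj_on_le) (use Y(1) in auto)
      next
        assume "\<forall>a\<in>A. \<forall>a'\<in>A. mu a ?b = mu a' ?b"
        then have "mu a ?b \<notin> Y" if "a \<in> A" for a using ab(1) that \<omega>Y by metis
        then have "{a\<in>A. mu a ?b \<in> Y} = {}" by blast
        then show ?thesis by (metis card.empty le0)
      qed
      moreover have "card {b\<in>B. mu ?a b \<in> Y} \<le> card Y"
        using muB[OF ab(1)]
      proof
        assume "inj_on (mu ?a) B"
        then have "inj_on (mu ?a) {b\<in>B. mu ?a b \<in> Y}" by (rule inj_on_subset) auto
        then show ?thesis by (rule card_inj_on_le) (use Y(1) in auto)
      next
        assume "\<forall>b\<in>B. \<forall>b'\<in>B. mu ?a b = mu ?a b'"
        then have "mu ?a b \<notin> Y" if "b \<in> B" for b using ab(2) that \<omega>Y by metis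
        then have "{b\<in>B. mu ?a b \<in> Y} = {}" by blast
        then show ?thesis by (metis card.empty le0)
      qed
      ultimately show "card {a\<in>A. mu a ?b \<in> Y} \<le> card Y \<and> card {b\<in>B. mu ?a b \<in> Y} \<le> card Y" by blast
    qed
    moreover have "l i * r \<le> lm * r" using l[OF i] by simp
    ultimately show "\<exists>S. embeds (Q i) H S \<and> S \<inter> X = {} \<and> finite S \<and> card S \<le> lm * r" by (meson order_trans)
  qed
qed

section \<open>Grids in which every cell has a private label\<close>

definition unique_labels :: "'a set \<Rightarrow> 'a set \<Rightarrow> ('a \<Rightarrow> 'a \<Rightarrow> 'a set) \<Rightarrow> ('a \<Rightarrow> 'a \<Rightarrow> 'a) \<Rightarrow> bool" where
  "unique_labels A B L v \<longleftrightarrow> (\<forall>a\<in>A. \<forall>b\<in>B. v a b \<in> L a b \<and>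
     (\<forall>a'\<in>A. \<forall>b'\<in>B. v a b = v a' b' \<longrightarrow> a = a' \<and> b = b'))"

lemma unique_labelsD:
  assumes "unique_labels A B L v" "a \<in> A" "b \<in> B"
  shows "v a b \<in> L a b" "a' \<in> A \<Longrightarrow> b' \<in> B \<Longrightarrow> v a b = v a' b' \<longleftrightarrow> a = a' \<and> b = b'"
  using assms unfolding unique_labels_def by blast+

text \<open>With private labels one and the same choice serves as \<open>lam\<close> and as
  \<open>mu\<close>.\<close>

lemma unique_label_pair:
  assumes "unique_labels A B L v"
  shows "label_pair A B L v v"
  unfolding label_pair_def using unique_labelsD[OF assms] by auto

lemma unique_label_bound:
  assumes v: "unique_labels A B L v" and ab: "a0 \<in> A" "b0 \<in> B" and Y: "finite Y"
  shows "card {a\<in>A. v a b0 \<in> Y} \<le> card Y \<and> card {b\<in>B. v a0 b \<in> Y} \<le> card Y"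
proof
  have "inj_on (\<lambda>a. v a b0) {a\<in>A. v a b0 \<in> Y}"
    using unique_labelsD(2)[OF v] ab by (auto simp: inj_on_def)
  then show "card {a\<in>A. v a b0 \<in> Y} \<le> card Y" by (rule card_inj_on_le) (use Y in auto)
  have "inj_on (v a0) {b\<in>B. v a0 b \<in> Y}"
    using unique_labelsD(2)[OF v] ab by (auto simp: inj_on_def)
  then show "card {b\<in>B. v a0 b \<in> Y} \<le> card Y" by (rule card_inj_on_le) (use Y in auto)
qed

text \<open>Without filler the base cell is \<open>{a, b, c}\<close>. Exchanging \<open>a\<close> in
  one copy and \<open>b\<close> in another leaves two hyperedges with only \<open>c\<close> in
  common; a filler would belong to both. Each component makes two exchanges with vertices that
  differ throughout, whence \<open>2 * card I \<le> t\<close>.\<close>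

lemma light_embedding_unique3:
  assumes G: "grid H A B Z L" and v: "unique_labels A B L v"
    and Z: "\<And>a b. a \<in> A \<Longrightarrow> b \<in> B \<Longrightarrow> Z a b = {}"
    and full: "grid_full H t A B Z L"
    and u: "uniform r H" and r: "r \<ge> 3" and I: "finite I" "2 * card I \<le> t"
    and l: "\<And>i. i \<in> I \<Longrightarrow> 5 \<le> l i \<and> l i \<le> lm"
    and Q: "\<And>i. i \<in> I \<Longrightarrow> Q i \<in> {expansion r (path_graph (l i)), expansion r (cycle_graph (l i))}"
    and cA: "grid_size t (card I) lm r \<le> card A" and cB: "grid_size t (card I) lm r \<le> card B"
  shows "\<exists>S. (\<forall>i\<in>I. embeds (Q i) H (S i)) \<and> disjoint_family_on S I"
proof -
  note g = gridD[OF G]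
  define N where "N = (2 * (2 * t) + 1) * card I"
  have "N \<le> card A" "N \<le> card B"
  proof -
    have "N \<le> grid_size t (card I) lm r" unfolding N_def grid_size_def by simp
    then show "N \<le> card A" "N \<le> card B" using cA cB by linarith+
  qed
  then obtain p q where p: "p ` {..<N} \<subseteq> A" "inj_on p {..<N}" and q: "q ` {..<N} \<subseteq> B" "inj_on q {..<N}"
    using card_le_inj[of "{..<N}" A] card_le_inj[of "{..<N}" B] g(1,2) by auto
  have pA: "p n \<in> A" and qB: "q n \<in> B" if "n < N" for n using p(1) q(1) that by auto
  have pq: "p n \<noteq> p m" "q n \<noteq> q m" if "n < N" "m < N" "n \<noteq> m" for n m
    using p(2) q(2) that by (auto simp: inj_on_def)
  define c where "c n = v (p n) (q n)" for n
  define K where "K n = {p n, q n, c n}" for n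
  have cL: "c n \<in> L (p n) (q n)" if "n < N" for n unfolding c_def using unique_labelsD(1)[OF v pA[OF that] qB[OF that]] .
  have Kc: "K n = cell Z (p n) (q n) (c n)" if "n < N" for n
    unfolding K_def cell_def using Z[OF pA[OF that] qB[OF that]] by simp
  have Kd: "p n \<noteq> q n" "c n \<noteq> p n" "c n \<noteq> q n" if "n < N" for n
    using g(3) g(6)[OF pA[OF that] qB[OF that] cL[OF that]] pA[OF that] qB[OF that] by auto
  have Kdis: "disjoint_family_on K {..<N}"
  proof (unfold disjoint_family_on_def, intro ballI impI)
    fix n m assume nm: "n \<in> {..<N}" "m \<in> {..<N}" "n \<noteq> m"
    then have nm': "n < N" "m < N" by auto
    note ab = pA[OF nm'(1)] qB[OF nm'(1)] pA[OF nm'(2)] qB[OF nm'(2)]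
    have "c n \<noteq> c m" unfolding c_def using unique_labelsD(2)[OF v ab] pq[OF nm' nm(3)] by simp
    then show "K n \<inter> K m = {}" unfolding Kc[OF nm'(1)] Kc[OF nm'(2)]
      using cell_inter[OF G ab(1,2) cL[OF nm'(1)] ab(3,4) cL[OF nm'(2)]] pq[OF nm' nm(3)] by auto
  qed
  have ex: "\<exists>F. \<forall>n\<in>{..<N}. F n \<subseteq> nbrs H (K n - {w n}) - {w n} \<and> card (F n) = t" if w: "\<And>n. n < N \<Longrightarrow> w n = p n \<or> w n = q n" for w
  proof (rule bchoice, rule ballI)
    fix n assume "n \<in> {..<N}"
    then have n: "n < N" by simp
    have "t + 1 \<le> card (nbrs H (K n - {p n})) \<and> t + 1 \<le> card (nbrs H (K n - {q n}))"
      using full pA[OF n] qB[OF n] cL[OF n] unfolding grid_full_def Kc[OF n] by blast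
    then have "t + 1 \<le> card (nbrs H (K n - {w n}))" using w[OF n] by auto
    moreover have "card (nbrs H (K n - {w n})) - card {w n} \<le> card (nbrs H (K n - {w n}) - {w n})"
      by (intro diff_card_le_card_Diff) auto
    ultimately have "t \<le> card (nbrs H (K n - {w n}) - {w n})" by simp
    then show "\<exists>F. F \<subseteq> nbrs H (K n - {w n}) - {w n} \<and> card F = t"
      by (metis obtain_subset_with_card_n)
  qed
  obtain FA where FA: "\<And>n. n < N \<Longrightarrow> FA n \<subseteq> nbrs H (K n - {p n}) - {p n}" "\<And>n. n < N \<Longrightarrow> card (FA n) = t"
    using ex[of p] by auto
  obtain FB where FB: "\<And>n. n < N \<Longrightarrow> FB n \<subseteq> nbrs H (K n - {q n}) - {q n}" "\<And>n. n < N \<Longrightarrow> card (FB n) = t"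
    using ex[of q] by auto
  have Ffin: "finite (FA n)" "finite (FB n)" if "n < N" for n
    using FA(1)[OF that] FB(1)[OF that] finite_nbrs[OF u] by (meson finite_Diff finite_subset)+
  have "\<exists>\<nu>. inj_on \<nu> I \<and> \<nu> ` I \<subseteq> {..<N} \<and> (\<forall>i\<in>I. \<forall>j\<in>I. i \<noteq> j \<longrightarrow> (FA (\<nu> i) \<union> FB (\<nu> i)) \<inter> K (\<nu> j) = {})"
  proof (rule select_independent[OF Kdis, where d = "2 * t"])
    fix n assume "n \<in> {..<N}"
    then show "finite (FA n \<union> FB n) \<and> card (FA n \<union> FB n) \<le> 2 * t"
      using Ffin FA(2) FB(2) card_Un_le[of "FA n" "FB n"] by simp
  qed (use I N_def in auto)
  then obtain \<nu> where \<nu>: "inj_on \<nu> I" "\<nu> ` I \<subseteq> {..<N}"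
    "\<forall>i\<in>I. \<forall>j\<in>I. i \<noteq> j \<longrightarrow> (FA (\<nu> i) \<union> FB (\<nu> i)) \<inter> K (\<nu> j) = {}" by blast
  have \<nu>N: "\<nu> i < N" if "i \<in> I" for i using \<nu>(2) that by auto
  have \<nu>inj: "\<nu> i \<noteq> \<nu> j" if "i \<in> I" "j \<in> I" "i \<noteq> j" for i j using \<nu>(1) that by (auto simp: inj_on_def)
  \<comment> \<open>The Boolean tells the exchange of the row vertex from that of the column vertex;
    a single choice makes all of them distinct.\<close>
  have "\<exists>\<alpha>. inj_on \<alpha> (I \<times> (UNIV::bool set)) \<and> (\<forall>x\<in>I \<times> UNIV. \<alpha> x \<in> (if snd x then FA (\<nu> (fst x)) else FB (\<nu> (fst x))))"
  proof (rule distinct_representatives)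
    fix x assume "x \<in> I \<times> (UNIV::bool set)"
    then have "fst x \<in> I" by auto
    then show "finite (if snd x then FA (\<nu> (fst x)) else FB (\<nu> (fst x))) \<and>
        card (I \<times> (UNIV::bool set)) \<le> card (if snd x then FA (\<nu> (fst x)) else FB (\<nu> (fst x)))"
      using Ffin[OF \<nu>N] FA(2)[OF \<nu>N] FB(2)[OF \<nu>N] I by (simp add: card_cartesian_product)
  qed (use I in simp)
  then obtain \<gamma> where \<gamma>: "inj_on \<gamma> (I \<times> (UNIV::bool set))"
    "\<forall>x\<in>I \<times> UNIV. \<gamma> x \<in> (if snd x then FA (\<nu> (fst x)) else FB (\<nu> (fst x)))" by blast
  define \<alpha> where "\<alpha> i = \<gamma> (i, True)" for i
  define \<beta> where "\<beta> i = \<gamma> (i, False)" for i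
  have \<alpha>\<beta>: "\<alpha> i \<in> FA (\<nu> i)" "\<beta> i \<in> FB (\<nu> i)" if "i \<in> I" for i
    using bspec[OF \<gamma>(2), of "(i, True)"] bspec[OF \<gamma>(2), of "(i, False)"] that unfolding \<alpha>_def \<beta>_def by simp_all
  have ne: "\<alpha> i \<noteq> \<beta> j" "i \<noteq> j \<Longrightarrow> \<alpha> i \<noteq> \<alpha> j" "i \<noteq> j \<Longrightarrow> \<beta> i \<noteq> \<beta> j" if "i \<in> I" "j \<in> I" for i j
    unfolding \<alpha>_def \<beta>_def using inj_on_eq_iff[OF \<gamma>(1)] that by auto
  have \<alpha>F: "insert (\<alpha> i) (K (\<nu> i) - {p (\<nu> i)}) \<in> H" "\<alpha> i \<notin> K (\<nu> i)"
    and \<beta>F: "insert (\<beta> i) (K (\<nu> i) - {q (\<nu> i)}) \<in> H" "\<beta> i \<notin> K (\<nu> i)" if "i \<in> I" for i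
    using \<alpha>\<beta>[OF that] FA(1)[OF \<nu>N[OF that]] FB(1)[OF \<nu>N[OF that]] by (auto simp: nbrs_def)
  define R where "R i = insert (\<alpha> i) (insert (\<beta> i) (K (\<nu> i)))" for i
  have Rdis: "disjoint_family_on R I" unfolding disjoint_family_on_def
  proof (intro ballI impI)
    fix i j assume ij: "i \<in> I" "j \<in> I" "i \<noteq> j"
    have "K (\<nu> i) \<inter> K (\<nu> j) = {}" using Kdis \<nu>N \<nu>inj[OF ij] ij unfolding disjoint_family_on_def by auto
    moreover have "\<alpha> i \<notin> K (\<nu> j)" "\<beta> i \<notin> K (\<nu> j)" "\<alpha> j \<notin> K (\<nu> i)" "\<beta> j \<notin> K (\<nu> i)"
      using \<nu>(3)[rule_format, of i j] \<nu>(3)[rule_format, of j i] \<alpha>\<beta>[OF ij(1)] \<alpha>\<beta>[OF ij(2)] ij by auto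
    ultimately show "R i \<inter> R j = {}" unfolding R_def using ne[OF ij(1,2)] ne[OF ij(2,1)] ij(3) by auto
  qed
  show ?thesis
  proof (rule disjoint_choice[OF I(1) Rdis, where s = "lm * r" and \<rho> = "3 * r + 1"])
    fix i assume i: "i \<in> I"
    have "card (R i) \<le> 5" unfolding R_def K_def by (simp add: card_insert_if)
    then show "finite (R i) \<and> card (R i) \<le> 3 * r + 1" using r by (simp add: R_def K_def)
  next
    fix i X assume i: "i \<in> I" and X: "finite X" "card X \<le> card I * (lm * r + (3 * r + 1))" "X \<inter> R i = {}"
    note n = \<nu>N[OF i]
    let ?a = "p (\<nu> i)" and ?b = "q (\<nu> i)" and ?c = "c (\<nu> i)"
    note ab = pA[OF n] qB[OF n] and kd = Kd[OF n]
    have "\<exists>S. embeds (Q i) H S \<and> S \<inter> X = {} \<and> finite S \<and> card S \<le> l i * r"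
    proof (rule light_component[OF G unique_label_pair[OF v] ab u r _ Q[OF i],
          where g = "insert (\<alpha> i) (K (\<nu> i) - {?a})" and g' = "insert (\<beta> i) (K (\<nu> i) - {?b})" and R = "R i"])
      show "insert (\<alpha> i) (K (\<nu> i) - {?a}) \<in> H" "insert (\<beta> i) (K (\<nu> i) - {?b}) \<in> H" using \<alpha>F \<beta>F i by auto
      show "?b \<in> insert (\<alpha> i) (K (\<nu> i) - {?a})" "?a \<in> insert (\<beta> i) (K (\<nu> i) - {?b})"
        unfolding K_def using kd by auto
      show "?a \<notin> insert (\<alpha> i) (K (\<nu> i) - {?a})" "?b \<notin> insert (\<beta> i) (K (\<nu> i) - {?b})"
        using \<alpha>F(2)[OF i] \<beta>F(2)[OF i] unfolding K_def by auto
      have "insert (\<alpha> i) (K (\<nu> i) - {?a}) \<inter> insert (\<beta> i) (K (\<nu> i) - {?b}) = {?c}"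
        using \<alpha>F(2)[OF i] \<beta>F(2)[OF i] ne(1)[OF i i] kd unfolding K_def by auto
      then show "is_singleton (insert (\<alpha> i) (K (\<nu> i) - {?a}) \<inter> insert (\<beta> i) (K (\<nu> i) - {?b}))" by simp
      show "cell Z ?a ?b (v ?a ?b) \<union> insert (\<alpha> i) (K (\<nu> i) - {?a}) \<union> insert (\<beta> i) (K (\<nu> i) - {?b}) \<subseteq> R i"
        unfolding R_def using Kc[OF n] unfolding c_def by auto
      show "finite X" "X \<inter> R i = {}" using X by auto
      show "5 \<le> l i" using l[OF i] by simp
      show "4 * (card X + 2 * r) + l i + 1 \<le> card A" "4 * (card X + 2 * r) + l i + 1 \<le> card B"
        using grid_sizeD[OF X(2) _ cA] grid_sizeD[OF X(2) _ cB] l[OF i] by blast+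
    next
      fix Y :: "'a set" assume "finite Y"
      then show "card {a\<in>A. v a ?b \<in> Y} \<le> card Y \<and> card {b\<in>B. v ?a b \<in> Y} \<le> card Y"
        by (rule unique_label_bound[OF v ab])
    qed
    moreover have "l i * r \<le> lm * r" using l[OF i] by simp
    ultimately show "\<exists>S. embeds (Q i) H S \<and> S \<inter> X = {} \<and> finite S \<and> card S \<le> lm * r" by (meson order_trans)
  qed
qed

text \<open>For each family every vertex of \<open>X\<close> rules out at most one
  candidate.\<close>

lemma pick_avoiding:
  assumes "finite A" "finite \<F>" "\<forall>F\<in>\<F>. disjoint_family_on F A" "finite X" "card \<F> * card X < card A"
  shows "\<exists>a\<in>A. \<forall>F\<in>\<F>. F a \<inter> X = {}"
proof (rule ccontr)
  assume "\<not> ?thesis"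
  then have "A \<subseteq> (\<Union>F\<in>\<F>. {a\<in>A. F a \<inter> X \<noteq> {}})" by blast
  then have "card A \<le> card (\<Union>F\<in>\<F>. {a\<in>A. F a \<inter> X \<noteq> {}})" using assms(1,2) by (intro card_mono) auto
  also have "\<dots> \<le> card \<F> * card X" by (intro card_UN_le_mult assms(2) card_meeting_le bspec[OF assms(3)] assms(4))
  finally show False using assms(5) by simp
qed

lemma grid_columns_disjoint:
  assumes "grid H A B Z L"
  shows "disjoint_family_on (\<lambda>a. \<Union>b\<in>B. Z a b) A" "disjoint_family_on (\<lambda>b. \<Union>a\<in>A. Z a b) B"
proof -
  note g = gridD[OF assms]
  have "Z a b \<inter> Z a' b' = {}" if "a \<in> A" "b \<in> B" "a' \<in> A" "b' \<in> B" "a \<noteq> a' \<or> b \<noteq> b'" for a b a' b'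
    using g(5)[of a b a' b'] that by auto
  then show "disjoint_family_on (\<lambda>a. \<Union>b\<in>B. Z a b) A" "disjoint_family_on (\<lambda>b. \<Union>a\<in>A. Z a b) B"
    unfolding disjoint_family_on_def by blast+
qed

lemma unique_labels_disjoint:
  assumes "unique_labels A B L v"
  shows "disjoint_family_on (\<lambda>a. v a ` B) A" "disjoint_family_on (\<lambda>b. (\<lambda>a. v a b) ` A) B"
  unfolding disjoint_family_on_def using unique_labelsD(2)[OF assms] by auto

text \<open>The cells at (a, z) and (b, z) in two further grids, with \<open>z\<close> in a third
  class, close the odd cycle: their fillers and labels are separate, so they meet in
  \<open>z\<close> only. All three vertices are chosen after \<open>X\<close> is known, so the
  reserved sets are empty.\<close>

lemma light_embedding_unique4:
  fixes H :: "'a set set"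
  assumes Gab: "grid H A B Zab Lab" and Gac: "grid H A C Zac Lac" and Gbc: "grid H B C Zbc Lbc"
    and vab: "unique_labels A B Lab vab" and vac: "unique_labels A C Lac vac" and vbc: "unique_labels B C Lbc vbc"
    and sep: "\<And>a b z. a \<in> A \<Longrightarrow> b \<in> B \<Longrightarrow> z \<in> C \<Longrightarrow> Zac a z \<inter> insert b (Zbc b z) = {} \<and> a \<notin> Zbc b z \<and>
        vac a z \<notin> insert b (Zbc b z) \<and> vbc b z \<notin> insert a (Zac a z)"
    and u: "uniform r H" and r: "r \<ge> 3" and I: "finite I"
    and l: "\<And>i. i \<in> I \<Longrightarrow> 5 \<le> l i \<and> l i \<le> lm"
    and Q: "\<And>i. i \<in> I \<Longrightarrow> Q i \<in> {expansion r (path_graph (l i)), expansion r (cycle_graph (l i))}"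
    and cA: "6 * (card I * (lm * r)) + 8 * r + lm + 2 < card A"
    and cB: "6 * (card I * (lm * r)) + 8 * r + lm + 2 < card B"
    and cC: "6 * (card I * (lm * r)) + 8 * r + lm + 2 < card C"
  shows "\<exists>S. (\<forall>i\<in>I. embeds (Q i) H (S i)) \<and> disjoint_family_on S I"
proof (rule disjoint_choice[OF I, where R = "\<lambda>_. {}" and s = "lm * r" and \<rho> = 0])
  fix i and X :: "'a set" assume i: "i \<in> I" and X: "finite X" "card X \<le> card I * (lm * r + 0)"
  note fin = gridD(1,2)[OF Gab] gridD(2)[OF Gac]
  have cX: "6 * card X + 8 * r + lm + 2 < card A" "6 * card X + 8 * r + lm + 2 < card B" "6 * card X + 8 * r + lm + 2 < card C"
    using X(2) cA cB cC by simp_all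
  have sg: "disjoint_family_on (\<lambda>a. {a}) D" for D :: "'a set" by (auto simp: disjoint_family_on_def)
  \<comment> \<open>\<open>a\<close> is chosen first. As \<open>b\<close> and \<open>z\<close> are
    still open, \<open>X\<close> must be kept off all fillers and labels of the row \<open>a\<close>
    in both grids.\<close>
  define FF where "FF = {\<lambda>a. {a}, \<lambda>a. \<Union>b\<in>B. Zab a b, \<lambda>a. \<Union>z\<in>C. Zac a z, \<lambda>a. vab a ` B, \<lambda>a. vac a ` C}"
  have "card FF \<le> 5" unfolding FF_def using card_length[of "[\<lambda>a. {a}, \<lambda>a. \<Union>b\<in>B. Zab a b, \<lambda>a. \<Union>z\<in>C. Zac a z, \<lambda>a. vab a ` B, \<lambda>a. vac a ` C]"] by simp
  then have "card FF * card X \<le> 5 * card X" by (rule mult_right_mono) simp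
  then have cFF: "card FF * card X < card A" using cX(1) by linarith
  have djFF: "\<forall>F\<in>FF. disjoint_family_on F A" unfolding FF_def
    by (simp only: ball_simps simp_thms sg grid_columns_disjoint(1)[OF Gab] grid_columns_disjoint(1)[OF Gac]
        unique_labels_disjoint(1)[OF vab] unique_labels_disjoint(1)[OF vac])
  have "finite FF" unfolding FF_def by simp
  have "\<exists>a\<in>A. \<forall>F\<in>FF. F a \<inter> X = {}"
    by (rule pick_avoiding[OF fin(1) \<open>finite FF\<close> djFF X(1) cFF])
  then obtain a where a: "a \<in> A" "\<forall>F\<in>FF. F a \<inter> X = {}" by (elim bexE)
  have memFF: "(\<lambda>a. {a}) \<in> FF" "(\<lambda>a. \<Union>b\<in>B. Zab a b) \<in> FF" "(\<lambda>a. \<Union>z\<in>C. Zac a z) \<in> FF"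
    "(\<lambda>a. vab a ` B) \<in> FF" "(\<lambda>a. vac a ` C) \<in> FF"
    unfolding FF_def by (simp_all only: insert_iff simp_thms)
  have aX: "a \<notin> X" "\<And>b. b \<in> B \<Longrightarrow> Zab a b \<inter> X = {}" "\<And>z. z \<in> C \<Longrightarrow> Zac a z \<inter> X = {}"
    "\<And>b. b \<in> B \<Longrightarrow> vab a b \<notin> X" "\<And>z. z \<in> C \<Longrightarrow> vac a z \<notin> X"
    using bspec[OF a(2) memFF(1)] bspec[OF a(2) memFF(2)] bspec[OF a(2) memFF(3)] bspec[OF a(2) memFF(4)] bspec[OF a(2) memFF(5)] by auto
  define GG where "GG = {\<lambda>z. {z}, \<lambda>z. \<Union>b\<in>B. Zbc b z, \<lambda>z. (\<lambda>b. vbc b z) ` B}"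
  have "card GG \<le> 3" unfolding GG_def using card_length[of "[\<lambda>z. {z}, \<lambda>z. \<Union>b\<in>B. Zbc b z, \<lambda>z. (\<lambda>b. vbc b z) ` B]"] by simp
  then have "card GG * card X \<le> 3 * card X" by (rule mult_right_mono) simp
  then have cGG: "card GG * card X < card C" using cX(3) by linarith
  have djGG: "\<forall>F\<in>GG. disjoint_family_on F C" unfolding GG_def
    by (simp only: ball_simps simp_thms sg grid_columns_disjoint(2)[OF Gbc] unique_labels_disjoint(2)[OF vbc])
  have "finite GG" unfolding GG_def by simp
  have "\<exists>z\<in>C. \<forall>F\<in>GG. F z \<inter> X = {}"
    by (rule pick_avoiding[OF fin(3) \<open>finite GG\<close> djGG X(1) cGG])
  then obtain z where z: "z \<in> C" "\<forall>F\<in>GG. F z \<inter> X = {}" by (elim bexE)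
  have memGG: "(\<lambda>z. {z}) \<in> GG" "(\<lambda>z. \<Union>b\<in>B. Zbc b z) \<in> GG" "(\<lambda>z. (\<lambda>b. vbc b z) ` B) \<in> GG"
    unfolding GG_def by (simp_all only: insert_iff simp_thms)
  have zX: "z \<notin> X" "\<And>b. b \<in> B \<Longrightarrow> Zbc b z \<inter> X = {}" "\<And>b. b \<in> B \<Longrightarrow> vbc b z \<notin> X"
    using bspec[OF z(2) memGG(1)] bspec[OF z(2) memGG(2)] bspec[OF z(2) memGG(3)] by auto
  \<comment> \<open>\<open>b\<close> comes last. Its label with \<open>z\<close> must differ from
    that of the cell (a, z), as otherwise the closing cells would meet a second time; hence the
    avoided set is enlarged by \<open>vac a z\<close>.\<close>
  define HH where "HH = {\<lambda>b. {b}, \<lambda>b. {vbc b z}}"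
  have "card HH \<le> 2" unfolding HH_def by (simp add: card_insert_if)
  then have "card HH * card (insert (vac a z) X) \<le> 2 * card (insert (vac a z) X)" by (rule mult_right_mono) simp
  also have "\<dots> \<le> 2 * (card X + 1)" using X(1) by (simp add: card_insert_if)
  also have "\<dots> < card B" using cX(2) by simp
  finally have cHH: "card HH * card (insert (vac a z) X) < card B" .
  have "disjoint_family_on (\<lambda>b. {vbc b z}) B"
    using unique_labelsD(2)[OF vbc] z(1) by (auto simp: disjoint_family_on_def)
  then have djHH: "\<forall>F\<in>HH. disjoint_family_on F B" unfolding HH_def by (simp only: ball_simps simp_thms sg)
  have "finite HH" unfolding HH_def by simp
  have "\<exists>b\<in>B. \<forall>F\<in>HH. F b \<inter> insert (vac a z) X = {}"
    by (rule pick_avoiding[OF fin(2) \<open>finite HH\<close> djHH _ cHH]) (use X(1) in simp)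
  then obtain b where b: "b \<in> B" "\<forall>F\<in>HH. F b \<inter> insert (vac a z) X = {}" by (elim bexE)
  have memHH: "(\<lambda>b. {b}) \<in> HH" "(\<lambda>b. {vbc b z}) \<in> HH"
    unfolding HH_def by (simp_all only: insert_iff simp_thms)
  have bX: "b \<notin> X" "vbc b z \<noteq> vac a z"
    using bspec[OF b(2) memHH(1)] bspec[OF b(2) memHH(2)] by auto
  let ?g = "cell Zbc b z (vbc b z)" and ?g' = "cell Zac a z (vac a z)"
  let ?R = "cell Zab a b (vab a b) \<union> ?g \<union> ?g'"
  have ab: "a \<notin> C" "b \<notin> C" "a \<noteq> b" using gridD(3)[OF Gab] gridD(3)[OF Gac] gridD(3)[OF Gbc] a(1) b(1) z(1) by auto
  note lac = unique_labelsD(1)[OF vac a(1) z(1)] and lbc = unique_labelsD(1)[OF vbc b(1) z(1)]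
  have nz: "vac a z \<noteq> z" "vbc b z \<noteq> z" "vac a z \<noteq> a" "vbc b z \<noteq> b" "z \<notin> Zac a z" "z \<notin> Zbc b z"
    using gridD(6)[OF Gac a(1) z(1) lac] gridD(6)[OF Gbc b(1) z(1) lbc] gridD(4)[OF Gac a(1) z(1)]
      gridD(4)[OF Gbc b(1) z(1)] a(1) b(1) z(1) by auto
  note sp = sep[OF a(1) b(1) z(1)]
  have "\<exists>S. embeds (Q i) H S \<and> S \<inter> X = {} \<and> finite S \<and> card S \<le> l i * r"
  proof (rule light_component[OF Gab unique_label_pair[OF vab] a(1) b(1) u r _ Q[OF i], where g = ?g and g' = ?g' and R = ?R])
    show "?g \<in> H" "?g' \<in> H" using gridD(8)[OF Gbc b(1) z(1) lbc] gridD(8)[OF Gac a(1) z(1) lac] by auto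
    show "b \<in> ?g" "a \<in> ?g'" by (auto simp: cell_def)
    show "a \<notin> ?g" "b \<notin> ?g'" using sp ab a(1) b(1) z(1) unfolding cell_def by auto
    have "?g \<inter> ?g' = {z}" using sp ab nz bX(2) unfolding cell_def by auto
    then show "is_singleton (?g \<inter> ?g')" by simp
    show "?R \<subseteq> ?R" ..
    show "finite X" using X by simp
    show "X \<inter> ?R = {}" unfolding cell_def
      using aX(1) aX(2,4)[OF b(1)] aX(3,5)[OF z(1)] bX(1) zX(1) zX(2,3)[OF b(1)] by auto
    show "5 \<le> l i" using l[OF i] by simp
    have "l i \<le> lm" using l[OF i] by simp
    then show "4 * (card X + 2 * r) + l i + 1 \<le> card A" "4 * (card X + 2 * r) + l i + 1 \<le> card B"
      using cX(1,2) by simp_all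
  next
    fix Y :: "'a set" assume "finite Y"
    then show "card {a\<in>A. vab a b \<in> Y} \<le> card Y \<and> card {b\<in>B. vab a b \<in> Y} \<le> card Y"
      by (rule unique_label_bound[OF vab a(1) b(1)])
  qed
  moreover have "l i * r \<le> lm * r" using l[OF i] by simp
  ultimately show "\<exists>S. embeds (Q i) H S \<and> S \<inter> X = {} \<and> finite S \<and> card S \<le> lm * r" by (meson order_trans)
qed (auto simp: disjoint_family_on_def)

section \<open>From canonical labels to embeddings\<close>

lemma canonicalD:
  assumes "canonical A B L T \<Phi> \<Psi> U"
  shows "a \<in> A \<Longrightarrow> b \<in> B \<Longrightarrow> L a b = T \<union> \<Phi> a \<union> \<Psi> b \<union> U a b"
    "a \<in> A \<Longrightarrow> b \<in> B \<Longrightarrow> T \<inter> \<Phi> a = {}" "a \<in> A \<Longrightarrow> b \<in> B \<Longrightarrow> T \<inter> \<Psi> b = {}"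
    "a \<in> A \<Longrightarrow> b \<in> B \<Longrightarrow> T \<inter> U a b = {}" "a \<in> A \<Longrightarrow> b \<in> B \<Longrightarrow> \<Phi> a \<inter> \<Psi> b = {}"
    "a \<in> A \<Longrightarrow> a' \<in> A \<Longrightarrow> a \<noteq> a' \<Longrightarrow> \<Phi> a \<inter> \<Phi> a' = {}"
    "b \<in> B \<Longrightarrow> b' \<in> B \<Longrightarrow> b \<noteq> b' \<Longrightarrow> \<Psi> b \<inter> \<Psi> b' = {}"
    "a \<in> A \<Longrightarrow> a' \<in> A \<Longrightarrow> b \<in> B \<Longrightarrow> \<Phi> a \<inter> U a' b = {}"
    "a \<in> A \<Longrightarrow> b \<in> B \<Longrightarrow> b' \<in> B \<Longrightarrow> \<Psi> b \<inter> U a b' = {}"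
    "a \<in> A \<Longrightarrow> a' \<in> A \<Longrightarrow> b \<in> B \<Longrightarrow> b' \<in> B \<Longrightarrow> (a, b) \<noteq> (a', b') \<Longrightarrow> U a b \<inter> U a' b' = {}"
  using assms unfolding canonical_def by simp_all

text \<open>\<open>lam\<close> is a row label and \<open>mu\<close> a second row label or a column
  label. So \<open>mu\<close> is injective in one direction and constant in the other, the situation
  of \<open>light_embedding_rows\<close>.\<close>

lemma canonical_rows_embedding:
  assumes G: "grid H A B Z L" and can: "canonical A B L T \<Phi> \<Psi> U"
    and \<phi>: "\<And>a. a \<in> A \<Longrightarrow> \<phi> a \<in> \<Phi> a"
    and mu: "(\<forall>a\<in>A. \<phi>' a \<in> \<Phi> a - {\<phi> a}) \<or> (\<forall>b\<in>B. \<psi> b \<in> \<Psi> b)"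
    and full: "grid_full H t A B Z L"
    and u: "uniform r H" and r: "r \<ge> 3" and I: "finite I" "card I + 1 \<le> t"
    and l: "\<And>i. i \<in> I \<Longrightarrow> 5 \<le> l i \<and> l i \<le> lm"
    and Q: "\<And>i. i \<in> I \<Longrightarrow> Q i \<in> {expansion r (path_graph (l i)), expansion r (cycle_graph (l i))}"
    and cA: "grid_size t (card I) lm r \<le> card A" and cB: "grid_size t (card I) lm r \<le> card B"
  shows "\<exists>S. (\<forall>i\<in>I. embeds (Q i) H (S i)) \<and> disjoint_family_on S I"
  using mu
proof
  note c = canonicalD[OF can]
  assume \<phi>': "\<forall>a\<in>A. \<phi>' a \<in> \<Phi> a - {\<phi> a}"
  have in\<Phi>: "\<phi> a \<in> \<Phi> a" "\<phi>' a \<in> \<Phi> a" "\<phi>' a \<noteq> \<phi> a" if "a \<in> A" for a using \<phi> \<phi>' that by auto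
  have dis: "{\<phi> a, \<phi>' a} \<inter> {\<phi> a', \<phi>' a'} = {}" if "a \<in> A" "a' \<in> A" "a \<noteq> a'" for a a'
    using c(6)[OF that] in\<Phi>[OF that(1)] in\<Phi>[OF that(2)] by auto
  have "label_pair A B L (\<lambda>a b. \<phi> a) (\<lambda>a b. \<phi>' a)" unfolding label_pair_def
  proof (intro conjI ballI impI)
    fix a b assume "a \<in> A" "b \<in> B"
    then show "\<phi> a \<in> L a b" "\<phi>' a \<in> L a b" using c(1) in\<Phi> by auto
  next
    fix a b b' assume "a \<in> A" then show "\<phi> a \<noteq> \<phi>' a" using in\<Phi>(3)[of a] by simp
  next
    fix a a' assume "a \<in> A" "a' \<in> A" "a \<noteq> a'" then show "\<phi> a \<noteq> \<phi>' a'" using dis[of a a'] by auto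
  qed (use dis in blast)
  then show ?thesis
  proof (rule light_embedding_rows[OF G _ _ _ _ full u r I l Q cA cB])
    have "inj_on \<phi>' A" using dis by (auto simp: inj_on_def)
    then show "inj_on (\<lambda>a. \<phi>' a) A \<or> (\<forall>a\<in>A. \<forall>a'\<in>A. \<phi>' a = \<phi>' a')" by simp
  qed (use in\<Phi> in auto)
next
  note c = canonicalD[OF can]
  assume \<psi>: "\<forall>b\<in>B. \<psi> b \<in> \<Psi> b"
  have d1: "\<phi> a \<noteq> \<phi> a'" if "a \<in> A" "a' \<in> A" "a \<noteq> a'" for a a'
    using c(6)[OF that] \<phi>[OF that(1)] \<phi>[OF that(2)] by auto
  have d2: "\<psi> b \<noteq> \<psi> b'" if "b \<in> B" "b' \<in> B" "b \<noteq> b'" for b b' using c(7)[OF that] \<psi> that by auto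
  have d3: "\<phi> a \<noteq> \<psi> b" if "a \<in> A" "b \<in> B" for a b 
    using c(5)[OF that] \<phi>[OF that(1)] \<psi>[rule_format, OF that(2)] by auto
  have "label_pair A B L (\<lambda>a b. \<phi> a) (\<lambda>a b. \<psi> b)" unfolding label_pair_def
  proof (intro conjI ballI impI)
    fix a b assume "a \<in> A" "b \<in> B"
    then show "\<phi> a \<in> L a b" "\<psi> b \<in> L a b" using c(1) \<phi> \<psi> by auto
  next
    fix a b a' b' assume "a \<in> A" "b \<in> B" "a' \<in> A" "b' \<in> B" "a \<noteq> a'" "b \<noteq> b'"
    then show "{\<phi> a, \<psi> b} \<inter> {\<phi> a', \<psi> b'} = {}" using d1[of a a'] d2[of b b'] d3[of a b'] d3[of a' b] by auto
  qed (use d3 in auto)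
  then show ?thesis
  proof (rule light_embedding_rows[OF G _ _ _ _ full u r I l Q cA cB])
    fix a
    have "inj_on \<psi> B" using d2 by (auto simp: inj_on_def)
    then show "inj_on (\<lambda>b. \<psi> b) B \<or> (\<forall>b\<in>B. \<forall>b'\<in>B. \<psi> b = \<psi> b')" by simp
  next
    fix a b assume "a \<in> A" "b \<in> B" then show "\<psi> b \<noteq> \<phi> a" using d3[of a b] by auto
  qed auto
qed

lemma grid_full_transpose:
  assumes "grid_full H t A B Z L"
  shows "grid_full H t B A (\<lambda>b a. Z a b) (\<lambda>b a. L a b)"
  unfolding grid_full_def
proof (intro ballI conjI)
  fix b a c assume "b \<in> B" "a \<in> A" "c \<in> L a b"
  then have "t + 1 \<le> card (nbrs H (cell Z a b c - {a})) \<and> t + 1 \<le> card (nbrs H (cell Z a b c - {b}))"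
    using assms unfolding grid_full_def by blast
  then show "t + 1 \<le> card (nbrs H (cell (\<lambda>b a. Z a b) b a c - {b}))" "t + 1 \<le> card (nbrs H (cell (\<lambda>b a. Z a b) b a c - {a}))"
    unfolding cell_transpose[of Z b a c] by blast+
qed

text \<open>If one cell has no private label, then \<open>t + 1 = card T + x + y\<close>. For
  \<open>x + y \<le> 1\<close> at least \<open>t\<close> labels are common and can cover the
  components; otherwise two varying labels drive the paths. Private labels in all cells are returned
  as an alternative, because they may call for further grids.\<close>

lemma grid_embedding:
  fixes H :: "'a set set"
  assumes G: "grid H A B Z L" and can: "canonical A B L T \<Phi> \<Psi> U"
    and x: "\<And>a. a \<in> A \<Longrightarrow> card (\<Phi> a) = x" and y: "\<And>b. b \<in> B \<Longrightarrow> card (\<Psi> b) = y"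
    and Lc: "\<And>a b. a \<in> A \<Longrightarrow> b \<in> B \<Longrightarrow> finite (L a b) \<and> card (L a b) = t + 1"
    and full: "grid_full H t A B Z L"
    and u: "uniform r H" and r: "r \<ge> 3" and I: "finite I" "card I + 1 \<le> t"
    and l: "\<And>i. i \<in> I \<Longrightarrow> 5 \<le> l i \<and> l i \<le> lm"
    and Q: "\<And>i. i \<in> I \<Longrightarrow> Q i \<in> {expansion r (path_graph (l i)), expansion r (cycle_graph (l i))}"
    and sum: "(\<Sum>i\<in>I. (l i + 1) div 2) = t + 1"
    and cA: "grid_size t (card I) lm r \<le> card A" and cB: "grid_size t (card I) lm r \<le> card B"
    and cA': "3 * (card I * (lm * r + lm)) + 2 * lm + 1 \<le> card A"
    and cB': "3 * (card I * (lm * r + lm)) + 2 * lm + 1 \<le> card B"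
  shows "(\<exists>S. (\<forall>i\<in>I. embeds (Q i) H (S i)) \<and> disjoint_family_on S I) \<or> (\<exists>v. unique_labels A B L v)"
proof (cases "\<forall>a\<in>A. \<forall>b\<in>B. U a b \<noteq> {}")
  case True
  note c = canonicalD[OF can]
  define v where "v a b = (SOME x. x \<in> U a b)" for a b
  have v: "v a b \<in> U a b" if "a \<in> A" "b \<in> B" for a b
    unfolding v_def using True that by (simp add: some_in_eq)
  have "unique_labels A B L v" unfolding unique_labels_def
  proof (intro ballI conjI impI)
    fix a b assume ab: "a \<in> A" "b \<in> B"
    then show "v a b \<in> L a b" using c(1)[OF ab] v[OF ab] by auto
    fix a' b' assume ab': "a' \<in> A" "b' \<in> B" and eq: "v a b = v a' b'"
    have "(a, b) = (a', b')"
    proof (rule ccontr)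
      assume "(a, b) \<noteq> (a', b')"
      then have "U a b \<inter> U a' b' = {}" using c(10)[OF ab(1) ab'(1) ab(2) ab'(2)] by blast
      then show False using v[OF ab] v[OF ab'] eq by auto
    qed
    then show "a = a'" "b = b'" by auto
  qed
  then show ?thesis by blast
next
  case False
  note c = canonicalD[OF can]
  have ne: "A \<noteq> {}" "B \<noteq> {}" using cA' cB' by auto
  have fin: "finite T" "finite (\<Phi> a)" "finite (\<Psi> b)" "finite (U a b)" if "a \<in> A" "b \<in> B" for a b
    using c(1)[OF that] Lc[OF that] by auto
  have cnt: "t + 1 = card T + x + y + card (U a b)" if ab: "a \<in> A" "b \<in> B" for a b
  proof -
    note f = fin[OF ab]
    have "card (L a b) = card (T \<union> \<Phi> a \<union> \<Psi> b) + card (U a b)" unfolding c(1)[OF ab]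
      using f c(4)[OF ab] c(8)[OF ab(1) ab(1) ab(2)] c(9)[OF ab(1) ab(2) ab(2)]
      by (intro card_Un_disjoint) auto
    also have "card (T \<union> \<Phi> a \<union> \<Psi> b) = card (T \<union> \<Phi> a) + card (\<Psi> b)"
      using f c(3)[OF ab] c(5)[OF ab] by (intro card_Un_disjoint) auto
    also have "card (T \<union> \<Phi> a) = card T + card (\<Phi> a)" using f c(2)[OF ab] by (intro card_Un_disjoint) auto
    finally show ?thesis using Lc[OF ab] x[OF ab(1)] y[OF ab(2)] by simp
  qed
  from False obtain a0 b0 where "a0 \<in> A" "b0 \<in> B" "U a0 b0 = {}" by blast
  then have tot: "t + 1 = card T + x + y" using cnt[of a0 b0] by simp
  have finT: "finite T" using fin(1) ne by blast
  have TL: "T \<subseteq> L a b" if "a \<in> A" "b \<in> B" for a b using c(1)[OF that] by blast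
  have fins: "finite (\<Phi> a)" if "a \<in> A" for a using fin(2)[OF that] ne by blast
  have fins': "finite (\<Psi> b)" if "b \<in> B" for b using fin(3)[OF _ that] ne by blast
  note Gt = grid_transpose[OF G] and ct = canonical_transpose[OF can] and ft = grid_full_transpose[OF full]
  have ex1: "\<exists>\<phi>. \<forall>a\<in>D. \<phi> a \<in> W a" if "\<And>a. a \<in> D \<Longrightarrow> finite (W a) \<and> card (W a) \<ge> 1" for D and W :: "'a \<Rightarrow> 'a set"
  proof (rule bchoice, rule ballI)
    fix a assume "a \<in> D"
    then have "W a \<noteq> {}" using that[of a] by auto
    then show "\<exists>y. y \<in> W a" by blast
  qed
  have ex2: "\<exists>\<phi>. \<forall>a\<in>D. \<phi> a \<in> W a - {\<psi> a}" if "\<And>a. a \<in> D \<Longrightarrow> finite (W a) \<and> card (W a) \<ge> 2" for D \<psi> and W :: "'a \<Rightarrow> 'a set"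
  proof (rule ex1)
    fix a assume "a \<in> D"
    then have "finite (W a)" "card (W a) \<ge> 2" using that by auto
    then show "finite (W a - {\<psi> a}) \<and> card (W a - {\<psi> a}) \<ge> 1"
      using diff_card_le_card_Diff[of "{\<psi> a}" "W a"] by simp
  qed
  have "\<exists>S. (\<forall>i\<in>I. embeds (Q i) H (S i)) \<and> disjoint_family_on S I"
  proof -
    consider "x + y = 0" | "x = 1" "y = 0" | "x = 0" "y = 1" | "x \<ge> 2" | "x \<ge> 1" "y \<ge> 1" | "y \<ge> 2" by linarith
    then show ?thesis
    proof cases
      case 1
      then have 1: "(\<Sum>i\<in>I. (l i + 1) div 2) = card T" using sum tot by simp
      show ?thesis
        by (rule heavy_embedding[where \<omega> = undefined, OF G u r I(1) l Q finT TL disjI1[OF 1] cA' cB'])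
    next
      case 2
      obtain \<phi> where \<phi>: "\<forall>a\<in>A. \<phi> a \<in> \<Phi> a" using ex1[of A \<Phi>] fins x 2 by auto
      have "inj_on \<phi> A"
      proof (rule inj_onI)
        fix a a' assume A: "a \<in> A" "a' \<in> A" "\<phi> a = \<phi> a'"
        show "a = a'"
        proof (rule ccontr)
          assume "a \<noteq> a'"
          then have "\<Phi> a \<inter> \<Phi> a' = {}" using c(6)[OF A(1,2)] by blast
          then show False using \<phi>[rule_format, OF A(1)] \<phi>[rule_format, OF A(2)] A(3) by auto
        qed
      qed
      moreover have "\<forall>a\<in>A. \<forall>b\<in>B. \<phi> a \<in> L a b - T"
      proof (intro ballI)
        fix a b assume ab: "a \<in> A" "b \<in> B"
        show "\<phi> a \<in> L a b - T" using c(1)[OF ab] c(2)[OF ab] \<phi>[rule_format, OF ab(1)] by auto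
      qed
      moreover have "(\<Sum>i\<in>I. (l i + 1) div 2) = card T + 1" using sum tot 2 by simp
      ultimately have 2: "(\<Sum>i\<in>I. (l i + 1) div 2) = card T + 1 \<and> inj_on \<phi> A \<and> (\<forall>a\<in>A. \<forall>b\<in>B. \<phi> a \<in> L a b - T)" by blast
      show ?thesis
        by (rule heavy_embedding[where \<omega> = \<phi>, OF G u r I(1) l Q finT TL disjI2[OF 2] cA' cB'])
    next
      case 3
      obtain \<psi> where \<psi>: "\<forall>b\<in>B. \<psi> b \<in> \<Psi> b" using ex1[of B \<Psi>] fins' y 3 by auto
      have "inj_on \<psi> B"
      proof (rule inj_onI)
        fix a a' assume A: "a \<in> B" "a' \<in> B" "\<psi> a = \<psi> a'"
        show "a = a'"
        proof (rule ccontr)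
          assume "a \<noteq> a'"
          then have "\<Psi> a \<inter> \<Psi> a' = {}" using c(7)[OF A(1,2)] by blast
          then show False using \<psi>[rule_format, OF A(1)] \<psi>[rule_format, OF A(2)] A(3) by auto
        qed
      qed
      moreover have "\<forall>b\<in>B. \<forall>a\<in>A. \<psi> b \<in> L a b - T"
      proof (intro ballI)
        fix a b assume ab: "b \<in> B" "a \<in> A"
        show "\<psi> b \<in> L a b - T" using c(1)[OF ab(2,1)] c(3)[OF ab(2,1)] \<psi>[rule_format, OF ab(1)] by auto
      qed
      moreover have "(\<Sum>i\<in>I. (l i + 1) div 2) = card T + 1" using sum tot 3 by simp
      ultimately have 3: "(\<Sum>i\<in>I. (l i + 1) div 2) = card T + 1 \<and> inj_on \<psi> B \<and> (\<forall>b\<in>B. \<forall>a\<in>A. \<psi> b \<in> L a b - T)" by blast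
      show ?thesis
        by (rule heavy_embedding[where \<omega> = \<psi>, OF Gt u r I(1) l Q finT TL disjI2[OF 3] cB' cA'])
    next
      case 4
      obtain \<phi> where \<phi>: "\<forall>a\<in>A. \<phi> a \<in> \<Phi> a" using ex1[of A \<Phi>] fins x 4 by auto
      obtain \<phi>' where \<phi>': "\<forall>a\<in>A. \<phi>' a \<in> \<Phi> a - {\<phi> a}" using ex2[of A \<Phi> \<phi>] fins x 4 by auto
      show ?thesis
        by (rule canonical_rows_embedding[OF G can _ disjI1[OF \<phi>'] full u r I l Q cA cB]) (use \<phi> in auto)
    next
      case 5
      obtain \<phi> where \<phi>: "\<forall>a\<in>A. \<phi> a \<in> \<Phi> a" using ex1[of A \<Phi>] fins x 5 by auto
      obtain \<psi> where \<psi>: "\<forall>b\<in>B. \<psi> b \<in> \<Psi> b" using ex1[of B \<Psi>] fins' y 5 by auto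
      show ?thesis
        by (rule canonical_rows_embedding[OF G can _ disjI2[OF \<psi>] full u r I l Q cA cB]) (use \<phi> in auto)
    next
      case 6
      obtain \<psi> where \<psi>: "\<forall>b\<in>B. \<psi> b \<in> \<Psi> b" using ex1[of B \<Psi>] fins' y 6 by auto
      obtain \<psi>' where \<psi>': "\<forall>b\<in>B. \<psi>' b \<in> \<Psi> b - {\<psi> b}" using ex2[of B \<Psi> \<psi>] fins' y 6 by auto
      show ?thesis
        by (rule canonical_rows_embedding[OF Gt ct _ disjI1[OF \<psi>'] ft u r I l Q cB cA]) (use \<psi> in auto)
    qed
  qed
  then show ?thesis by blast
qed

section \<open>Grids in dense families\<close>

lemma card_supersets_le:
  assumes V: "finite V" and S: "finite S" "card S \<le> q"
  shows "card {f. S \<subseteq> f \<and> f \<subseteq> V \<and> card f = q} \<le> card V ^ (q - card S)"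
proof -
  let ?F = "{f. S \<subseteq> f \<and> f \<subseteq> V \<and> card f = q}"
  have "inj_on (\<lambda>f. f - S) ?F" by (auto simp: inj_on_def)
  moreover have "(\<lambda>f. f - S) ` ?F \<subseteq> {g. g \<subseteq> V \<and> card g = q - card S}"
    using S V by (auto simp: card_Diff_subset)
  moreover have "finite {g. g \<subseteq> V \<and> card g = q - card S}" using V by simp
  ultimately have "card ?F \<le> card {g. g \<subseteq> V \<and> card g = q - card S}" by (rule card_inj_on_le)
  also have "\<dots> = card V choose (q - card S)" using V by (rule n_subsets)
  also have "\<dots> \<le> card V ^ (q - card S)"
  proof (cases "q - card S \<le> card V")
    case True
    then show ?thesis by (rule binomial_le_pow)
  qed (simp add: binomial_eq_0)
  finally show ?thesis .
qed

text \<open>Averaging over all W \<subseteq> V: for a fixed \<open>f\<close> a fraction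
  \<open>1 / 2 ^ m\<close> of them contains \<open>f\<close> and misses \<open>L f\<close>.
  Confining sets to \<open>W\<close> and labels to its complement keeps labels off the rows, columns
  and fillers of all cells at once.\<close>

lemma separating_set_exists:
  assumes V: "finite V" and E: "finite E" "E \<noteq> {}"
    and f: "\<And>f. f \<in> E \<Longrightarrow> f \<subseteq> V \<and> L f \<subseteq> V \<and> f \<inter> L f = {} \<and> card f + card (L f) = m"
  shows "\<exists>W. card E \<le> 2 ^ m * card {f\<in>E. f \<subseteq> W \<and> L f \<inter> W = {}}"
proof (rule ccontr)
  assume "\<not> ?thesis"
  then have lt: "2 ^ m * card {f\<in>E. f \<subseteq> W \<and> L f \<inter> W = {}} < card E" for W by (meson not_le)
  have one: "card {W\<in>Pow V. f \<subseteq> W \<and> L f \<inter> W = {}} * 2 ^ m = 2 ^ card V" if fE: "f \<in> E" for f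
  proof -
    let ?R = "V - (f \<union> L f)"
    have "bij_betw (\<lambda>X. f \<union> X) (Pow ?R) {W\<in>Pow V. f \<subseteq> W \<and> L f \<inter> W = {}}"
      by (rule bij_betwI[where g = "\<lambda>W. W - f"]) (use f[OF fE] in auto)
    then have "card {W\<in>Pow V. f \<subseteq> W \<and> L f \<inter> W = {}} = card (Pow ?R)" by (simp add: bij_betw_same_card)
    also have "\<dots> = 2 ^ card ?R" using V by (simp add: card_Pow)
    also have "card ?R = card V - card (f \<union> L f)" using f[OF fE] V by (intro card_Diff_subset) (auto intro: finite_subset)
    also have "card (f \<union> L f) = m" using f[OF fE] V by (subst card_Un_disjoint) (auto intro: finite_subset)
    finally have "card {W\<in>Pow V. f \<subseteq> W \<and> L f \<inter> W = {}} * 2 ^ m = 2 ^ (card V - m + m)" by (simp add: power_add)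
    moreover have "m \<le> card V"
      using \<open>card (f \<union> L f) = m\<close> card_mono[OF V, of "f \<union> L f"] f[OF fE] by simp
    ultimately show ?thesis by simp
  qed
  have "2 ^ card V * card E = (\<Sum>f\<in>E. card {W\<in>Pow V. f \<subseteq> W \<and> L f \<inter> W = {}} * 2 ^ m)"
    using one by simp
  also have "\<dots> = (\<Sum>f\<in>E. \<Sum>W\<in>Pow V. if f \<subseteq> W \<and> L f \<inter> W = {} then 2 ^ m else 0)"
    using V by (intro sum.cong refl) (simp add: sum.If_cases Int_def)
  also have "\<dots> = (\<Sum>W\<in>Pow V. \<Sum>f\<in>E. if f \<subseteq> W \<and> L f \<inter> W = {} then 2 ^ m else 0)" by (rule sum.swap)
  also have "\<dots> = (\<Sum>W\<in>Pow V. 2 ^ m * card {f\<in>E. f \<subseteq> W \<and> L f \<inter> W = {}})"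
    using E by (intro sum.cong refl) (simp add: sum.If_cases Int_def)
  also have "\<dots> < (\<Sum>W\<in>Pow V. card E)" using V lt by (intro sum_strict_mono) auto
  also have "\<dots> = 2 ^ card V * card E" using V by (simp add: card_Pow)
  finally show False by simp
qed

text \<open>Double counting in the manner of Kovari, Sos and Turan, with n = \<open>card X\<close>.
  A fraction \<delta> / 2 of the \<open>y\<close> has at least \<delta> n / 2 neighbours, hence at
  least \<open>(\<delta> * n / (2 * N)) ^ N\<close> neighbour sets of size \<open>N\<close>; as
  there are at most \<open>n ^ N\<close> sets of that size, one of them is common to many
  \<open>y\<close>. The result is again a positive density, so the lemma can be iterated.\<close>

lemma common_neighbours:
  fixes \<delta> :: real
  assumes X: "finite X" and Y: "finite Y" and R: "R \<subseteq> X \<times> Y" "\<delta> * card X * card Y \<le> card R"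
    and \<delta>: "0 < \<delta>" and N: "1 \<le> N" "N \<le> card X" "2 * real N / \<delta> \<le> card X"
  shows "\<exists>A\<subseteq>X. card A = N \<and> \<delta> / 2 * (\<delta> / (2 * real N)) ^ N * card Y \<le> card {y\<in>Y. \<forall>x\<in>A. (x, y) \<in> R}"
proof (rule ccontr)
  assume "\<not> ?thesis"
  then have lt: "card {y\<in>Y. \<forall>x\<in>A. (x, y) \<in> R} < \<delta> / 2 * (\<delta> / (2 * real N)) ^ N * card Y" if "A \<subseteq> X" "card A = N" for A
    using that by (auto simp: not_le)
  define n where "n = card X"
  have "0 < 2 * real N / \<delta>" using \<delta> N by simp
  then have n: "0 < real n" using N(3) unfolding n_def by linarith
  define d where "d y = card {x\<in>X. (x, y) \<in> R}" for y
  have dn: "d y \<le> n" for y unfolding d_def n_def using X by (intro card_mono) auto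
  define Y1 where "Y1 = {y\<in>Y. \<delta> * n / 2 \<le> d y}"
  have Y1: "finite Y1" "Y1 \<subseteq> Y" using Y by (auto simp: Y1_def)
  have "R \<subseteq> (\<Union>y\<in>Y. (\<lambda>x. (x, y)) ` {x\<in>X. (x, y) \<in> R})" using R(1) by auto
  then have "card R \<le> card (\<Union>y\<in>Y. (\<lambda>x. (x, y)) ` {x\<in>X. (x, y) \<in> R})" using X Y by (intro card_mono) auto
  also have "\<dots> \<le> (\<Sum>y\<in>Y. card ((\<lambda>x. (x, y)) ` {x\<in>X. (x, y) \<in> R}))" by (rule card_UN_le[OF Y])
  also have "\<dots> = (\<Sum>y\<in>Y. d y)" unfolding d_def by (intro sum.cong refl card_image) (auto simp: inj_on_def)
  finally have "real (card R) \<le> (\<Sum>y\<in>Y. real (d y))" by (metis of_nat_le_iff of_nat_sum)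
  also have "\<dots> = (\<Sum>y\<in>Y1. real (d y)) + (\<Sum>y\<in>Y - Y1. real (d y))"
    using sum.subset_diff[OF Y1(2) Y, of "\<lambda>y. real (d y)"] by simp
  also have "(\<Sum>y\<in>Y1. real (d y)) \<le> (\<Sum>y\<in>Y1. real n)" using dn by (intro sum_mono) simp
  also have "(\<Sum>y\<in>Y - Y1. real (d y)) \<le> (\<Sum>y\<in>Y - Y1. \<delta> * n / 2)" by (intro sum_mono) (auto simp: Y1_def)
  also have "\<dots> \<le> card Y * (\<delta> * n / 2)" using \<delta> Y card_mono[OF Y, of "Y - Y1"] by (simp add: mult_right_mono)
  finally have "\<delta> * n * card Y \<le> card Y1 * n + card Y * (\<delta> * n / 2)" using R(2) unfolding n_def by simp
  then have "real n * (\<delta> / 2 * card Y) \<le> real n * real (card Y1)" by (simp add: algebra_simps)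
  then have cY1: "\<delta> / 2 * card Y \<le> card Y1" using n by (simp only: mult_le_cancel_left_pos)
  define m where "m = (\<delta> * n / (2 * real N)) ^ N"
  have m0: "0 \<le> m" unfolding m_def using \<delta> by simp
  have md: "m \<le> d y choose N" if "y \<in> Y1" for y
  proof -
    have dy: "\<delta> * n / 2 \<le> d y" using that by (simp add: Y1_def)
    have "real N \<le> \<delta> * n / 2" using N(3) \<delta> unfolding n_def by (simp add: field_simps)
    then have "N \<le> d y" using dy by linarith
    have "\<delta> * n / (2 * real N) \<le> d y / N" using dy N(1) by (simp add: field_simps)
    then have "m \<le> (d y / N) ^ N" unfolding m_def using \<delta> by (intro power_mono) auto
    also have "\<dots> \<le> d y choose N" using binomial_ge_n_over_k_pow_k[OF \<open>N \<le> d y\<close>, where 'a = real] by simp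
    finally show ?thesis .
  qed
  define \<A> where "\<A> = {A. A \<subseteq> X \<and> card A = N}"
  have finA: "finite \<A>" unfolding \<A>_def using X by simp
  have Nn: "N \<le> n" using N(2) by (simp add: n_def)
  obtain A0 where "A0 \<subseteq> X" "card A0 = N" using obtain_subset_with_card_n[of N X] Nn unfolding n_def by blast
  then have neA: "\<A> \<noteq> {}" unfolding \<A>_def by blast
  have "\<delta> / 2 * card Y * m \<le> card Y1 * m" using cY1 m0 by (rule mult_right_mono)
  also have "\<dots> = (\<Sum>y\<in>Y1. m)" by simp
  also have "\<dots> \<le> (\<Sum>y\<in>Y1. real (d y choose N))" using md by (intro sum_mono)
  also have "\<dots> \<le> (\<Sum>y\<in>Y. real (d y choose N))" using Y1 Y by (intro sum_mono2) auto
  also have "\<dots> = (\<Sum>y\<in>Y. real (card {A\<in>\<A>. \<forall>x\<in>A. (x, y) \<in> R}))"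
  proof (intro sum.cong refl arg_cong[where f = real])
    fix y
    have "{A\<in>\<A>. \<forall>x\<in>A. (x, y) \<in> R} = {A. A \<subseteq> {x\<in>X. (x, y) \<in> R} \<and> card A = N}" unfolding \<A>_def by auto
    then show "d y choose N = card {A\<in>\<A>. \<forall>x\<in>A. (x, y) \<in> R}" unfolding d_def using X by (simp add: n_subsets)
  qed
  also have "\<dots> = (\<Sum>y\<in>Y. \<Sum>A\<in>\<A>. if \<forall>x\<in>A. (x, y) \<in> R then 1 else 0)"
    using finA by (intro sum.cong refl) (simp add: sum.If_cases Int_def)
  also have "\<dots> = (\<Sum>A\<in>\<A>. \<Sum>y\<in>Y. if \<forall>x\<in>A. (x, y) \<in> R then 1 else 0)" by (rule sum.swap)
  also have "\<dots> = (\<Sum>A\<in>\<A>. real (card {y\<in>Y. \<forall>x\<in>A. (x, y) \<in> R}))"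
    using Y by (intro sum.cong refl) (simp add: sum.If_cases Int_def)
  also have "\<dots> < (\<Sum>A\<in>\<A>. \<delta> / 2 * (\<delta> / (2 * real N)) ^ N * card Y)"
    using finA neA lt by (intro sum_strict_mono) (auto simp: \<A>_def)
  also have "\<dots> = card \<A> * (\<delta> / 2 * (\<delta> / (2 * real N)) ^ N * card Y)" by simp
  also have "\<dots> \<le> real n ^ N * (\<delta> / 2 * (\<delta> / (2 * real N)) ^ N * card Y)"
  proof (rule mult_right_mono)
    have "card \<A> = n choose N" unfolding \<A>_def n_def using X by (rule n_subsets)
    then have "card \<A> \<le> n ^ N" using binomial_le_pow[OF Nn] by simp
    then show "real (card \<A>) \<le> real n ^ N" by (metis of_nat_le_iff of_nat_power)
  qed (use \<delta> in simp)
  also have "\<dots> = \<delta> / 2 * card Y * m" unfolding m_def by (simp add: power_mult_distrib power_divide)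
  finally show False by simp
qed

lemma grid_from_cells:
  assumes fin: "finite A" "finite B" and AB: "A \<inter> B = {}"
    and F: "\<And>a b. a \<in> A \<Longrightarrow> b \<in> B \<Longrightarrow> F (a, b) \<in> E \<and> a \<in> F (a, b) \<and> b \<in> F (a, b) \<and> (F (a, b) - {a, b}) \<inter> (A \<union> B) = {}"
    and dis: "disjoint_family_on (\<lambda>p. F p - {fst p, snd p}) (A \<times> B)"
    and E: "\<And>f. f \<in> E \<Longrightarrow> f \<subseteq> W \<and> L f \<inter> W = {} \<and> L f \<subseteq> nbrs H f \<and>
        (\<forall>c\<in>L f. \<forall>x\<in>f. t + 1 \<le> card (nbrs H (insert c f - {x})))"
  shows "grid H A B (\<lambda>a b. F (a, b) - {a, b}) (\<lambda>a b. L (F (a, b)))"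
    "grid_full H t A B (\<lambda>a b. F (a, b) - {a, b}) (\<lambda>a b. L (F (a, b)))"
proof -
  let ?Z = "\<lambda>a b. F (a, b) - {a, b}"
  have cell: "cell ?Z a b c = insert c (F (a, b))" if "a \<in> A" "b \<in> B" for a b c
    unfolding cell_def using F[OF that] by auto
  have W: "F (a, b) \<subseteq> W" "L (F (a, b)) \<inter> W = {}" "L (F (a, b)) \<subseteq> nbrs H (F (a, b))" if "a \<in> A" "b \<in> B" for a b
    using F[OF that] E by blast+
  show "grid H A B ?Z (\<lambda>a b. L (F (a, b)))" unfolding grid_def
  proof (intro conjI ballI impI)
    fix a b assume ab: "a \<in> A" "b \<in> B"
    show "?Z a b \<inter> (A \<union> B) = {}" using F[OF ab] by blast
    fix c assume c: "c \<in> L (F (a, b))"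
    show "cell ?Z a b c \<in> H" unfolding cell[OF ab] using W(3)[OF ab] c by (auto simp: nbrs_def)
    have cW: "c \<notin> W" using W(2)[OF ab] c by auto
    have "a' \<in> W" if "a' \<in> A" for a' using W(1)[OF that ab(2)] F[OF that ab(2)] by auto
    moreover have "b' \<in> W" if "b' \<in> B" for b' using W(1)[OF ab(1) that] F[OF ab(1) that] by auto
    ultimately show "c \<notin> A \<union> B" using cW by auto
    fix a' b' assume "a' \<in> A" "b' \<in> B"
    then show "c \<notin> ?Z a' b'" using W(1)[of a' b'] cW by auto
  next
    fix a b a' b' assume A: "a \<in> A" "b \<in> B" "a' \<in> A" "b' \<in> B" "(a, b) \<noteq> (a', b')"
    then have "(F (a, b) - {fst (a, b), snd (a, b)}) \<inter> (F (a', b') - {fst (a', b'), snd (a', b')}) = {}"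
      using dis unfolding disjoint_family_on_def by (metis mem_Sigma_iff)
    then show "?Z a b \<inter> ?Z a' b' = {}" by simp
  qed (use fin AB in auto)
  show "grid_full H t A B ?Z (\<lambda>a b. L (F (a, b)))" unfolding grid_full_def
  proof (intro ballI)
    fix a b c assume ab: "a \<in> A" "b \<in> B" and c: "c \<in> L (F (a, b))"
    then show "t + 1 \<le> card (nbrs H (cell ?Z a b c - {a})) \<and> t + 1 \<le> card (nbrs H (cell ?Z a b c - {b}))"
      unfolding cell[OF ab] using F[OF ab] E[of "F (a, b)"] by blast
  qed
qed

text \<open>A cell through a rich pair can be chosen clear of any \<open>m\<close> vertices used so
  far, the pair itself aside.\<close>

definition rich :: "'a set set \<Rightarrow> nat \<Rightarrow> 'a \<Rightarrow> 'a \<Rightarrow> bool" where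
  "rich E m u v \<longleftrightarrow> (\<forall>X. finite X \<longrightarrow> card X \<le> m \<longrightarrow> (\<exists>f\<in>E. u \<in> f \<and> v \<in> f \<and> f \<inter> X \<subseteq> {u, v}))"

lemma choose_cells:
  assumes "finite P" and rich: "\<And>u v. (u, v) \<in> P \<Longrightarrow> rich E m u v" and E: "\<And>f. f \<in> E \<Longrightarrow> finite f \<and> card f = q"
    and W: "finite W" "card W + card P * q \<le> m"
  shows "\<exists>F. (\<forall>p\<in>P. F p \<in> E \<and> fst p \<in> F p \<and> snd p \<in> F p \<and> (F p - {fst p, snd p}) \<inter> W = {}) \<and>
    disjoint_family_on (\<lambda>p. F p - {fst p, snd p}) P"
  using assms(1,2,5)
proof (induction P rule: finite_induct)
  case empty
  then show ?case by (simp add: disjoint_family_on_def)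
next
  case (insert p P)
  have "card W + card P * q \<le> m" using insert by simp
  then obtain F where F: "\<forall>p\<in>P. F p \<in> E \<and> fst p \<in> F p \<and> snd p \<in> F p \<and> (F p - {fst p, snd p}) \<inter> W = {}"
    "disjoint_family_on (\<lambda>p. F p - {fst p, snd p}) P"
    using insert.IH insert.prems by blast
  let ?X = "W \<union> (\<Union>p\<in>P. F p)"
  have "card (\<Union>p\<in>P. F p) \<le> card P * q" using insert.hyps F(1) E by (intro card_UN_le_mult) auto
  then have "card ?X \<le> m" using card_Un_le[of W "\<Union>p\<in>P. F p"] \<open>card W + card P * q \<le> m\<close> by linarith
  moreover have "finite ?X" using W insert.hyps F(1) E by auto
  moreover have "rich E m (fst p) (snd p)" using insert.prems(1)[of "fst p" "snd p"] by simp
  ultimately obtain f where f: "f \<in> E" "fst p \<in> f" "snd p \<in> f" "f \<inter> ?X \<subseteq> {fst p, snd p}"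
    unfolding rich_def by blast
  define G where "G = F(p := f)"
  have Gp: "G p = f" and GP: "\<And>p'. p' \<in> P \<Longrightarrow> G p' = F p'" using insert.hyps(2) by (auto simp: G_def)
  have "\<forall>p'\<in>insert p P. G p' \<in> E \<and> fst p' \<in> G p' \<and> snd p' \<in> G p' \<and> (G p' - {fst p', snd p'}) \<inter> W = {}"
    using F(1) f Gp GP by auto
  moreover have "disjoint_family_on (\<lambda>p. G p - {fst p, snd p}) (insert p P)"
    unfolding disjoint_family_on_insert[OF insert.hyps(2)]
  proof
    show "(G p - {fst p, snd p}) \<inter> (\<Union>i\<in>P. G i - {fst i, snd i}) = {}"
      unfolding Gp using GP f(4) by auto
    show "disjoint_family_on (\<lambda>p. G p - {fst p, snd p}) P"
      using F(2) GP unfolding disjoint_family_on_def by simp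
  qed
  ultimately show ?case by blast
qed

text \<open>A pair that is not rich has a blocking set of at most \<open>m\<close> vertices, and
  each member of \<open>E\<close> through the pair contains one of them as a third vertex. The loss
  is of order \<open>card V ^ (q - 1)\<close>, one below a positive density.\<close>

lemma card_not_rich_le:
  assumes V: "finite V" and E: "\<And>f. f \<in> E \<Longrightarrow> f \<subseteq> V \<and> card f = q" and q: "q \<ge> 3"
  shows "card {f\<in>E. \<exists>u\<in>f. \<exists>v\<in>f. u \<noteq> v \<and> \<not> rich E m u v} \<le> card V * card V * (m * card V ^ (q - 3))"
proof -
  have "\<exists>X. finite X \<and> card X \<le> m \<and> (\<not> rich E m u v \<longrightarrow> (\<forall>f\<in>E. u \<in> f \<longrightarrow> v \<in> f \<longrightarrow> \<not> f \<inter> X \<subseteq> {u, v}))" for u v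
  proof (cases "rich E m u v")
    case True
    then show ?thesis by (intro exI[of _ "{}"]) auto
  next
    case False
    then show ?thesis unfolding rich_def by blast
  qed
  then obtain X where X: "\<And>u v. finite (X u v) \<and> card (X u v) \<le> m"
    "\<And>u v f. \<not> rich E m u v \<Longrightarrow> f \<in> E \<Longrightarrow> u \<in> f \<Longrightarrow> v \<in> f \<Longrightarrow> \<not> f \<inter> X u v \<subseteq> {u, v}" by metis
  define G where "G u v x = (if u \<noteq> v \<and> x \<noteq> u \<and> x \<noteq> v then {f. {u, v, x} \<subseteq> f \<and> f \<subseteq> V \<and> card f = q} else {})" for u v x
  have Gc: "card (G u v x) \<le> card V ^ (q - 3)" for u v x
  proof (cases "u \<noteq> v \<and> x \<noteq> u \<and> x \<noteq> v")
    case True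
    then have "card {u, v, x} = 3" by auto
    then show ?thesis using card_supersets_le[OF V, of "{u, v, x}" q] q True by (simp add: G_def)
  next
    case False
    then show ?thesis unfolding G_def by (simp only: if_False card.empty le0)
  qed
  let ?S = "{f\<in>E. \<exists>u\<in>f. \<exists>v\<in>f. u \<noteq> v \<and> \<not> rich E m u v}"
  have "?S \<subseteq> (\<Union>u\<in>V. \<Union>v\<in>V. \<Union>x\<in>X u v. G u v x)"
  proof
    fix f assume "f \<in> ?S"
    then obtain u v where uv: "f \<in> E" "u \<in> f" "v \<in> f" "u \<noteq> v" "\<not> rich E m u v" by blast
    then obtain x where "x \<in> f" "x \<in> X u v" "x \<noteq> u" "x \<noteq> v" using X(2)[OF uv(5,1,2,3)] by blast
    then have "f \<in> G u v x" using uv E[OF uv(1)] by (simp add: G_def)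
    moreover have "u \<in> V" "v \<in> V" using uv E[OF uv(1)] by auto
    ultimately show "f \<in> (\<Union>u\<in>V. \<Union>v\<in>V. \<Union>x\<in>X u v. G u v x)" using \<open>x \<in> X u v\<close> by blast
  qed
  moreover have "finite (G u v x)" for u v x
    by (rule finite_subset[of _ "Pow V"]) (use V in \<open>auto simp: G_def\<close>)
  then have "finite (\<Union>u\<in>V. \<Union>v\<in>V. \<Union>x\<in>X u v. G u v x)" using V X(1) by blast
  ultimately have "card ?S \<le> card (\<Union>u\<in>V. \<Union>v\<in>V. \<Union>x\<in>X u v. G u v x)" by (rule card_mono[rotated])
  also have "\<dots> \<le> card V * (card V * (m * card V ^ (q - 3)))"
  proof (intro card_UN_le_mult V)
    fix u v
    have "card (\<Union>x\<in>X u v. G u v x) \<le> card (X u v) * card V ^ (q - 3)" using X(1) Gc by (intro card_UN_le_mult) auto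
    also have "\<dots> \<le> m * card V ^ (q - 3)" using X(1) by (intro mult_right_mono) auto
    finally show "card (\<Union>x\<in>X u v. G u v x) \<le> m * card V ^ (q - 3)" .
  qed
  finally show ?thesis by (simp add: mult.assoc)
qed

text \<open>A triple lies in at most \<open>card V ^ (q - 3)\<close> sets, so a positive density of
  sets gives a positive density of ordered triples.\<close>

lemma card_le_triples:
  assumes V: "finite V" and E: "\<And>f. f \<in> E \<Longrightarrow> f \<subseteq> V \<and> card f = q" and q: "q \<ge> 3"
  shows "card E \<le> card {(x, y, z). x \<noteq> y \<and> y \<noteq> z \<and> x \<noteq> z \<and> (\<exists>f\<in>E. {x, y, z} \<subseteq> f)} * card V ^ (q - 3)"
proof -
  let ?T = "{(x, y, z). x \<noteq> y \<and> y \<noteq> z \<and> x \<noteq> z \<and> (\<exists>f\<in>E. {x, y, z} \<subseteq> f)}"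
  define G where "G p = {f. {fst p, fst (snd p), snd (snd p)} \<subseteq> f \<and> f \<subseteq> V \<and> card f = q}" for p
  have "?T \<subseteq> V \<times> V \<times> V" using E by auto
  then have finT: "finite ?T" by (rule finite_subset) (use V in simp)
  have "E \<subseteq> (\<Union>p\<in>?T. G p)"
  proof
    fix f assume f: "f \<in> E"
    have "3 \<le> card f" using E[OF f] q by simp
    then obtain S where S: "S \<subseteq> f" "card S = 3" by (metis obtain_subset_with_card_n)
    then obtain x y z where xyz: "S = {x, y, z}" "x \<noteq> y" "y \<noteq> z" "x \<noteq> z" by (metis card_3_iff)
    then have "(x, y, z) \<in> ?T" using f S(1) by auto
    moreover have "f \<in> G (x, y, z)" using S(1) xyz(1) E[OF f] by (simp add: G_def)
    ultimately show "f \<in> (\<Union>p\<in>?T. G p)" by blast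
  qed
  moreover have "finite (G p)" for p by (rule finite_subset[of _ "Pow V"]) (use V in \<open>auto simp: G_def\<close>)
  then have "finite (\<Union>p\<in>?T. G p)" using finT by blast
  ultimately have "card E \<le> card (\<Union>p\<in>?T. G p)" by (rule card_mono[rotated])
  also have "\<dots> \<le> card ?T * card V ^ (q - 3)"
  proof (rule card_UN_le_mult[OF finT])
    fix p assume "p \<in> ?T"
    then have "card {fst p, fst (snd p), snd (snd p)} = 3" by auto
    then show "card (G p) \<le> card V ^ (q - 3)" unfolding G_def
      using card_supersets_le[OF V, of "{fst p, fst (snd p), snd (snd p)}" q] q by simp
  qed
  finally show ?thesis .
qed

text \<open>\<open>t\<close> enters through \<open>t + 1\<close>, which avoids truncated
  subtraction. \<open>lm\<close> bounds all lengths, so thresholds can be stated in terms of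
  \<open>r\<close>, \<open>t\<close>, \<open>lm\<close> and the number of components.\<close>

locale path_cycle_components =
  fixes r t lm :: nat and I :: "'i set" and l :: "'i \<Rightarrow> nat"
    and Q :: "'i \<Rightarrow> (nat + nat set \<times> nat) hypergraph"
  assumes r: "r \<ge> 3" and I: "finite I" "I \<noteq> {}"
    and l: "\<And>i. i \<in> I \<Longrightarrow> 5 \<le> l i \<and> l i \<le> lm"
    and Q: "\<And>i. i \<in> I \<Longrightarrow> Q i \<in> {expansion r (path_graph (l i)), expansion r (cycle_graph (l i))}"
    and sum_t: "(\<Sum>i\<in>I. (l i + 1) div 2) = t + 1"
begin

definition occurs :: "'a set set \<Rightarrow> bool" where
  "occurs H \<longleftrightarrow> (\<exists>S. (\<forall>i\<in>I. embeds (Q i) H (S i)) \<and> disjoint_family_on S I)"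

text \<open>Since \<open>l i \<ge> 5\<close>, each component contributes at least 3 to
  \<open>t + 1\<close>. The consequences \<open>card I + 1 \<le> t\<close> and
  \<open>2 * card I \<le> t\<close> are what the exchanges require.\<close>

lemma card_I: "1 \<le> card I" "3 * card I \<le> t + 1"
proof -
  show "1 \<le> card I" using I by (simp add: Suc_leI card_gt_0_iff)
  have "(\<Sum>i\<in>I. 3) \<le> (\<Sum>i\<in>I. (l i + 1) div 2)"
  proof (rule sum_mono)
    fix i assume "i \<in> I"
    then have "5 \<le> l i" using l by blast
    then show "3 \<le> (l i + 1) div 2" by linarith
  qed
  then show "3 * card I \<le> t + 1" using sum_t by simp
qed

definition big :: nat where
  "big = grid_size t (card I) lm r + (3 * (card I * (lm * r + lm)) + 2 * lm + 1) +
     (6 * (card I * (lm * r)) + 8 * r + lm + 3)"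

lemma big: "grid_size t (card I) lm r \<le> big" "3 * (card I * (lm * r + lm)) + 2 * lm + 1 \<le> big"
  "6 * (card I * (lm * r)) + 8 * r + lm + 2 < big" "1 \<le> big"
  unfolding big_def by simp_all

lemma grid_dichotomy:
  assumes "grid H A B Z L" "canonical A B L T \<Phi> \<Psi> U" "\<forall>a\<in>A. card (\<Phi> a) = x" "\<forall>b\<in>B. card (\<Psi> b) = y"
    "\<And>a b. a \<in> A \<Longrightarrow> b \<in> B \<Longrightarrow> finite (L a b) \<and> card (L a b) = t + 1"
    "grid_full H t A B Z L" "uniform r H" "big \<le> card A" "big \<le> card B"
  shows "occurs H \<or> (\<exists>v. unique_labels A B L v)"
  unfolding occurs_def
proof (rule grid_embedding[where x = x and y = y and l = l and Q = Q and lm = lm, OF assms(1,2)])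
  show "card I + 1 \<le> t" using card_I by linarith
  show "card (\<Phi> a) = x" if "a \<in> A" for a using assms(3) that by (rule bspec)
  show "card (\<Psi> b) = y" if "b \<in> B" for b using assms(4) that by (rule bspec)
  show "grid_size t (card I) lm r \<le> card A" by (rule order_trans[OF big(1) assms(8)])
  show "grid_size t (card I) lm r \<le> card B" by (rule order_trans[OF big(1) assms(9)])
  show "3 * (card I * (lm * r + lm)) + 2 * lm + 1 \<le> card A" by (rule order_trans[OF big(2) assms(8)])
  show "3 * (card I * (lm * r + lm)) + 2 * lm + 1 \<le> card B" by (rule order_trans[OF big(2) assms(9)])
qed (fact assms r I l Q sum_t)+

text \<open>Empty fillers are the situation r = 3, where private labels are dealt with inside a
  single grid.\<close>

lemma grid_occurs3:
  "\<exists>N\<ge>1. \<forall>(H::'a set set) A B Z L. grid H A B Z L \<longrightarrow> grid_full H t A B Z L \<longrightarrow> uniform r H \<longrightarrow>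
     N \<le> card A \<longrightarrow> N \<le> card B \<longrightarrow> (\<forall>a\<in>A. \<forall>b\<in>B. Z a b = {} \<and> finite (L a b) \<and> card (L a b) = t + 1) \<longrightarrow> occurs H"
proof -
  obtain N where N: "\<forall>(A::'a set) B L. finite A \<longrightarrow> finite B \<longrightarrow> N \<le> card A \<longrightarrow> N \<le> card B \<longrightarrow>
    (\<forall>a\<in>A. \<forall>b\<in>B. finite (L a b) \<and> card (L a b) \<le> t + 1) \<longrightarrow>
    (\<exists>A' B' T \<Phi> \<Psi> U x y. A' \<subseteq> A \<and> B' \<subseteq> B \<and> card A' = big \<and> card B' = big \<and>
       canonical A' B' L T \<Phi> \<Psi> U \<and> (\<forall>a\<in>A'. card (\<Phi> a) = x) \<and> (\<forall>b\<in>B'. card (\<Psi> b) = y))"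
    using canonical_exists[OF big(4), of "t + 1", where 'a = 'a] by (elim exE)
  have "occurs H" if G: "grid H A B Z L" and full: "grid_full H t A B Z L" and u: "uniform r H"
    and c: "N + 1 \<le> card A" "N + 1 \<le> card B" and Z: "\<forall>a\<in>A. \<forall>b\<in>B. Z a b = {} \<and> finite (L a b) \<and> card (L a b) = t + 1"
    for H :: "'a set set" and A B Z L
  proof -
    have "\<exists>A' B' T \<Phi> \<Psi> U x y. A' \<subseteq> A \<and> B' \<subseteq> B \<and> card A' = big \<and> card B' = big \<and>
       canonical A' B' L T \<Phi> \<Psi> U \<and> (\<forall>a\<in>A'. card (\<Phi> a) = x) \<and> (\<forall>b\<in>B'. card (\<Psi> b) = y)"
    proof (rule N[rule_format])
      show "N \<le> card A" "N \<le> card B" using c by simp_all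
    qed (use gridD(1,2)[OF G] Z in auto)
    then obtain A' B' T \<Phi> \<Psi> U x y where s: "A' \<subseteq> A" "B' \<subseteq> B" "card A' = big" "card B' = big"
       and can: "canonical A' B' L T \<Phi> \<Psi> U" "\<forall>a\<in>A'. card (\<Phi> a) = x" "\<forall>b\<in>B'. card (\<Psi> b) = y" by blast
    have G': "grid H A' B' Z L" by (rule grid_mono[OF G s(1,2)]) auto
    have full': "grid_full H t A' B' Z L" using full s(1,2) unfolding grid_full_def by blast
    have L': "finite (L a b) \<and> card (L a b) = t + 1" "Z a b = {}" if "a \<in> A'" "b \<in> B'" for a b
      using Z that s(1,2) by blast+
    have "occurs H \<or> (\<exists>v. unique_labels A' B' L v)"
    proof (rule grid_dichotomy[OF G' can])
      show "finite (L a b) \<and> card (L a b) = t + 1" if "a \<in> A'" "b \<in> B'" for a b using L'(1)[OF that] .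
    qed (use full' u s in simp_all)
    then show ?thesis
    proof
      assume "\<exists>v. unique_labels A' B' L v"
      then obtain v where v: "unique_labels A' B' L v" by blast
      show ?thesis unfolding occurs_def
      proof (rule light_embedding_unique3[where l = l and Q = Q and lm = lm, OF G' v])
        show "2 * card I \<le> t" using card_I by linarith
        show "grid_size t (card I) lm r \<le> card A'" "grid_size t (card I) lm r \<le> card B'" using s(3,4) big(1) by simp_all
      qed (fact L'(2) full' u r I l Q)+
    qed
  qed
  then show ?thesis by (intro exI[of _ "N + 1"] conjI allI impI le_add2)
qed

end

text \<open>Hiding the witnesses gives a property that passes to subgrids, as is needed when several
  grids on common classes are made canonical in turn.\<close>

definition canonizable :: "'a set \<Rightarrow> 'a set \<Rightarrow> ('a \<Rightarrow> 'a \<Rightarrow> 'a set) \<Rightarrow> bool" where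
  "canonizable A B L \<longleftrightarrow> (\<exists>T \<Phi> \<Psi> U x y. canonical A B L T \<Phi> \<Psi> U \<and>
     (\<forall>a\<in>A. card (\<Phi> a) = x) \<and> (\<forall>b\<in>B. card (\<Psi> b) = y))"

lemma canonizable_mono:
  assumes "canonizable A B L" "A' \<subseteq> A" "B' \<subseteq> B"
  shows "canonizable A' B' L"
proof -
  obtain T \<Phi> \<Psi> U x y where *: "canonical A B L T \<Phi> \<Psi> U" "\<forall>a\<in>A. card (\<Phi> a) = x" "\<forall>b\<in>B. card (\<Psi> b) = y"
    using assms(1) unfolding canonizable_def by (elim exE conjE)
  have "canonical A' B' L T \<Phi> \<Psi> U" "\<forall>a\<in>A'. card (\<Phi> a) = x" "\<forall>b\<in>B'. card (\<Psi> b) = y"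
    using canonical_mono[OF *(1) assms(2,3)] *(2,3) assms(2,3) by auto
  then show ?thesis unfolding canonizable_def by (intro exI conjI)
qed

lemma canonizable_subgrid:
  assumes "1 \<le> m"
  shows "\<exists>N. \<forall>(A::'a set) B L. finite A \<longrightarrow> finite B \<longrightarrow> N \<le> card A \<longrightarrow> N \<le> card B \<longrightarrow>
    (\<forall>a\<in>A. \<forall>b\<in>B. finite (L a b) \<and> card (L a b) \<le> d) \<longrightarrow>
    (\<exists>A' B'. A' \<subseteq> A \<and> B' \<subseteq> B \<and> card A' = m \<and> card B' = m \<and> canonizable A' B' L)"
proof -
  obtain N where N: "\<forall>(A::'a set) B L. finite A \<longrightarrow> finite B \<longrightarrow> N \<le> card A \<longrightarrow> N \<le> card B \<longrightarrow>
    (\<forall>a\<in>A. \<forall>b\<in>B. finite (L a b) \<and> card (L a b) \<le> d) \<longrightarrow>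
    (\<exists>A' B' T \<Phi> \<Psi> U x y. A' \<subseteq> A \<and> B' \<subseteq> B \<and> card A' = m \<and> card B' = m \<and>
       canonical A' B' L T \<Phi> \<Psi> U \<and> (\<forall>a\<in>A'. card (\<Phi> a) = x) \<and> (\<forall>b\<in>B'. card (\<Psi> b) = y))"
    using canonical_exists[OF assms, of d, where 'a = 'a] by (elim exE)
  show ?thesis
  proof (intro exI[of _ N] allI impI)
    fix A B :: "'a set" and L :: "'a \<Rightarrow> 'a \<Rightarrow> 'a set"
    assume "finite A" "finite B" "N \<le> card A" "N \<le> card B" "\<forall>a\<in>A. \<forall>b\<in>B. finite (L a b) \<and> card (L a b) \<le> d"
    then have "\<exists>A' B' T \<Phi> \<Psi> U x y. A' \<subseteq> A \<and> B' \<subseteq> B \<and> card A' = m \<and> card B' = m \<and>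
       canonical A' B' L T \<Phi> \<Psi> U \<and> (\<forall>a\<in>A'. card (\<Phi> a) = x) \<and> (\<forall>b\<in>B'. card (\<Psi> b) = y)"
      using N by blast
    then obtain A' B' T \<Phi> \<Psi> U x y where
      *: "A' \<subseteq> A" "B' \<subseteq> B" "card A' = m" "card B' = m" "canonical A' B' L T \<Phi> \<Psi> U"
      "\<forall>a\<in>A'. card (\<Phi> a) = x" "\<forall>b\<in>B'. card (\<Psi> b) = y" by (elim exE conjE)
    have "canonizable A' B' L" unfolding canonizable_def using *(5-7) by (intro exI conjI)
    then show "\<exists>A' B'. A' \<subseteq> A \<and> B' \<subseteq> B \<and> card A' = m \<and> card B' = m \<and> canonizable A' B' L"
      using *(1-4) by (intro exI conjI)
  qed
qed

lemma grid_full_mono: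
  "grid_full H t A B Z L \<Longrightarrow> A' \<subseteq> A \<Longrightarrow> B' \<subseteq> B \<Longrightarrow> grid_full H t A' B' Z L"
  unfolding grid_full_def by (meson subsetD)

context path_cycle_components
begin

lemma grid_canonizable_dichotomy:
  assumes "grid H A B Z L" "grid_full H t A B Z L" "uniform r H"
    "\<forall>a\<in>A. \<forall>b\<in>B. finite (L a b) \<and> card (L a b) = t + 1"
    "canonizable A' B' L" "A' \<subseteq> A" "B' \<subseteq> B" "big \<le> card A'" "big \<le> card B'"
  shows "occurs H \<or> (\<exists>v. unique_labels A' B' L v)"
proof -
  obtain T \<Phi> \<Psi> U x y where *: "canonical A' B' L T \<Phi> \<Psi> U" "\<forall>a\<in>A'. card (\<Phi> a) = x" "\<forall>b\<in>B'. card (\<Psi> b) = y"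
    using assms(5) unfolding canonizable_def by (elim exE conjE)
  have G: "grid H A' B' Z L" by (rule grid_mono[OF assms(1,6,7)]) simp
  show ?thesis
  proof (rule grid_dichotomy[OF G *])
    show "finite (L a b) \<and> card (L a b) = t + 1" if "a \<in> A'" "b \<in> B'" for a b
      using assms(4,6,7) that by (meson subsetD)
    show "grid_full H t A' B' Z L" by (rule grid_full_mono[OF assms(2,6,7)])
  qed (fact assms)+
qed

text \<open>The grids are made canonical one after the other. Each step shrinks two of the three
  classes, so the sizes \<open>m2\<close>, \<open>m1\<close>, \<open>N\<close> are fixed backwards,
  and \<open>canonizable_mono\<close> carries the earlier results to the final classes.\<close>

lemma grid_occurs4:
  "\<exists>N\<ge>1. \<forall>(H::'a set set) A B C Zab Zac Zbc Lab Lac Lbc.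
     grid H A B Zab Lab \<longrightarrow> grid H A C Zac Lac \<longrightarrow> grid H B C Zbc Lbc \<longrightarrow>
     grid_full H t A B Zab Lab \<longrightarrow> grid_full H t A C Zac Lac \<longrightarrow> grid_full H t B C Zbc Lbc \<longrightarrow> uniform r H \<longrightarrow>
     N \<le> card A \<longrightarrow> N \<le> card B \<longrightarrow> N \<le> card C \<longrightarrow>
     (\<forall>a\<in>A. \<forall>b\<in>B. finite (Lab a b) \<and> card (Lab a b) = t + 1) \<longrightarrow>
     (\<forall>a\<in>A. \<forall>b\<in>C. finite (Lac a b) \<and> card (Lac a b) = t + 1) \<longrightarrow>
     (\<forall>a\<in>B. \<forall>b\<in>C. finite (Lbc a b) \<and> card (Lbc a b) = t + 1) \<longrightarrow>
     (\<forall>a\<in>A. \<forall>b\<in>B. \<forall>z\<in>C. Zac a z \<inter> insert b (Zbc b z) = {} \<and> a \<notin> Zbc b z \<and>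
        Lac a z \<inter> insert b (Zbc b z) = {} \<and> Lbc b z \<inter> insert a (Zac a z) = {}) \<longrightarrow> occurs H"
proof -
  let ?P = "\<lambda>m N. \<forall>(A::'a set) B L. finite A \<longrightarrow> finite B \<longrightarrow> N \<le> card A \<longrightarrow> N \<le> card B \<longrightarrow>
    (\<forall>a\<in>A. \<forall>b\<in>B. finite (L a b) \<and> card (L a b) \<le> t + 1) \<longrightarrow>
    (\<exists>A' B'. A' \<subseteq> A \<and> B' \<subseteq> B \<and> card A' = m \<and> card B' = m \<and> canonizable A' B' L)"
  obtain N3 where N3: "?P big N3" using canonizable_subgrid[OF big(4), of "t + 1", where 'a = 'a] by (elim exE)
  define m2 where "m2 = big + N3"
  have "1 \<le> m2" using big(4) by (simp add: m2_def)
  from canonizable_subgrid[OF this, of "t + 1", where 'a = 'a] obtain N2 where N2: "?P m2 N2" by (elim exE)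
  define m1 where "m1 = N2 + N3 + 1"
  have "1 \<le> m1" by (simp add: m1_def)
  from canonizable_subgrid[OF this, of "t + 1", where 'a = 'a] obtain N1 where N1: "?P m1 N1" by (elim exE)
  define N where "N = N1 + N2 + 1"
  have "occurs H" if G: "grid H A B Zab Lab" "grid H A C Zac Lac" "grid H B C Zbc Lbc"
    and full: "grid_full H t A B Zab Lab" "grid_full H t A C Zac Lac" "grid_full H t B C Zbc Lbc" and u: "uniform r H"
    and c: "N \<le> card A" "N \<le> card B" "N \<le> card C"
    and L: "\<forall>a\<in>A. \<forall>b\<in>B. finite (Lab a b) \<and> card (Lab a b) = t + 1"
     "\<forall>a\<in>A. \<forall>b\<in>C. finite (Lac a b) \<and> card (Lac a b) = t + 1"
     "\<forall>a\<in>B. \<forall>b\<in>C. finite (Lbc a b) \<and> card (Lbc a b) = t + 1"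
    and sep: "\<forall>a\<in>A. \<forall>b\<in>B. \<forall>z\<in>C. Zac a z \<inter> insert b (Zbc b z) = {} \<and> a \<notin> Zbc b z \<and>
        Lac a z \<inter> insert b (Zbc b z) = {} \<and> Lbc b z \<inter> insert a (Zac a z) = {}"
    for H :: "'a set set" and A B C Zab Zac Zbc Lab Lac Lbc
  proof -
    note fin = gridD(1,2)[OF G(1)] gridD(2)[OF G(2)]
    have "\<exists>A' B'. A' \<subseteq> A \<and> B' \<subseteq> B \<and> card A' = m1 \<and> card B' = m1 \<and> canonizable A' B' Lab"
      by (rule N1[rule_format, OF fin(1,2)]) (use c L(1) in \<open>auto simp: N_def\<close>)
    then obtain A1 B1 where 1: "A1 \<subseteq> A" "B1 \<subseteq> B" "card A1 = m1" "card B1 = m1" "canonizable A1 B1 Lab"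
      by (elim exE conjE)
    have fin1: "finite A1" "finite B1" using 1(1,2) fin finite_subset by auto
    have "\<exists>A' B'. A' \<subseteq> A1 \<and> B' \<subseteq> C \<and> card A' = m2 \<and> card B' = m2 \<and> canonizable A' B' Lac"
    proof (rule N2[rule_format, OF fin1(1) fin(3)])
      show "N2 \<le> card A1" using 1(3) by (simp add: m1_def)
      show "N2 \<le> card C" using c(3) by (simp add: N_def)
      show "finite (Lac a b) \<and> card (Lac a b) \<le> t + 1" if "a \<in> A1" "b \<in> C" for a b
      proof -
        have "a \<in> A" using that 1(1) by auto
        then show ?thesis using L(2) that(2) by auto
      qed
    qed
    then obtain A2 C2 where 2: "A2 \<subseteq> A1" "C2 \<subseteq> C" "card A2 = m2" "card C2 = m2" "canonizable A2 C2 Lac"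
      by (elim exE conjE)
    have fin2: "finite C2" using 2(2) fin finite_subset by auto
    have "\<exists>A' B'. A' \<subseteq> B1 \<and> B' \<subseteq> C2 \<and> card A' = big \<and> card B' = big \<and> canonizable A' B' Lbc"
    proof (rule N3[rule_format, OF fin1(2) fin2])
      show "N3 \<le> card B1" using 1(4) by (simp add: m1_def)
      show "N3 \<le> card C2" using 2(4) by (simp add: m2_def)
      show "finite (Lbc a b) \<and> card (Lbc a b) \<le> t + 1" if "a \<in> B1" "b \<in> C2" for a b
      proof -
        have "a \<in> B" "b \<in> C" using that 1(2) 2(2) by auto
        then show ?thesis using L(3) by auto
      qed
    qed
    then obtain B3 C3 where 3: "B3 \<subseteq> B1" "C3 \<subseteq> C2" "card B3 = big" "card C3 = big" "canonizable B3 C3 Lbc"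
      by (elim exE conjE)
    have sub: "A2 \<subseteq> A" "B3 \<subseteq> B" "C3 \<subseteq> C" using 1 2 3 by auto
    have sz: "big \<le> card A2" "big \<le> card B3" "big \<le> card C3" using 2 3 by (auto simp: m2_def)
    have "occurs H \<or> (\<exists>v. unique_labels A2 B3 Lab v)"
      by (rule grid_canonizable_dichotomy[OF G(1) full(1) u L(1) canonizable_mono[OF 1(5) 2(1) 3(1)] sub(1,2) sz(1,2)])
    moreover have "occurs H \<or> (\<exists>v. unique_labels A2 C3 Lac v)"
      by (rule grid_canonizable_dichotomy[OF G(2) full(2) u L(2) canonizable_mono[OF 2(5) subset_refl 3(2)] sub(1,3) sz(1,3)])
    moreover have "occurs H \<or> (\<exists>v. unique_labels B3 C3 Lbc v)"
      by (rule grid_canonizable_dichotomy[OF G(3) full(3) u L(3) 3(5) sub(2,3) sz(2,3)])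
    moreover have "occurs H" if v: "unique_labels A2 B3 Lab v" "unique_labels A2 C3 Lac v'" "unique_labels B3 C3 Lbc v''" for v v' v''
      unfolding occurs_def
    proof (rule light_embedding_unique4[where l = l and Q = Q and lm = lm and r = r, OF _ _ _ v])
      show "grid H A2 B3 Zab Lab" by (rule grid_mono[OF G(1) sub(1,2)]) simp
      show "grid H A2 C3 Zac Lac" by (rule grid_mono[OF G(2) sub(1,3)]) simp
      show "grid H B3 C3 Zbc Lbc" by (rule grid_mono[OF G(3) sub(2,3)]) simp
      show "6 * (card I * (lm * r)) + 8 * r + lm + 2 < card A2" by (rule less_le_trans[OF big(3) sz(1)])
      show "6 * (card I * (lm * r)) + 8 * r + lm + 2 < card B3" by (rule less_le_trans[OF big(3) sz(2)])
      show "6 * (card I * (lm * r)) + 8 * r + lm + 2 < card C3" by (rule less_le_trans[OF big(3) sz(3)])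
      fix a b z assume abz: "a \<in> A2" "b \<in> B3" "z \<in> C3"
      have "v' a z \<in> Lac a z" "v'' b z \<in> Lbc b z"
        using unique_labelsD(1)[OF v(2) abz(1,3)] unique_labelsD(1)[OF v(3) abz(2,3)] .
      then show "Zac a z \<inter> insert b (Zbc b z) = {} \<and> a \<notin> Zbc b z \<and>
        v' a z \<notin> insert b (Zbc b z) \<and> v'' b z \<notin> insert a (Zac a z)"
        using sep[rule_format, of a b z] abz sub by auto
    qed (fact u r I l Q)+
    ultimately show ?thesis by blast
  qed
  then show ?thesis by (intro exI[of _ N] conjI allI impI) (simp add: N_def)
qed

text \<open>The structural heart of the upper bound: a positive density of \<open>(r - 1)\<close>-sets, each of which
  extends to a hyperedge in \<open>t + 1\<close> ways, forces the components. The last condition is needed only for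
  odd cycles.\<close>

lemma dense_occurs:
  fixes \<delta> :: real
  assumes \<delta>: "0 < \<delta>"
  shows "\<exists>n0. \<forall>(V::'a set) H E L. finite V \<longrightarrow> n0 \<le> card V \<longrightarrow> uniform r H \<longrightarrow> \<Union>H \<subseteq> V \<longrightarrow>
    (\<forall>f\<in>E. f \<subseteq> V \<and> card f = r - 1) \<longrightarrow> \<delta> * real (card V) ^ (r - 1) \<le> card E \<longrightarrow>
    (\<forall>f\<in>E. L f \<subseteq> nbrs H f \<and> card (L f) = t + 1 \<and> (\<forall>c\<in>L f. \<forall>x\<in>f. t + 1 \<le> card (nbrs H (insert c f - {x})))) \<longrightarrow>
    occurs H"
proof -
  obtain N3 where N3: "N3 \<ge> 1" "\<forall>(H::'a set set) A B Z L. grid H A B Z L \<longrightarrow> grid_full H t A B Z L \<longrightarrow> uniform r H \<longrightarrow>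
     N3 \<le> card A \<longrightarrow> N3 \<le> card B \<longrightarrow> (\<forall>a\<in>A. \<forall>b\<in>B. Z a b = {} \<and> finite (L a b) \<and> card (L a b) = t + 1) \<longrightarrow> occurs H"
    using grid_occurs3[where 'a = 'a] by (elim exE conjE)
  obtain N4 where N4: "N4 \<ge> 1" "\<forall>(H::'a set set) A B C Zab Zac Zbc Lab Lac Lbc.
     grid H A B Zab Lab \<longrightarrow> grid H A C Zac Lac \<longrightarrow> grid H B C Zbc Lbc \<longrightarrow>
     grid_full H t A B Zab Lab \<longrightarrow> grid_full H t A C Zac Lac \<longrightarrow> grid_full H t B C Zbc Lbc \<longrightarrow> uniform r H \<longrightarrow>
     N4 \<le> card A \<longrightarrow> N4 \<le> card B \<longrightarrow> N4 \<le> card C \<longrightarrow>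
     (\<forall>a\<in>A. \<forall>b\<in>B. finite (Lab a b) \<and> card (Lab a b) = t + 1) \<longrightarrow>
     (\<forall>a\<in>A. \<forall>b\<in>C. finite (Lac a b) \<and> card (Lac a b) = t + 1) \<longrightarrow>
     (\<forall>a\<in>B. \<forall>b\<in>C. finite (Lbc a b) \<and> card (Lbc a b) = t + 1) \<longrightarrow>
     (\<forall>a\<in>A. \<forall>b\<in>B. \<forall>z\<in>C. Zac a z \<inter> insert b (Zbc b z) = {} \<and> a \<notin> Zbc b z \<and>
        Lac a z \<inter> insert b (Zbc b z) = {} \<and> Lbc b z \<inter> insert a (Zac a z) = {}) \<longrightarrow> occurs H"
    using grid_occurs4[where 'a = 'a] by (elim exE conjE)
  define N where "N = N3 + N4"
  have N1: "1 \<le> N" "N3 \<le> N" "N4 \<le> N" using N3(1) by (auto simp: N_def)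
  define q where "q = r - 1"
  \<comment> \<open>Room for \<open>choose_cells\<close>: the \<open>3 * N\<close> vertices of three
    classes and at most \<open>3 * (N * N)\<close> cells with \<open>q\<close> vertices
    each.\<close>
  define m where "m = 3 * N + 3 * (N * N) * q"
  \<comment> \<open>A set and its labels have (r - 1) + (t + 1) = r + t vertices, which is the price
    of the separating set. Half of the remaining density is then spent on sets with a pair that is
    not rich.\<close>
  define \<delta>1 where "\<delta>1 = \<delta> / 2 ^ (r + t)"
  define \<delta>2 where "\<delta>2 = \<delta>1 / 2"
  define nxt where "nxt d = d / 2 * (d / (2 * real N)) ^ N" for d :: real
  have nxt: "0 < nxt d" if "0 < d" for d unfolding nxt_def using that N1 by simp
  have dpos: "0 < \<delta>1" "0 < \<delta>2" using \<delta> by (auto simp: \<delta>1_def \<delta>2_def)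
  have npos: "0 < nxt \<delta>1" "0 < nxt \<delta>2" "0 < nxt (nxt \<delta>2)" using nxt dpos by simp_all
  \<comment> \<open>Each summand is the threshold of one later step; those with \<open>nxt\<close>
    in the denominator make the remaining densities still yield \<open>N\<close> vertices or meet
    the size demand of \<open>common_neighbours\<close>.\<close>
  define M where "M = real N + 1 + real m / \<delta>2 + 2 * N / \<delta>1 + N / nxt \<delta>1 + 2 * N / \<delta>2 + 2 * N / nxt \<delta>2 + N / nxt (nxt \<delta>2)"
  have main: "occurs H" if V: "finite V" and n: "M \<le> card V" and u: "uniform r H" and HV: "\<Union>H \<subseteq> V"
    and E: "\<forall>f\<in>E. f \<subseteq> V \<and> card f = r - 1" and dens: "\<delta> * real (card V) ^ (r - 1) \<le> card E"
    and L: "\<forall>f\<in>E. L f \<subseteq> nbrs H f \<and> card (L f) = t + 1 \<and> (\<forall>c\<in>L f. \<forall>x\<in>f. t + 1 \<le> card (nbrs H (insert c f - {x})))"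
    for V :: "'a set" and H E L
  proof -
    define n where "n = real (card V)"
    have terms: "0 \<le> real m / \<delta>2" "0 \<le> 2 * N / \<delta>1" "0 \<le> N / nxt \<delta>1" "0 \<le> 2 * N / \<delta>2" "0 \<le> 2 * N / nxt \<delta>2" "0 \<le> N / nxt (nxt \<delta>2)"
      using dpos npos by (simp_all add: less_imp_le)
    have nM: "real N \<le> n" "1 \<le> n" "real m / \<delta>2 \<le> n" "2 * real N / \<delta>1 \<le> n" "N / nxt \<delta>1 \<le> n" "2 * real N / \<delta>2 \<le> n"
      "2 * real N / nxt \<delta>2 \<le> n" "N / nxt (nxt \<delta>2) \<le> n"
      using \<open>M \<le> card V\<close> terms N1(1) unfolding M_def n_def by linarith+
    have NV: "N \<le> card V" using nM(1) by (simp add: n_def)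
    have finE: "finite E" by (rule finite_subset[of _ "Pow V"]) (use E V in auto)
    have "0 < \<delta> * n ^ (r - 1)" using \<delta> nM(2) by simp
    then have neE: "E \<noteq> {}" using dens unfolding n_def by auto
    have "\<exists>W. card E \<le> 2 ^ (r + t) * card {f\<in>E. f \<subseteq> W \<and> L f \<inter> W = {}}"
    proof (rule separating_set_exists[OF V finE neE])
      fix f assume f: "f \<in> E"
      have "nbrs H f \<subseteq> V" using HV by (auto simp: nbrs_def)
      then have "L f \<subseteq> V" using L f by blast
      moreover have "f \<inter> L f = {}" using L f by (auto simp: nbrs_def)
      ultimately show "f \<subseteq> V \<and> L f \<subseteq> V \<and> f \<inter> L f = {} \<and> card f + card (L f) = r + t" using E L f r by auto
    qed
    then obtain W where W: "card E \<le> 2 ^ (r + t) * card {f\<in>E. f \<subseteq> W \<and> L f \<inter> W = {}}" by blast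
    define E1 where "E1 = {f\<in>E. f \<subseteq> W \<and> L f \<inter> W = {}}"
    have "real (card E) \<le> real (2 ^ (r + t) * card E1)" using W unfolding E1_def of_nat_le_iff .
    then have "real (card E) \<le> 2 ^ (r + t) * real (card E1)" by simp
    then have d1: "\<delta>1 * n ^ q \<le> card E1" using dens unfolding \<delta>1_def q_def n_def by (simp add: field_simps)
    have finE1: "finite E1" using finE by (simp add: E1_def)
    have E1: "f \<subseteq> V \<and> card f = q" "finite f \<and> card f = q" if "f \<in> E1" for f
      using E that V by (auto simp: E1_def q_def intro: finite_subset)
    have E1L: "f \<subseteq> W \<and> L f \<inter> W = {} \<and> L f \<subseteq> nbrs H f \<and> (\<forall>c\<in>L f. \<forall>x\<in>f. t + 1 \<le> card (nbrs H (insert c f - {x})))"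
      if "f \<in> E1" for f using L that by (simp add: E1_def)
    have E1c: "finite (L f) \<and> card (L f) = t + 1" if "f \<in> E1" for f
      using L that by (auto simp: E1_def intro: card_ge_0_finite)
    show ?thesis
    \<comment> \<open>For r = 3 the sets are pairs, that is, edges of a dense graph, and one use of
      \<open>common_neighbours\<close> gives the grid without fillers. For larger r the members have
      a third vertex, which makes a third class possible, but pairs must be completed by
      fillers.\<close>
    proof (cases "r = 3")
      case True
      then have q2: "q = 2" by (simp add: q_def)
      define R where "R = {(x, y). {x, y} \<in> E1}"
      have RV: "R \<subseteq> V \<times> V" using E1(1) by (auto simp: R_def)
      have "E1 \<subseteq> (\<lambda>(x, y). {x, y}) ` R"
      proof
        fix f assume f: "f \<in> E1"
        then obtain x y where "f = {x, y}" using E1(1)[OF f] q2 by (metis card_2_iff)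
        then show "f \<in> (\<lambda>(x, y). {x, y}) ` R" using f by (auto simp: R_def)
      qed
      moreover have finR: "finite R" using RV V by (meson finite_SigmaI finite_subset)
      ultimately have "card E1 \<le> card R" by (meson surj_card_le)
      then have "\<delta>1 * card V * card V \<le> card R" using d1 unfolding q2 n_def by (simp add: power2_eq_square mult.assoc)
      then obtain A where A: "A \<subseteq> V" "card A = N" "nxt \<delta>1 * card V \<le> card {y\<in>V. \<forall>x\<in>A. (x, y) \<in> R}"
        using common_neighbours[OF V V RV _ dpos(1) N1(1) NV] nM(4) unfolding n_def nxt_def by blast
      have "N \<le> nxt \<delta>1 * n" using nM(5) nxt[OF dpos(1)] by (simp add: field_simps)
      then have "N \<le> card {y\<in>V. \<forall>x\<in>A. (x, y) \<in> R}" using A(3) unfolding n_def by linarith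
      then obtain B where B: "B \<subseteq> {y\<in>V. \<forall>x\<in>A. (x, y) \<in> R}" "card B = N" "finite B" by (rule obtain_subset_with_card_n)
      have AB: "{a, b} \<in> E1" if "a \<in> A" "b \<in> B" for a b using B(1) that by (auto simp: R_def)
      have "a \<noteq> b" if "a \<in> A" "b \<in> B" for a b using E1(1)[OF AB[OF that]] q2 by auto
      then have dj: "A \<inter> B = {}" by auto
      have fin: "finite A" "finite B" using finite_subset[OF A(1) V] B(3) .
      define F where "F p = {fst p, snd p}" for p :: "'a \<times> 'a"
      have FE: "F (a, b) \<in> E1" if "a \<in> A" "b \<in> B" for a b using AB[OF that] by (simp add: F_def)
      have G: "grid H A B (\<lambda>a b. F (a, b) - {a, b}) (\<lambda>a b. L (F (a, b)))"
        "grid_full H t A B (\<lambda>a b. F (a, b) - {a, b}) (\<lambda>a b. L (F (a, b)))"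
      proof (atomize (full), rule conjI)
        have 1: "F (a, b) \<in> E1 \<and> a \<in> F (a, b) \<and> b \<in> F (a, b) \<and> (F (a, b) - {a, b}) \<inter> (A \<union> B) = {}"
          if "a \<in> A" "b \<in> B" for a b using FE[OF that] by (simp add: F_def)
        have 2: "disjoint_family_on (\<lambda>p. F p - {fst p, snd p}) (A \<times> B)" by (simp add: F_def disjoint_family_on_def)
        show "grid H A B (\<lambda>a b. F (a, b) - {a, b}) (\<lambda>a b. L (F (a, b)))"
          by (rule grid_from_cells(1)[where E = E1 and W = W and t = t, OF fin dj _ 2]) (fact 1 E1L)+
        show "grid_full H t A B (\<lambda>a b. F (a, b) - {a, b}) (\<lambda>a b. L (F (a, b)))"
          by (rule grid_from_cells(2)[where E = E1 and W = W and t = t, OF fin dj _ 2]) (fact 1 E1L)+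
      qed
      have "\<forall>a\<in>A. \<forall>b\<in>B. F (a, b) - {a, b} = {} \<and> finite (L (F (a, b))) \<and> card (L (F (a, b))) = t + 1"
        using E1c[OF FE] by (simp add: F_def)
      then show ?thesis using N3(2)[rule_format, OF G u] A(2) B(2) N1(2) by simp
    next
      case False
      then have q3: "q \<ge> 3" using r by (simp add: q_def)
      \<comment> \<open>All pairs inside a surviving set are rich in \<open>E1\<close>, so cells
        will be taken from \<open>E1\<close> for the pairs of triples in \<open>E2\<close>.\<close>
      define E2 where "E2 = E1 - {f\<in>E1. \<exists>u\<in>f. \<exists>v\<in>f. u \<noteq> v \<and> \<not> rich E1 m u v}"
      have E2: "f \<subseteq> V \<and> card f = q" if "f \<in> E2" for f using E1(1) that by (auto simp: E2_def)
      have E2r: "rich E1 m u v" if "f \<in> E2" "u \<in> f" "v \<in> f" "u \<noteq> v" for f u v using that by (auto simp: E2_def)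
      have nq: "n ^ q = n ^ (q - 3) * n * n * n"
        using power_add[of n "q - 3" 3] q3 by (simp add: power3_eq_cube)
      have "card {f\<in>E1. \<exists>u\<in>f. \<exists>v\<in>f. u \<noteq> v \<and> \<not> rich E1 m u v} \<le> card V * card V * (m * card V ^ (q - 3))"
        by (rule card_not_rich_le[OF V _ q3]) (rule E1(1))
      then have "real (card {f\<in>E1. \<exists>u\<in>f. \<exists>v\<in>f. u \<noteq> v \<and> \<not> rich E1 m u v})
          \<le> real (card V * card V * (m * card V ^ (q - 3)))" unfolding of_nat_le_iff .
      also have "\<dots> = n * n * (m * n ^ (q - 3))" unfolding n_def by simp
      also have "\<dots> \<le> n * n * ((\<delta>2 * n) * n ^ (q - 3))"
        using nM(2,3) dpos(2) by (intro mult_left_mono mult_right_mono) (auto simp: field_simps)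
      also have "\<dots> = \<delta>2 * n ^ q" unfolding nq by simp
      finally have "real (card {f\<in>E1. \<exists>u\<in>f. \<exists>v\<in>f. u \<noteq> v \<and> \<not> rich E1 m u v}) \<le> \<delta>2 * n ^ q" .
      moreover have "card E2 = card E1 - card {f\<in>E1. \<exists>u\<in>f. \<exists>v\<in>f. u \<noteq> v \<and> \<not> rich E1 m u v}"
        unfolding E2_def using finE1 by (intro card_Diff_subset) auto
      ultimately have d2: "\<delta>2 * n ^ q \<le> card E2" using d1 unfolding \<delta>2_def by (simp add: field_simps)
      define Tr where "Tr = {(x, y, z). x \<noteq> y \<and> y \<noteq> z \<and> x \<noteq> z \<and> (\<exists>f\<in>E2. {x, y, z} \<subseteq> f)}"
      have TrV: "Tr \<subseteq> V \<times> (V \<times> V)" using E2 by (auto simp: Tr_def)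
      have "card E2 \<le> card Tr * card V ^ (q - 3)" unfolding Tr_def by (rule card_le_triples[OF V _ q3]) (rule E2)
      then have "real (card E2) \<le> real (card Tr * card V ^ (q - 3))" unfolding of_nat_le_iff .
      then have "real (card E2) \<le> card Tr * n ^ (q - 3)" unfolding n_def by simp
      then have "n ^ (q - 3) * (\<delta>2 * n * n * n) \<le> n ^ (q - 3) * card Tr" using d2 unfolding nq by (simp add: algebra_simps)
      then have "\<delta>2 * n * n * n \<le> card Tr" using nM(2) by (simp add: mult_le_cancel_left_pos)
      then have "\<delta>2 * card V * card (V \<times> V) \<le> card Tr" unfolding n_def by (simp add: card_cartesian_product mult.assoc)
      \<comment> \<open>Two uses of \<open>common_neighbours\<close>: here \<open>A\<close> against
        pairs of vertices, then \<open>B\<close> against single vertices among the pairs joined to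
        all of \<open>A\<close>. All triples in \<open>A \<times> B \<times> C\<close> then belong
        to \<open>Tr\<close>.\<close>
      then obtain A where A: "A \<subseteq> V" "card A = N" "nxt \<delta>2 * card (V \<times> V) \<le> card {y\<in>V \<times> V. \<forall>x\<in>A. (x, y) \<in> Tr}"
        using common_neighbours[OF V _ TrV _ dpos(2) N1(1) NV] nM(6) V unfolding n_def nxt_def by blast
      define R where "R = {y\<in>V \<times> V. \<forall>x\<in>A. (x, y) \<in> Tr}"
      have "nxt \<delta>2 * card V * card V \<le> card R" using A(3) unfolding R_def by (simp add: card_cartesian_product mult.assoc)
      then obtain B where B: "B \<subseteq> V" "card B = N" "nxt (nxt \<delta>2) * card V \<le> card {z\<in>V. \<forall>y\<in>B. (y, z) \<in> R}"
        using common_neighbours[OF V V _ _ nxt[OF dpos(2)] N1(1) NV, of R] nM(7) unfolding n_def nxt_def[of "nxt \<delta>2"] R_def by blast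
      have "N \<le> nxt (nxt \<delta>2) * n" using nM(8) nxt[OF nxt[OF dpos(2)]] by (simp add: field_simps)
      then have "N \<le> card {z\<in>V. \<forall>y\<in>B. (y, z) \<in> R}" using B(3) unfolding n_def by linarith
      then obtain C where C: "C \<subseteq> {z\<in>V. \<forall>y\<in>B. (y, z) \<in> R}" "card C = N" "finite C" by (rule obtain_subset_with_card_n)
      have Tr: "(x, y, z) \<in> Tr" if "x \<in> A" "y \<in> B" "z \<in> C" for x y z using C(1) that by (auto simp: R_def)
      have fin: "finite A" "finite B" "finite C" using finite_subset[OF A(1) V] finite_subset[OF B(1) V] C(3) .
      have ne: "A \<noteq> {}" "B \<noteq> {}" "C \<noteq> {}" using A(2) B(2) C(2) N1(1) by auto
      have dj: "A \<inter> B = {}" "A \<inter> C = {}" "B \<inter> C = {}"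
        using Tr ne unfolding Tr_def by blast+
      have rAB: "rich E1 m a b" if st: "a \<in> A" "b \<in> B" for a b
      proof -
        obtain z where "z \<in> C" using ne by blast
        then obtain f where "f \<in> E2" "a \<in> f" "b \<in> f" "a \<noteq> b" using Tr[OF st, of z] by (auto simp: Tr_def)
        then show ?thesis by (rule E2r)
      qed
      have rAC: "rich E1 m a z" if st: "a \<in> A" "z \<in> C" for a z
      proof -
        obtain b where "b \<in> B" using ne by blast
        then obtain f where "f \<in> E2" "a \<in> f" "z \<in> f" "a \<noteq> z" using Tr[OF st(1) _ st(2), of b] by (auto simp: Tr_def)
        then show ?thesis by (rule E2r)
      qed
      have rBC: "rich E1 m b z" if st: "b \<in> B" "z \<in> C" for b z
      proof -
        obtain a where "a \<in> A" using ne by blast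
        then obtain f where "f \<in> E2" "b \<in> f" "z \<in> f" "b \<noteq> z" using Tr[OF _ st, of a] by (auto simp: Tr_def)
        then show ?thesis by (rule E2r)
      qed
      define P where "P = A \<times> B \<union> A \<times> C \<union> B \<times> C"
      define W0 where "W0 = A \<union> B \<union> C"
      have "card P \<le> card (A \<times> B) + card (A \<times> C) + card (B \<times> C)" unfolding P_def
        by (intro order_trans[OF card_Un_le] add_mono order_refl)
      then have cP: "card P \<le> 3 * (N * N)" using A(2) B(2) C(2) by (simp add: card_cartesian_product)
      have "card W0 \<le> card A + card B + card C" unfolding W0_def by (intro order_trans[OF card_Un_le] add_mono order_refl)
      then have "card W0 \<le> 3 * N" using A(2) B(2) C(2) by simp
      moreover have "card P * q \<le> 3 * (N * N) * q" using cP by (rule mult_right_mono) simp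
      ultimately have cm: "card W0 + card P * q \<le> m" unfolding m_def by linarith
      have "\<exists>F. (\<forall>p\<in>P. F p \<in> E1 \<and> fst p \<in> F p \<and> snd p \<in> F p \<and> (F p - {fst p, snd p}) \<inter> W0 = {}) \<and>
          disjoint_family_on (\<lambda>p. F p - {fst p, snd p}) P"
      proof (rule choose_cells[where m = m and q = q])
        show "rich E1 m u v" if "(u, v) \<in> P" for u v using that rAB rAC rBC unfolding P_def by blast
        show "finite f \<and> card f = q" if "f \<in> E1" for f using E1(2)[OF that] .
      qed (use fin cm in \<open>auto simp: P_def W0_def\<close>)
      then obtain F where F: "\<forall>p\<in>P. F p \<in> E1 \<and> fst p \<in> F p \<and> snd p \<in> F p \<and> (F p - {fst p, snd p}) \<inter> W0 = {}"
        and Fd: "disjoint_family_on (\<lambda>p. F p - {fst p, snd p}) P" by (elim exE conjE)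
      have sub: "A \<times> B \<subseteq> P" "A \<times> C \<subseteq> P" "B \<times> C \<subseteq> P" by (auto simp: P_def)
      have Fp: "F (a, b) \<in> E1" "a \<in> F (a, b)" "b \<in> F (a, b)" "(F (a, b) - {a, b}) \<inter> W0 = {}" if "(a, b) \<in> P" for a b
        using F that by force+
      have G: "grid H A' B' (\<lambda>a b. F (a, b) - {a, b}) (\<lambda>a b. L (F (a, b))) \<and>
        grid_full H t A' B' (\<lambda>a b. F (a, b) - {a, b}) (\<lambda>a b. L (F (a, b))) \<and>
        (\<forall>a\<in>A'. \<forall>b\<in>B'. finite (L (F (a, b))) \<and> card (L (F (a, b))) = t + 1)"
        if "finite A'" "finite B'" "A' \<inter> B' = {}" "A' \<times> B' \<subseteq> P" "A' \<union> B' \<subseteq> W0" for A' B'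
      proof -
        have 1: "F (a, b) \<in> E1 \<and> a \<in> F (a, b) \<and> b \<in> F (a, b) \<and> (F (a, b) - {a, b}) \<inter> (A' \<union> B') = {}"
          if "a \<in> A'" "b \<in> B'" for a b
        proof -
          have "(a, b) \<in> P" using that \<open>A' \<times> B' \<subseteq> P\<close> by blast
          from Fp[OF this] show ?thesis using \<open>A' \<union> B' \<subseteq> W0\<close> by blast
        qed
        have 2: "disjoint_family_on (\<lambda>p. F p - {fst p, snd p}) (A' \<times> B')"
          by (rule disjoint_family_on_mono[OF that(4) Fd])
        have "grid H A' B' (\<lambda>a b. F (a, b) - {a, b}) (\<lambda>a b. L (F (a, b)))"
          by (rule grid_from_cells(1)[where E = E1 and W = W and t = t, OF that(1-3) _ 2]) (fact 1 E1L)+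
        moreover have "grid_full H t A' B' (\<lambda>a b. F (a, b) - {a, b}) (\<lambda>a b. L (F (a, b)))"
          by (rule grid_from_cells(2)[where E = E1 and W = W and t = t, OF that(1-3) _ 2]) (fact 1 E1L)+
        moreover have "\<forall>a\<in>A'. \<forall>b\<in>B'. finite (L (F (a, b))) \<and> card (L (F (a, b))) = t + 1" using 1 E1c by blast
        ultimately show ?thesis by blast
      qed
      have Gab: "grid H A B (\<lambda>a b. F (a, b) - {a, b}) (\<lambda>a b. L (F (a, b)))"
          "grid_full H t A B (\<lambda>a b. F (a, b) - {a, b}) (\<lambda>a b. L (F (a, b)))"
          "\<forall>a\<in>A. \<forall>b\<in>B. finite (L (F (a, b))) \<and> card (L (F (a, b))) = t + 1"
        using G[OF fin(1,2) dj(1) sub(1)] by (auto simp: W0_def)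
      have Gac: "grid H A C (\<lambda>a b. F (a, b) - {a, b}) (\<lambda>a b. L (F (a, b)))"
          "grid_full H t A C (\<lambda>a b. F (a, b) - {a, b}) (\<lambda>a b. L (F (a, b)))"
          "\<forall>a\<in>A. \<forall>b\<in>C. finite (L (F (a, b))) \<and> card (L (F (a, b))) = t + 1"
        using G[OF fin(1,3) dj(2) sub(2)] by (auto simp: W0_def)
      have Gbc: "grid H B C (\<lambda>a b. F (a, b) - {a, b}) (\<lambda>a b. L (F (a, b)))"
          "grid_full H t B C (\<lambda>a b. F (a, b) - {a, b}) (\<lambda>a b. L (F (a, b)))"
          "\<forall>a\<in>B. \<forall>b\<in>C. finite (L (F (a, b))) \<and> card (L (F (a, b))) = t + 1"
        using G[OF fin(2,3) dj(3) sub(3)] by (auto simp: W0_def)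
      have sep: "(F (a, z) - {a, z}) \<inter> insert b (F (b, z) - {b, z}) = {} \<and> a \<notin> F (b, z) - {b, z} \<and>
        L (F (a, z)) \<inter> insert b (F (b, z) - {b, z}) = {} \<and> L (F (b, z)) \<inter> insert a (F (a, z) - {a, z}) = {}"
        if abz: "a \<in> A" "b \<in> B" "z \<in> C" for a b z
      proof -
        have p: "(a, z) \<in> P" "(b, z) \<in> P" using abz by (auto simp: P_def)
        have ab: "a \<in> W0" "b \<in> W0" "a \<noteq> b" using abz dj by (auto simp: W0_def)
        have "(F (a, z) - {fst (a, z), snd (a, z)}) \<inter> (F (b, z) - {fst (b, z), snd (b, z)}) = {}"
          using Fd p ab(3) unfolding disjoint_family_on_def by (metis Pair_inject)
        moreover have "F (a, z) \<subseteq> W" "F (b, z) \<subseteq> W" "L (F (a, z)) \<inter> W = {}" "L (F (b, z)) \<inter> W = {}"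
          using E1L[OF Fp(1)[OF p(1)]] E1L[OF Fp(1)[OF p(2)]] by auto
        ultimately show ?thesis using Fp(2,4)[OF p(1)] Fp(2,4)[OF p(2)] ab by auto
      qed
      show ?thesis
        by (rule N4(2)[rule_format, OF Gab(1) Gac(1) Gbc(1) Gab(2) Gac(2) Gbc(2) u])
           (use A(2) B(2) C(2) N1(3) Gab(3) Gac(3) Gbc(3) sep in auto)
    qed
  qed
  show ?thesis
  proof (intro exI[of _ "nat \<lceil>M\<rceil>"] allI impI)
    fix V :: "'a set" and H E L
    assume A: "finite V" "nat \<lceil>M\<rceil> \<le> card V" "uniform r H" "\<Union>H \<subseteq> V" "\<forall>f\<in>E. f \<subseteq> V \<and> card f = r - 1"
      "\<delta> * real (card V) ^ (r - 1) \<le> card E"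
      "\<forall>f\<in>E. L f \<subseteq> nbrs H f \<and> card (L f) = t + 1 \<and> (\<forall>c\<in>L f. \<forall>x\<in>f. t + 1 \<le> card (nbrs H (insert c f - {x})))"
    have "M \<le> card V" using A(2) by linarith
    then show "occurs H" using main[OF A(1) _ A(3-7)] by blast
  qed
qed

end

section \<open>The upper bound\<close>

lemma expansion_covered:
  assumes "\<And>x. x \<in> hverts F \<Longrightarrow> \<exists>e\<in>hedges F. x \<in> e"
  shows "hverts (expansion r F) \<subseteq> \<Union>(hedges (expansion r F))"
proof
  fix x assume "x \<in> hverts (expansion r F)"
  then consider v where "v \<in> hverts F" "x = Inl v" | e j where "e \<in> hedges F" "j < r - 2" "x = Inr (e, j)"
    by (auto simp: expansion_def)
  then show "x \<in> \<Union>(hedges (expansion r F))"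
  proof cases
    case 1
    then obtain e where "e \<in> hedges F" "v \<in> e" using assms by blast
    then show ?thesis using 1 by (auto simp: expansion_def)
  next
    case 2
    then show ?thesis by (auto simp: expansion_def)
  qed
qed

lemma path_graph_covered: "l \<ge> 1 \<Longrightarrow> x \<in> hverts (path_graph l) \<Longrightarrow> \<exists>e\<in>hedges (path_graph l). x \<in> e"
proof -
  assume "l \<ge> 1" "x \<in> hverts (path_graph l)"
  then have "(if x = l then x - 1 else x) < l" "x \<in> {if x = l then x - 1 else x, (if x = l then x - 1 else x) + 1}"
    by (auto simp: path_graph_def)
  then show ?thesis unfolding path_graph_def by (auto simp del: One_nat_def)
qed

lemma cycle_graph_covered: "x \<in> hverts (cycle_graph l) \<Longrightarrow> \<exists>e\<in>hedges (cycle_graph l). x \<in> e"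
  by (auto simp: cycle_graph_def)

lemma embeds_mono: "embeds Q H S \<Longrightarrow> H \<subseteq> H' \<Longrightarrow> embeds Q H' S"
  unfolding embeds_def by (meson subsetD)

text \<open>Without isolated vertices every image lies in a hyperedge, so the target can be cut down
  to vertices of the host.\<close>

lemma embeds_covered:
  assumes "embeds Q H S" "hverts Q \<subseteq> \<Union>(hedges Q)"
  shows "embeds Q H (S \<inter> \<Union>H)"
proof -
  obtain g where g: "inj_on g (hverts Q)" "g ` hverts Q \<subseteq> S" "\<forall>e\<in>hedges Q. g ` e \<in> H"
    using assms(1) unfolding embeds_def by (elim exE conjE)
  have "g x \<in> \<Union>H" if x: "x \<in> hverts Q" for x
  proof -
    obtain e where "e \<in> hedges Q" "x \<in> e" using assms(2) x by auto
    then show ?thesis using g(3) by auto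
  qed
  then have "g ` hverts Q \<subseteq> S \<inter> \<Union>H" using g(2) by auto
  then show ?thesis unfolding embeds_def using g(1,3) by (intro exI[of _ g] conjI)
qed

lemma shadow_subset:
  assumes "uniform r H" "\<Union>H \<subseteq> V" "f \<in> shadow H"
  shows "f \<subseteq> V \<and> card f = r - 1"
  using assms by (auto simp: shadow_def uniform_def)

context path_cycle_components
begin

lemma components_covered:
  assumes "i \<in> I"
  shows "hverts (Q i) \<subseteq> \<Union>(hedges (Q i))"
proof -
  have "l i \<ge> 1" using l[OF assms] by simp
  then have "hverts (expansion r (path_graph (l i))) \<subseteq> \<Union>(hedges (expansion r (path_graph (l i))))"
    by (intro expansion_covered path_graph_covered)
  moreover have "hverts (expansion r (cycle_graph (l i))) \<subseteq> \<Union>(hedges (expansion r (cycle_graph (l i))))"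
    by (intro expansion_covered cycle_graph_covered)
  ultimately show ?thesis using Q[OF assms] by (elim insertE emptyE) simp_all
qed

lemma occurs_mono: "occurs H \<Longrightarrow> H \<subseteq> H' \<Longrightarrow> occurs H'"
  unfolding occurs_def using embeds_mono by metis

lemma occurs_copies:
  assumes "occurs (hedges G)" "r_graph r G"
  shows "copies (disjoint_union I Q) G \<noteq> {}"
proof -
  obtain S where S: "\<forall>i\<in>I. embeds (Q i) (hedges G) (S i)" "disjoint_family_on S I"
    using assms(1) unfolding occurs_def by (elim exE conjE)
  let ?S = "\<lambda>i. S i \<inter> \<Union>(hedges G)"
  have "disjoint_family_on ?S I" using S(2) by (auto simp: disjoint_family_on_def)
  then have "embeds (disjoint_union I Q) (hedges G) (\<Union>i\<in>I. ?S i)"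
    by (rule embeds_disjoint_union[rotated]) (use S(1) embeds_covered components_covered in metis)
  then show ?thesis by (rule copies_nonempty) (use assms(2) in \<open>auto simp: r_graph_def\<close>)
qed

text \<open>Suffices for \<open>full_contains_cycle\<close> while the components already placed are
  avoided. The factor \<open>lm + 1\<close> accounts for paths, which are cut from a cycle one
  longer.\<close>

definition dmax :: nat where "dmax = card I * (lm * r + 0) + (lm + 1) * (r + 1) + 1"

lemma full_occurs:
  fixes H :: "'a set set"
  assumes full: "full dmax H" and u: "uniform r H" and ne: "H \<noteq> {}"
  shows "occurs H"
  unfolding occurs_def
proof (rule disjoint_choice[OF I(1), where R = "\<lambda>_. {}" and s = "lm * r" and \<rho> = 0])
  fix i and X :: "'a set" assume i: "i \<in> I" and X: "finite X" "card X \<le> card I * (lm * r + 0)"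
  have li: "5 \<le> l i" "l i \<le> lm" using l[OF i] by auto
  have "\<exists>e. (\<forall>j<l i. e j \<in> H \<and> e j \<inter> X = {}) \<and>
    (Q i = expansion r (path_graph (l i)) \<and> lin_path e (l i) \<or> Q i = expansion r (cycle_graph (l i)) \<and> lin_cycle e (l i))"
  proof (cases "Q i = expansion r (path_graph (l i))")
    case True
    have "(l i + 1) * (r + 1) \<le> (lm + 1) * (r + 1)" using li by (intro mult_right_mono) auto
    then have "card X + (l i + 1) * (r + 1) < dmax" unfolding dmax_def using X(2) by linarith
    then obtain e where e: "\<forall>j<l i + 1. e j \<in> H \<and> e j \<inter> X = {}" "lin_cycle e (l i + 1)"
      using full_contains_cycle[OF full u ne r X(1), of "l i + 1"] li by (elim exE conjE meta_impE) auto
    have "lin_path e (l i)" using e(2) by (intro lin_cycle_imp_path) simp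
    then show ?thesis using e(1) True by (intro exI[of _ e]) simp
  next
    case False
    have "l i * (r + 1) \<le> (lm + 1) * (r + 1)" using li by (intro mult_right_mono) auto
    then have "card X + l i * (r + 1) < dmax" unfolding dmax_def using X(2) by linarith
    then obtain e where e: "\<forall>j<l i. e j \<in> H \<and> e j \<inter> X = {}" "lin_cycle e (l i)"
      using full_contains_cycle[OF full u ne r X(1), of "l i"] li by (elim exE conjE meta_impE) auto
    then show ?thesis using False Q[OF i] by (intro exI[of _ e]) simp
  qed
  then obtain e where e: "\<forall>j<l i. e j \<in> H \<and> e j \<inter> X = {}"
    "Q i = expansion r (path_graph (l i)) \<and> lin_path e (l i) \<or> Q i = expansion r (cycle_graph (l i)) \<and> lin_cycle e (l i)"
    by (elim exE conjE)
  have "embeds (Q i) H (\<Union>j<l i. e j) \<and> finite (\<Union>j<l i. e j) \<and> card (\<Union>j<l i. e j) \<le> l i * r"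
    by (rule embeds_component[OF u r li(1) _ e(2)]) (use e(1) in simp)
  moreover have "(\<Union>j<l i. e j) \<inter> X = {}" using e(1) by auto
  moreover have "l i * r \<le> lm * r" using li by simp
  ultimately show "\<exists>S. embeds (Q i) H S \<and> S \<inter> X = {} \<and> finite S \<and> card S \<le> lm * r" by (meson order_trans)
qed (auto simp: disjoint_family_on_def)

text \<open>Deleted sets of codegree at most \<open>t\<close> number at most
  \<open>card V choose (r - 1)\<close> and give the main term. The others carry boundedly many
  cliques each, and \<open>dense_occurs\<close> makes them sparse.\<close>

lemma cliques_upper_bound:
  fixes \<epsilon> :: real
  assumes \<epsilon>: "0 < \<epsilon>" and s: "r \<le> s"
  shows "\<exists>n0. \<forall>(V::'a set) H. finite V \<longrightarrow> n0 \<le> card V \<longrightarrow> uniform r H \<longrightarrow> \<Union>H \<subseteq> V \<longrightarrow> \<not> occurs H \<longrightarrow>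
    real (card (cliques r H s)) \<le> real (t choose (s - r + 1)) * real (card V choose (r - 1)) + \<epsilon> * real (card V) ^ (r - 1)"
proof -
  define b where "b = real (dmax choose (s - r + 1))"
  \<comment> \<open>\<open>b\<close> bounds the cliques charged to one set in \<open>E\<close>, so
    \<open>b * \<delta> \<le> \<epsilon>\<close>; the summand 1 keeps the denominator
    positive.\<close>
  define \<delta> where "\<delta> = \<epsilon> / (b + 1)"
  have b0: "0 \<le> b" by (simp add: b_def)
  have \<delta>: "0 < \<delta>" unfolding \<delta>_def using \<epsilon> b0 by (intro divide_pos_pos) auto
  obtain n0 where n0: "\<forall>(V::'a set) H E L. finite V \<longrightarrow> n0 \<le> card V \<longrightarrow> uniform r H \<longrightarrow> \<Union>H \<subseteq> V \<longrightarrow>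
    (\<forall>f\<in>E. f \<subseteq> V \<and> card f = r - 1) \<longrightarrow> \<delta> * real (card V) ^ (r - 1) \<le> card E \<longrightarrow>
    (\<forall>f\<in>E. L f \<subseteq> nbrs H f \<and> card (L f) = t + 1 \<and> (\<forall>c\<in>L f. \<forall>x\<in>f. t + 1 \<le> card (nbrs H (insert c f - {x})))) \<longrightarrow>
    occurs H" using dense_occurs[OF \<delta>, where 'a = 'a] by (elim exE)
  show ?thesis
  proof (intro exI[of _ n0] allI impI)
    fix V :: "'a set" and H
    assume V: "finite V" "n0 \<le> card V" and u: "uniform r H" and HV: "\<Union>H \<subseteq> V" and no: "\<not> occurs H"
    have nofull: "\<not> full dmax H'" if "H' \<subseteq> H" "H' \<noteq> {}" for H'
    proof
      assume "full dmax H'"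
      moreover have "uniform r H'" using u that(1) by (auto simp: uniform_def intro: finite_subset)
      ultimately have "occurs H'" using full_occurs that(2) by blast
      then show False using no occurs_mono that(1) by blast
    qed
    have "1 \<le> r" using r by simp
    have "\<exists>P E. P \<subseteq> shadow H \<and> E \<subseteq> shadow H \<and> finite P \<and> finite E \<and>
      card (cliques r H s) \<le> (t choose (s - r + 1)) * card P + (dmax choose (s - r + 1)) * card E \<and>
      (\<forall>f\<in>E. \<exists>H'\<subseteq>H. full (t + 1) H' \<and> f \<in> shadow H')"
      by (rule trimming[OF u \<open>1 \<le> r\<close> s]) (fact nofull)
    then obtain P E where PE: "P \<subseteq> shadow H" "E \<subseteq> shadow H" "finite P" "finite E"
      "card (cliques r H s) \<le> (t choose (s - r + 1)) * card P + (dmax choose (s - r + 1)) * card E"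
      and ff: "\<forall>f\<in>E. \<exists>H'\<subseteq>H. full (t + 1) H' \<and> f \<in> shadow H'" by (elim exE conjE)
    have sh: "f \<subseteq> V \<and> card f = r - 1" if "f \<in> shadow H" for f using shadow_subset[OF u HV that] .
    have "card P \<le> card {f. f \<subseteq> V \<and> card f = r - 1}" using PE(1) sh V(1) by (intro card_mono) auto
    also have "\<dots> = card V choose (r - 1)" using V(1) by (rule n_subsets)
    finally have cP: "card P \<le> card V choose (r - 1)" .
    \<comment> \<open>The labels are taken in the full subhypergraph present when \<open>f\<close>
      was deleted; its codegrees are lower bounds for those in \<open>H\<close>.\<close>
    have "\<exists>L. \<forall>f\<in>E. L f \<subseteq> nbrs H f \<and> card (L f) = t + 1 \<and> (\<forall>c\<in>L f. \<forall>x\<in>f. t + 1 \<le> card (nbrs H (insert c f - {x})))"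
    proof (rule bchoice, rule ballI)
      fix f assume "f \<in> E"
      then obtain H' where H': "H' \<subseteq> H" "full (t + 1) H'" "f \<in> shadow H'" using ff by blast
      then obtain e x where ex: "e \<in> H'" "x \<in> e" "f = e - {x}" unfolding shadow_def by blast
      have mono: "nbrs H' g \<subseteq> nbrs H g" for g using H'(1) by (auto simp: nbrs_def)
      have "t + 1 \<le> card (nbrs H' f)" using H'(2) ex unfolding full_def by blast
      then obtain L where L: "L \<subseteq> nbrs H' f" "card L = t + 1" "finite L" by (rule obtain_subset_with_card_n)
      have "t + 1 \<le> card (nbrs H (insert c f - {y}))" if "c \<in> L" "y \<in> f" for c y
      proof -
        have "insert c f \<in> H'" using L(1) that(1) by (auto simp: nbrs_def)
        then have "t + 1 \<le> card (nbrs H' (insert c f - {y}))" using H'(2) that(2) unfolding full_def by blast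
        also have "\<dots> \<le> card (nbrs H (insert c f - {y}))" by (intro card_mono finite_nbrs[OF u] mono)
        finally show ?thesis .
      qed
      then show "\<exists>L. L \<subseteq> nbrs H f \<and> card L = t + 1 \<and> (\<forall>c\<in>L. \<forall>x\<in>f. t + 1 \<le> card (nbrs H (insert c f - {x})))"
        using L(1,2) mono[of f] by (intro exI[of _ L]) auto
    qed
    then obtain L where L: "\<forall>f\<in>E. L f \<subseteq> nbrs H f \<and> card (L f) = t + 1 \<and> (\<forall>c\<in>L f. \<forall>x\<in>f. t + 1 \<le> card (nbrs H (insert c f - {x})))"
      by (elim exE)
    have "\<not> \<delta> * real (card V) ^ (r - 1) \<le> card E"
    proof
      assume d: "\<delta> * real (card V) ^ (r - 1) \<le> card E"
      have "\<forall>f\<in>E. f \<subseteq> V \<and> card f = r - 1" using PE(2) sh by blast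
      from n0[rule_format, OF V u HV bspec[OF this] d bspec[OF L]] show False using no by simp
    qed
    then have "real (card E) \<le> \<delta> * real (card V) ^ (r - 1)" by simp
    then have "b * real (card E) \<le> b * (\<delta> * real (card V) ^ (r - 1))" using b0 by (rule mult_left_mono)
    also have "\<dots> = (b * \<delta>) * real (card V) ^ (r - 1)" by simp
    also have "\<dots> \<le> \<epsilon> * real (card V) ^ (r - 1)"
    proof (rule mult_right_mono)
      show "b * \<delta> \<le> \<epsilon>" unfolding \<delta>_def using \<epsilon> b0 by (simp add: field_simps)
    qed simp
    finally have "b * real (card E) \<le> \<epsilon> * real (card V) ^ (r - 1)" .
    moreover have "real (t choose (s - r + 1)) * real (card P) \<le> real (t choose (s - r + 1)) * real (card V choose (r - 1))"
      using cP by (intro mult_left_mono) auto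
    moreover have "real (card (cliques r H s)) \<le> real ((t choose (s - r + 1)) * card P + (dmax choose (s - r + 1)) * card E)"
      using PE(5) unfolding of_nat_le_iff .
    ultimately show "real (card (cliques r H s)) \<le> real (t choose (s - r + 1)) * real (card V choose (r - 1)) + \<epsilon> * real (card V) ^ (r - 1)"
      unfolding b_def by simp
  qed
qed

end

section \<open>The star and the asymptotics\<close>

lemma r_graph_uniform: "r_graph r G \<Longrightarrow> 1 \<le> r \<Longrightarrow> uniform r (hedges G) \<and> \<Union>(hedges G) \<subseteq> hverts G"
proof -
  assume G: "r_graph r G" "1 \<le> r"
  have "hedges G \<subseteq> Pow (hverts G)" using G(1) by (auto simp: r_graph_def)
  moreover have "finite (Pow (hverts G))" using G(1) by (simp add: r_graph_def)
  ultimately have "finite (hedges G)" by (rule finite_subset)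
  then show ?thesis using G(1) by (auto simp: r_graph_def uniform_def intro: finite_subset)
qed

lemma clique_subset_verts:
  assumes "r_graph r G" "1 \<le> r" "r \<le> s" "S \<in> cliques r (hedges G) s"
  shows "S \<subseteq> hverts G" "finite S"
proof -
  have card: "card S = s" "\<And>e. e \<subseteq> S \<Longrightarrow> card e = r \<Longrightarrow> e \<in> hedges G" using assms(4) by (auto simp: cliques_def)
  show fin: "finite S" using card(1) assms(2,3) by (intro card_ge_0_finite) simp
  show "S \<subseteq> hverts G"
  proof
    fix x assume x: "x \<in> S"
    have "r - 1 \<le> card (S - {x})" using x fin card(1) assms(3) by simp
    then obtain T where T: "T \<subseteq> S - {x}" "card T = r - 1" "finite T" by (rule obtain_subset_with_card_n)
    have "x \<notin> T" using T(1) by auto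
    then have "card (insert x T) = r" using T(2,3) assms(2) by simp
    moreover have "insert x T \<subseteq> S" using T(1) x by auto
    ultimately have "insert x T \<in> hedges G" by (intro card(2))
    then show "x \<in> hverts G" using assms(1) by (auto simp: r_graph_def)
  qed
qed

lemma image_card_subsets:
  assumes "bij_betw f A B"
  shows "(\<lambda>e. f ` e) ` {e. e \<subseteq> A \<and> card e = r} = {e. e \<subseteq> B \<and> card e = r}"
proof
  show "(\<lambda>e. f ` e) ` {e. e \<subseteq> A \<and> card e = r} \<subseteq> {e. e \<subseteq> B \<and> card e = r}"
  proof clarify
    fix e assume "e \<subseteq> A"
    then have "inj_on f e" "f ` e \<subseteq> B" using assms by (auto simp: bij_betw_def intro: inj_on_subset)
    then show "f ` e \<subseteq> B \<and> card (f ` e) = card e" by (simp add: card_image)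
  qed
  show "{e. e \<subseteq> B \<and> card e = r} \<subseteq> (\<lambda>e. f ` e) ` {e. e \<subseteq> A \<and> card e = r}"
  proof clarify
    fix e assume e: "e \<subseteq> B"
    then obtain d where d: "d \<subseteq> A" "e = f ` d" using assms by (auto simp: bij_betw_def subset_image_iff)
    then have "card e = card d" using assms by (auto simp: bij_betw_def intro: card_image inj_on_subset)
    then show "e \<in> (\<lambda>e. f ` e) ` {d. d \<subseteq> A \<and> card d = card e}" using d by auto
  qed
qed

text \<open>A copy of the complete r-graph is determined by its vertex set, so unlabelled copies
  correspond to cliques.\<close>

lemma num_copies_complete:
  assumes G: "r_graph r G" and r: "1 \<le> r" "r \<le> s"
  shows "num_copies (complete_r_graph r s) G = card (cliques r (hedges G) s)"
proof -
  let ?h = "\<lambda>S. (S, {e. e \<subseteq> S \<and> card e = r})"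
  have "copies (complete_r_graph r s) G = ?h ` cliques r (hedges G) s"
  proof
    show "copies (complete_r_graph r s) G \<subseteq> ?h ` cliques r (hedges G) s"
    proof
      fix G' assume G': "G' \<in> copies (complete_r_graph r s) G"
      then obtain f where f: "bij_betw f {..<s} (hverts G')"
        "hedges G' = (\<lambda>e. f ` e) ` {e. e \<subseteq> {..<s} \<and> card e = r}"
        by (auto simp: copies_def hyper_iso_def complete_r_graph_def)
      have e: "hedges G' = {e. e \<subseteq> hverts G' \<and> card e = r}" using f(2) image_card_subsets[OF f(1)] by simp
      have "card (hverts G') = s" using bij_betw_same_card[OF f(1)] by simp
      then have "hverts G' \<in> cliques r (hedges G) s" using G' e by (auto simp: cliques_def copies_def)
      moreover have "G' = ?h (hverts G')" using e by (metis prod.collapse)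
      ultimately show "G' \<in> ?h ` cliques r (hedges G) s" by blast
    qed
    show "?h ` cliques r (hedges G) s \<subseteq> copies (complete_r_graph r s) G"
    proof clarify
      fix S assume S: "S \<in> cliques r (hedges G) s"
      note fs = clique_subset_verts[OF G r S]
      have "card S = s" using S by (simp add: cliques_def)
      then obtain f where f: "bij_betw f {..<s} S" using finite_same_card_bij[of "{..<s}" S] fs(2) by auto
      have "hyper_iso (complete_r_graph r s) (?h S)" unfolding hyper_iso_def complete_r_graph_def
        using f image_card_subsets[OF f, of r] by (intro exI[of _ f]) simp
      then show "?h S \<in> copies (complete_r_graph r s) G" using fs S by (auto simp: copies_def cliques_def)
    qed
  qed
  moreover have "inj_on ?h (cliques r (hedges G) s)" by (auto simp: inj_on_def)
  ultimately show ?thesis unfolding num_copies_def by (simp add: card_image)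
qed

section \<open>Degrees in the components and the star\<close>

lemma copies_embedding:
  assumes "copies F G \<noteq> {}"
  shows "\<exists>g. inj_on g (hverts F) \<and> (\<forall>e\<in>hedges F. g ` e \<in> hedges G)"
proof -
  obtain G' where G': "G' \<in> copies F G" using assms by auto
  then have "hyper_iso F G'" by (simp add: copies_def)
  then obtain f where f: "bij_betw f (hverts F) (hverts G')" "hedges G' = (\<lambda>e. f ` e) ` hedges F"
    unfolding hyper_iso_def by (elim exE conjE)
  have "hedges G' \<subseteq> hedges G" using G' by (simp add: copies_def)
  then have "\<forall>e\<in>hedges F. f ` e \<in> hedges G" unfolding f(2) by (simp add: image_subset_iff)
  then show ?thesis using bij_betw_imp_inj_on[OF f(1)] by (intro exI[of _ f] conjI)
qed

text \<open>Expansion does not raise the degree of an old vertex, and a new vertex lies in a single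
  hyperedge.\<close>

lemma expansion_degree_le:
  assumes "\<And>v. finite {e\<in>hedges F. v \<in> e} \<and> card {e\<in>hedges F. v \<in> e} \<le> 2"
  shows "card {h\<in>hedges (expansion r F). x \<in> h} \<le> 2"
proof (cases x)
  case (Inl v)
  let ?h = "\<lambda>e. Inl ` e \<union> Inr ` ({e} \<times> {..<r - 2})"
  have "{h\<in>hedges (expansion r F). x \<in> h} \<subseteq> ?h ` {e\<in>hedges F. v \<in> e}" by (auto simp: expansion_def Inl)
  then have "card {h\<in>hedges (expansion r F). x \<in> h} \<le> card (?h ` {e\<in>hedges F. v \<in> e})"
    using assms[of v] by (intro card_mono) auto
  also have "\<dots> \<le> card {e\<in>hedges F. v \<in> e}" using assms[of v] by (intro card_image_le) simp
  finally show ?thesis using assms[of v] by simp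
next
  case (Inr p)
  obtain e j where p: "p = (e, j)" by (cases p)
  have "{h\<in>hedges (expansion r F). x \<in> h} \<subseteq> {Inl ` e \<union> Inr ` ({e} \<times> {..<r - 2})}" by (auto simp: expansion_def Inr p)
  then have "card {h\<in>hedges (expansion r F). x \<in> h} \<le> card {Inl ` e \<union> Inr ` ({e} \<times> {..<r - 2})}"
    by (intro card_mono) auto
  then show ?thesis by simp
qed

lemma expansion_edge_subset:
  assumes "\<And>e. e \<in> hedges F \<Longrightarrow> e \<subseteq> hverts F" "h \<in> hedges (expansion r F)"
  shows "h \<subseteq> hverts (expansion r F)"
proof -
  obtain e where "e \<in> hedges F" "h = Inl ` e \<union> Inr ` ({e} \<times> {..<r - 2})"
    using assms(2) by (auto simp: expansion_def)
  moreover then have "e \<subseteq> hverts F" by (intro assms(1))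
  ultimately show ?thesis by (simp add: expansion_def) blast
qed

lemma card_expansion_edges: "card (hedges (expansion r F)) = card (hedges F)"
proof -
  have "inj_on (\<lambda>e. Inl ` e \<union> Inr ` ({e} \<times> {..<r - 2})) (hedges F)"
  proof (rule inj_onI)
    fix e d :: "'a set" assume eq: "Inl ` e \<union> Inr ` ({e} \<times> {..<r - 2}) = Inl ` d \<union> Inr ` ({d} \<times> {..<r - 2})"
    have "x \<in> e \<longleftrightarrow> x \<in> d" for x
    proof -
      have "x \<in> e \<longleftrightarrow> Inl x \<in> Inl ` e \<union> Inr ` ({e} \<times> {..<r - 2})" by auto
      also have "\<dots> \<longleftrightarrow> Inl x \<in> Inl ` d \<union> Inr ` ({d} \<times> {..<r - 2})" unfolding eq ..
      also have "\<dots> \<longleftrightarrow> x \<in> d" by auto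
      finally show ?thesis .
    qed
    then show "e = d" by blast
  qed
  then show ?thesis by (simp add: expansion_def card_image)
qed

lemma path_graph_degree: "finite {e\<in>hedges (path_graph l). v \<in> e} \<and> card {e\<in>hedges (path_graph l). v \<in> e} \<le> 2"
proof -
  have "{e\<in>hedges (path_graph l). v \<in> e} \<subseteq> {{v, v + 1}, {v - 1, v}}" by (auto simp: path_graph_def)
  moreover have "card {{v, v + 1}, {v - 1, v}} \<le> 2" by (simp add: card_insert_if)
  ultimately show ?thesis by (meson card_mono finite.emptyI finite.insertI finite_subset order_trans)
qed

lemma cycle_graph_degree: "finite {e\<in>hedges (cycle_graph l). v \<in> e} \<and> card {e\<in>hedges (cycle_graph l). v \<in> e} \<le> 2"
proof -
  let ?p = "if v = 0 then l - 1 else v - 1"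
  have "{e\<in>hedges (cycle_graph l). v \<in> e} \<subseteq> {{v, (v + 1) mod l}, {?p, v}}"
  proof
    fix e assume "e \<in> {e\<in>hedges (cycle_graph l). v \<in> e}"
    then obtain i where i: "i < l" "e = {i, (i + 1) mod l}" "v \<in> e" by (auto simp: cycle_graph_def)
    show "e \<in> {{v, (v + 1) mod l}, {?p, v}}"
    proof (cases "v = i")
      case False
      then have v: "v = (i + 1) mod l" using i by auto
      then have "i = ?p" using i(1) by (cases "i + 1 = l") auto
      then show ?thesis using i(2) v by auto
    qed (use i in auto)
  qed
  moreover have "card {{v, (v + 1) mod l}, {?p, v}} \<le> 2" by (simp add: card_insert_if)
  ultimately show ?thesis by (meson card_mono finite.emptyI finite.insertI finite_subset order_trans)
qed

lemma card_path_graph_edges: "card (hedges (path_graph l)) = l"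
proof -
  have "inj_on (\<lambda>i. {i, i + 1 :: nat}) {..<l}" by (auto simp: inj_on_def doubleton_eq_iff)
  moreover have "hedges (path_graph l) = (\<lambda>i. {i, i + 1}) ` {..<l}" by (auto simp: path_graph_def)
  ultimately show ?thesis by (simp add: card_image)
qed

lemma card_cycle_graph_edges: "3 \<le> l \<Longrightarrow> card (hedges (cycle_graph l)) = l"
proof -
  assume "3 \<le> l"
  then have "inj_on (\<lambda>i. {i, (i + 1) mod l}) {..<l}" by (rule cycle_graph_edge_inj)
  moreover have "hedges (cycle_graph l) = (\<lambda>i. {i, (i + 1) mod l}) ` {..<l}" by (auto simp: cycle_graph_def)
  ultimately show ?thesis by (simp add: card_image)
qed

lemma star_r_graph: "r_graph r (star_r_graph r n t)" "hverts (star_r_graph r n t) = {..<n}"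
  by (auto simp: r_graph_def star_r_graph_def)

text \<open>Every vertex lies in at most two hyperedges of a component, so covering the \<open>l i\<close> hyperedges
  takes at least \<open>(l i + 1) div 2\<close> vertices.\<close>

lemma (in path_cycle_components) star_free:
  "copies (disjoint_union I Q) (star_r_graph r n t) = {}"
proof (rule ccontr)
  assume "copies (disjoint_union I Q) (star_r_graph r n t) \<noteq> {}"
  then obtain g where g: "inj_on g (hverts (disjoint_union I Q))"
    "\<forall>e\<in>hedges (disjoint_union I Q). g ` e \<in> hedges (star_r_graph r n t)" using copies_embedding by blast
  \<comment> \<open>The vertices of component \<open>i\<close> that land among the \<open>t\<close>
    distinguished vertices; every hyperedge of the component contains one.\<close>
  define X where "X i = {x\<in>hverts (Q i). g (i, x) < t}" for i
  have inj: "inj_on g (SIGMA i:I. X i)" by (rule inj_on_subset[OF g(1)]) (auto simp: disjoint_union_def X_def)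
  have im: "g ` (SIGMA i:I. X i) \<subseteq> {..<t}" by (auto simp: X_def)
  have finS: "finite (SIGMA i:I. X i)" using finite_subset[OF im] finite_imageD[OF _ inj] by simp
  have Xfin: "finite (X i)" if "i \<in> I" for i
  proof -
    have "X i = Pair i -` (SIGMA i:I. X i)" using that by auto
    then show ?thesis using finite_vimageI[OF finS, of "Pair i"] by (simp add: inj_on_def)
  qed
  have "(\<Sum>i\<in>I. card (X i)) = card (SIGMA i:I. X i)" using I(1) Xfin by (simp add: card_SigmaI)
  also have "\<dots> \<le> card {..<t}" by (rule card_inj_on_le[OF inj im]) simp
  finally have le: "(\<Sum>i\<in>I. card (X i)) \<le> t" by simp
  have "(l i + 1) div 2 \<le> card (X i)" if i: "i \<in> I" for i
  proof -
    have l3: "3 \<le> l i" using l[OF i] by simp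
    have deg: "card {h\<in>hedges (Q i). x \<in> h} \<le> 2" for x
      using Q[OF i] expansion_degree_le[OF path_graph_degree, of r "l i" x] expansion_degree_le[OF cycle_graph_degree, of r "l i" x]
      by (elim insertE emptyE) simp_all
    have cnt: "card (hedges (Q i)) = l i"
      using Q[OF i] card_expansion_edges[of r "path_graph (l i)"] card_expansion_edges[of r "cycle_graph (l i)"]
        card_path_graph_edges[of "l i"] card_cycle_graph_edges[OF l3] by (elim insertE emptyE) simp_all
    have "finite (hedges (Q i))" using cnt l3 by (intro card_ge_0_finite) simp
    have "hedges (Q i) \<subseteq> (\<Union>x\<in>X i. {h\<in>hedges (Q i). x \<in> h})"
    proof
      fix h assume h: "h \<in> hedges (Q i)"
      then have "Pair i ` h \<in> hedges (disjoint_union I Q)" using i by (auto simp: disjoint_union_def)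
      then have "g ` Pair i ` h \<in> hedges (star_r_graph r n t)" using g(2) by blast
      then obtain x where x: "x \<in> h" "g (i, x) < t" by (auto simp: star_r_graph_def)
      have "h \<subseteq> hverts (Q i)"
      proof -
        have "e \<subseteq> hverts (path_graph (l i))" if "e \<in> hedges (path_graph (l i))" for e
          using that by (auto simp: path_graph_def)
        moreover have "e \<subseteq> hverts (cycle_graph (l i))" if "e \<in> hedges (cycle_graph (l i))" for e
          using that by (auto simp: cycle_graph_def)
        ultimately have "h \<in> hedges (expansion r (path_graph (l i))) \<Longrightarrow> h \<subseteq> hverts (expansion r (path_graph (l i)))"
          "h \<in> hedges (expansion r (cycle_graph (l i))) \<Longrightarrow> h \<subseteq> hverts (expansion r (cycle_graph (l i)))"
          using expansion_edge_subset[of "path_graph (l i)" h r] expansion_edge_subset[of "cycle_graph (l i)" h r]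
          by presburger+
        then show ?thesis using Q[OF i] h by (elim insertE emptyE) simp_all
      qed
      then have "x \<in> X i" using x by (auto simp: X_def)
      then show "h \<in> (\<Union>x\<in>X i. {h\<in>hedges (Q i). x \<in> h})" using x h by auto
    qed
    then have "card (hedges (Q i)) \<le> card (\<Union>x\<in>X i. {h\<in>hedges (Q i). x \<in> h})"
      using Xfin[OF i] \<open>finite (hedges (Q i))\<close> by (intro card_mono) auto
    also have "\<dots> \<le> card (X i) * 2" by (intro card_UN_le_mult Xfin[OF i] deg)
    finally show ?thesis using cnt by linarith
  qed
  then have "(\<Sum>i\<in>I. (l i + 1) div 2) \<le> (\<Sum>i\<in>I. card (X i))" by (intro sum_mono)
  then show False using sum_t le by simp
qed

text \<open>Any s - r + 1 distinguished and r - 1 other vertices form a clique, since an r-subset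
  cannot avoid the distinguished ones. These cliques alone give the main term.\<close>

lemma star_cliques_lower_bound:
  assumes "1 \<le> r" "r \<le> s" "t \<le> n"
  shows "(t choose (s - r + 1)) * ((n - t) choose (r - 1)) \<le> card (cliques r (hedges (star_r_graph r n t)) s)"
proof -
  let ?q = "s - r + 1"
  let ?A = "{A. A \<subseteq> {..<t} \<and> card A = ?q}" and ?B = "{B. B \<subseteq> {t..<n} \<and> card B = r - 1}"
  have "(t choose ?q) * ((n - t) choose (r - 1)) = card (?A \<times> ?B)"
    using n_subsets[of "{..<t}" ?q] n_subsets[of "{t..<n}" "r - 1"] by (simp add: card_cartesian_product)
  also have "\<dots> \<le> card (cliques r (hedges (star_r_graph r n t)) s)"
  proof (rule card_inj_on_le[where f = "\<lambda>(A, B). A \<union> B"])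
    have dis: "a = a' \<and> b = b'" if "a \<subseteq> {..<t}" "a' \<subseteq> {..<t}" "b \<subseteq> {t..<n}" "b' \<subseteq> {t..<n}" "a \<union> b = a' \<union> b'" for a a' b b'
    proof -
      have "a = (a \<union> b) \<inter> {..<t}" "a' = (a' \<union> b') \<inter> {..<t}" "b = (a \<union> b) \<inter> {t..<n}" "b' = (a' \<union> b') \<inter> {t..<n}"
        using that(1-4) by auto
      then show ?thesis using that(5) by metis
    qed
    show "inj_on (\<lambda>(A, B). A \<union> B) (?A \<times> ?B)"
    proof (rule inj_onI, clarify)
      fix a b a' b'
      assume "a \<subseteq> {..<t}" "b \<subseteq> {t..<n}" "a' \<subseteq> {..<t}" "b' \<subseteq> {t..<n}" "a \<union> b = a' \<union> b'"
      then show "a = a' \<and> b = b'" using dis by blast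
    qed
    show "(\<lambda>(A, B). A \<union> B) ` (?A \<times> ?B) \<subseteq> cliques r (hedges (star_r_graph r n t)) s"
    proof clarify
      fix a b assume ab: "a \<subseteq> {..<t}" "card a = ?q" "b \<subseteq> {t..<n}" "card b = r - 1"
      have fin: "finite a" "finite b" using ab(1,3) finite_subset by auto
      have "a \<inter> b = {}" using ab(1,3) by fastforce
      then have "card (a \<union> b) = s" using fin ab(2,4) assms by (simp add: card_Un_disjoint)
      moreover have "e \<in> hedges (star_r_graph r n t)" if e: "e \<subseteq> a \<union> b" "card e = r" for e
      proof -
        have "e \<inter> {..<t} \<noteq> {}"
        proof
          assume "e \<inter> {..<t} = {}"
          then have "e \<subseteq> b" using e(1) ab(1) by blast
          then have "card e \<le> r - 1" using card_mono[OF fin(2)] ab(4) by metis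
          then show False using e(2) assms(1) by simp
        qed
        moreover have "e \<subseteq> {..<n}" using e(1) ab(1,3) assms(3) by fastforce
        ultimately show ?thesis using e(2) by (simp add: star_r_graph_def)
      qed
      ultimately show "a \<union> b \<in> cliques r (hedges (star_r_graph r n t)) s" by (simp add: cliques_def)
    qed
    have "uniform r (hedges (star_r_graph r n t))" using r_graph_uniform[OF star_r_graph(1) assms(1)] by blast
    then show "finite (cliques r (hedges (star_r_graph r n t)) s)" using finite_cliques(1) assms by blast
  qed
  finally show ?thesis .
qed

section \<open>Binomial asymptotics and the limits\<close>

text \<open>Every factor of the falling factorial \<open>n * (n - 1) * ... * (n - k + 1)\<close> is
  at least \<open>n - k\<close>.\<close>

lemma power_le_binomial: "k \<le> n \<Longrightarrow> (n - k) ^ k \<le> (n choose k) * fact k"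
proof -
  assume "k \<le> n"
  have "(n - k) ^ j \<le> (n choose j) * fact j" if "j \<le> k" for j
    using that
  proof (induction j)
    case (Suc j)
    have "(n choose Suc j) * fact (Suc j) = (Suc j * (n choose Suc j)) * fact j" by (simp add: algebra_simps)
    also have "Suc j * (n choose Suc j) = (n - j) * (n choose j)" by (simp only: binomial_absorption binomial_absorb_comp)
    finally have "(n choose Suc j) * fact (Suc j) = (n - j) * ((n choose j) * fact j)" by simp
    moreover have "(n - k) * (n - k) ^ j \<le> (n - j) * ((n choose j) * fact j)"
      using Suc by (intro mult_mono) auto
    ultimately show ?case by simp
  qed simp
  then show ?thesis by simp
qed

lemma binomial_div_power_tendsto: "(\<lambda>n. real ((n - c) choose k) / real n ^ k) \<longlonglongrightarrow> 1 / fact k"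
proof (rule tendsto_sandwich)
  have "(\<lambda>n. 1 - real (c + k) / real n) \<longlonglongrightarrow> 1 - 0"
    by (intro tendsto_diff tendsto_const lim_const_over_n)
  then have "(\<lambda>n. (1 - real (c + k) / real n) ^ k * (1 / fact k)) \<longlonglongrightarrow> (1 - 0) ^ k * (1 / fact k)"
    by (intro tendsto_mult tendsto_power tendsto_const)
  then show "(\<lambda>n. (1 - real (c + k) / real n) ^ k * (1 / fact k)) \<longlonglongrightarrow> 1 / fact k" by simp
  show "(\<lambda>n. 1 / fact k :: real) \<longlonglongrightarrow> 1 / fact k" by simp
  show "\<forall>\<^sub>F n in sequentially. (1 - real (c + k) / real n) ^ k * (1 / fact k) \<le> real ((n - c) choose k) / real n ^ k"
  proof (rule eventually_sequentiallyI[of "c + k + 1"])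
    fix n assume n: "c + k + 1 \<le> n"
    then have "k \<le> n - c" by simp
    then have "real ((n - c - k) ^ k) \<le> real (((n - c) choose k) * fact k)" using power_le_binomial by (simp only: of_nat_le_iff)
    moreover have "real (n - c - k) = real n - real (c + k)" using n by simp
    ultimately have le: "(real n - real (c + k)) ^ k \<le> real ((n - c) choose k) * fact k" by simp
    have "(1 - real (c + k) / real n) ^ k = (real n - real (c + k)) ^ k / real n ^ k"
      using n by (simp add: power_divide[symmetric] diff_divide_distrib)
    also have "\<dots> * (1 / fact k) \<le> (real ((n - c) choose k) * fact k) / real n ^ k * (1 / fact k)"
      by (intro mult_right_mono divide_right_mono le) auto
    also have "\<dots> = real ((n - c) choose k) / real n ^ k" by simp
    finally show "(1 - real (c + k) / real n) ^ k * (1 / fact k) \<le> real ((n - c) choose k) / real n ^ k" .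
  qed
  show "\<forall>\<^sub>F n in sequentially. real ((n - c) choose k) / real n ^ k \<le> 1 / fact k"
  proof (rule eventually_sequentiallyI[of 1])
    fix n :: nat assume n: "1 \<le> n"
    have "((n - c) choose k) * fact k \<le> (n - c) ^ k" by (rule binomial_fact_pow)
    also have "\<dots> \<le> n ^ k" by (intro power_mono) auto
    finally have "real (((n - c) choose k) * fact k) \<le> real (n ^ k)" by (simp only: of_nat_le_iff)
    then show "real ((n - c) choose k) / real n ^ k \<le> 1 / fact k" using n by (simp add: field_simps)
  qed
qed

lemma tendsto_smallo_power:
  assumes "(\<lambda>n. f n / real n ^ k) \<longlonglongrightarrow> c"
  shows "(\<lambda>n. f n - c * real n ^ k) \<in> o[at_top](\<lambda>n. real n ^ k)"
proof (rule smalloI_tendsto)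
  have "(\<lambda>n. f n / real n ^ k - c) \<longlonglongrightarrow> c - c" by (intro tendsto_diff assms tendsto_const)
  moreover have "\<forall>\<^sub>F n in at_top. f n / real n ^ k - c = (f n - c * real n ^ k) / real n ^ k"
    by (rule eventually_sequentiallyI[of 1]) (simp add: field_simps)
  ultimately show "((\<lambda>n. (f n - c * real n ^ k) / real n ^ k) \<longlongrightarrow> 0) at_top"
    by (simp add: tendsto_cong)
  show "\<forall>\<^sub>F n in at_top. real n ^ k \<noteq> 0" by (rule eventually_sequentiallyI[of 1]) simp
qed

text \<open>\<open>Max\<close> is informative only on a finite nonempty set: the counts are bounded
  by \<open>n choose s\<close>, and the star contributes a member.\<close>

lemma (in path_cycle_components) ex_copies_bounds:
  fixes s :: nat
  assumes s: "r \<le> s"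
  defines "F \<equiv> disjoint_union I Q"
  shows "num_copies (complete_r_graph r s) (star_r_graph r n t) \<le> ex_copies r n (complete_r_graph r s) F"
    and "\<exists>G :: nat hypergraph. r_graph r G \<and> card (hverts G) = n \<and> copies F G = {} \<and>
      ex_copies r n (complete_r_graph r s) F = num_copies (complete_r_graph r s) G"
proof -
  let ?M = "{num_copies (complete_r_graph r s) G | G :: nat hypergraph.
            r_graph r G \<and> card (hverts G) = n \<and> copies F G = {}}"
  have r1: "1 \<le> r" using r by simp
  have "num_copies (complete_r_graph r s) G \<le> n choose s" if G: "r_graph r G" "card (hverts G) = n" for G :: "nat hypergraph"
  proof -
    have fin: "finite (hverts G)" using G(1) by (simp add: r_graph_def)
    have "cliques r (hedges G) s \<subseteq> {S. S \<subseteq> hverts G \<and> card S = s}"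
      using clique_subset_verts(1)[OF G(1) r1 s] by (auto simp: cliques_def)
    then have "card (cliques r (hedges G) s) \<le> card {S. S \<subseteq> hverts G \<and> card S = s}" using fin by (intro card_mono) auto
    then show ?thesis using num_copies_complete[OF G(1) r1 s] n_subsets[OF fin, of s] G(2) by simp
  qed
  then have "?M \<subseteq> {..n choose s}" by auto
  then have fin: "finite ?M" by (rule finite_subset) simp
  have star: "num_copies (complete_r_graph r s) (star_r_graph r n t) \<in> ?M"
    using star_r_graph[of r n t] star_free[of n] unfolding F_def by (intro CollectI exI[of _ "star_r_graph r n t"]) auto
  show "num_copies (complete_r_graph r s) (star_r_graph r n t) \<le> ex_copies r n (complete_r_graph r s) F"
    unfolding ex_copies_def by (rule Max_ge[OF fin star])
  have "ex_copies r n (complete_r_graph r s) F \<in> ?M" unfolding ex_copies_def using fin star by (intro Max_in) auto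
  then show "\<exists>G :: nat hypergraph. r_graph r G \<and> card (hverts G) = n \<and> copies F G = {} \<and>
      ex_copies r n (complete_r_graph r s) F = num_copies (complete_r_graph r s) G" by blast
qed

text \<open>Star and extremal number are squeezed together between
  \<open>star_cliques_lower_bound\<close> and \<open>cliques_upper_bound\<close> with arbitrary
  \<epsilon>. The value c = 0 is included and is the case s \<ge> t + r.\<close>

lemma (in path_cycle_components) ex_copies_limit:
  assumes s: "r \<le> s"
  defines "ex \<equiv> \<lambda>n. real (ex_copies r n (complete_r_graph r s) (disjoint_union I Q))"
    and "st \<equiv> \<lambda>n. real (num_copies (complete_r_graph r s) (star_r_graph r n t))"
    and "c \<equiv> real (t choose (s - r + 1)) / fact (r - 1)"
  shows "(\<lambda>n. st n / real n ^ (r - 1)) \<longlonglongrightarrow> c" and "(\<lambda>n. ex n / real n ^ (r - 1)) \<longlonglongrightarrow> c"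
proof -
  have r1: "1 \<le> r" using r by simp
  define b where "b = real (t choose (s - r + 1))"
  have b0: "0 \<le> b" by (simp add: b_def)
  define lo where "lo n = b * (real ((n - t) choose (r - 1)) / real n ^ (r - 1))" for n
  have lo: "lo \<longlonglongrightarrow> c"
  proof -
    have "lo \<longlonglongrightarrow> b * (1 / fact (r - 1))" unfolding lo_def
      by (intro tendsto_mult tendsto_const binomial_div_power_tendsto)
    then show ?thesis by (simp add: c_def b_def)
  qed
  have st_le: "st n \<le> ex n" for n unfolding st_def ex_def using ex_copies_bounds(1)[OF s, of n] by simp
  have lo_st: "lo n \<le> st n / real n ^ (r - 1)" if "t \<le> n" for n
  proof -
    have "(t choose (s - r + 1)) * ((n - t) choose (r - 1)) \<le> num_copies (complete_r_graph r s) (star_r_graph r n t)"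
      using star_cliques_lower_bound[OF r1 s that] num_copies_complete[OF star_r_graph(1) r1 s, of n t] by simp
    then have "real ((t choose (s - r + 1)) * ((n - t) choose (r - 1))) \<le> st n" unfolding st_def of_nat_le_iff .
    then show ?thesis unfolding lo_def b_def by (simp add: divide_right_mono)
  qed
  have up: "\<forall>\<^sub>F n in sequentially. ex n / real n ^ (r - 1) < a" if a: "c < a" for a
  proof -
    define \<epsilon> where "\<epsilon> = (a - c) / 2"
    have \<epsilon>: "0 < \<epsilon>" using a by (simp add: \<epsilon>_def)
    obtain n0 where n0: "\<forall>(V::nat set) H. finite V \<longrightarrow> n0 \<le> card V \<longrightarrow> uniform r H \<longrightarrow> \<Union>H \<subseteq> V \<longrightarrow> \<not> occurs H \<longrightarrow>
      real (card (cliques r H s)) \<le> real (t choose (s - r + 1)) * real (card V choose (r - 1)) + \<epsilon> * real (card V) ^ (r - 1)"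
      using cliques_upper_bound[OF \<epsilon> s, where 'a = nat] by (elim exE)
    have "(\<lambda>n. b * (real (n choose (r - 1)) / real n ^ (r - 1)) + \<epsilon>) \<longlonglongrightarrow> b * (1 / fact (r - 1)) + \<epsilon>"
      using binomial_div_power_tendsto[of 0 "r - 1"] by (intro tendsto_add tendsto_mult tendsto_const) simp
    moreover have "b * (1 / fact (r - 1)) + \<epsilon> < a" using a by (simp add: c_def b_def \<epsilon>_def field_simps)
    ultimately have ev: "\<forall>\<^sub>F n in sequentially. b * (real (n choose (r - 1)) / real n ^ (r - 1)) + \<epsilon> < a"
      by (rule order_tendstoD(2))
    have "\<forall>\<^sub>F n in sequentially. ex n / real n ^ (r - 1) \<le> b * (real (n choose (r - 1)) / real n ^ (r - 1)) + \<epsilon>"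
    proof (rule eventually_sequentiallyI[of "n0 + 1"])
      fix n assume n: "n0 + 1 \<le> n"
      obtain G :: "nat hypergraph" where G: "r_graph r G" "card (hverts G) = n" "copies (disjoint_union I Q) G = {}"
        "ex n = real (num_copies (complete_r_graph r s) G)"
        using ex_copies_bounds(2)[OF s, of n] unfolding ex_def by (elim exE conjE) simp
      have no: "\<not> occurs (hedges G)" using occurs_copies G(1,3) by blast
      have u: "uniform r (hedges G)" "\<Union>(hedges G) \<subseteq> hverts G" "finite (hverts G)"
        using r_graph_uniform[OF G(1) r1] G(1) by (auto simp: r_graph_def)
      have "n0 \<le> card (hverts G)" using n G(2) by simp
      from n0[rule_format, OF u(3) this u(1,2) no]
      have "ex n \<le> b * real (n choose (r - 1)) + \<epsilon> * real n ^ (r - 1)"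
        unfolding G(4) num_copies_complete[OF G(1) r1 s] G(2) b_def .
      then have "ex n / real n ^ (r - 1) \<le> (b * real (n choose (r - 1)) + \<epsilon> * real n ^ (r - 1)) / real n ^ (r - 1)"
        by (rule divide_right_mono) simp
      then show "ex n / real n ^ (r - 1) \<le> b * (real (n choose (r - 1)) / real n ^ (r - 1)) + \<epsilon>"
        using n by (simp add: add_divide_distrib)
    qed
    then show ?thesis using ev by eventually_elim simp
  qed
  have evt: "\<forall>\<^sub>F n in sequentially. t \<le> n" by (rule eventually_ge_at_top)
  have mono: "st n / real n ^ (r - 1) \<le> ex n / real n ^ (r - 1)" for n using st_le by (intro divide_right_mono) auto
  show "(\<lambda>n. st n / real n ^ (r - 1)) \<longlonglongrightarrow> c"
  proof (rule order_tendstoI)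
    fix a assume "a < c"
    then have "\<forall>\<^sub>F n in sequentially. a < lo n" by (rule order_tendstoD(1)[OF lo])
    then show "\<forall>\<^sub>F n in sequentially. a < st n / real n ^ (r - 1)"
      using evt
    proof eventually_elim
      case (elim n)
      then show ?case using lo_st[of n] by linarith
    qed
  next
    fix a assume "c < a"
    from up[OF this] show "\<forall>\<^sub>F n in sequentially. st n / real n ^ (r - 1) < a"
    proof eventually_elim
      case (elim n)
      then show ?case using mono[of n] by linarith
    qed
  qed
  show "(\<lambda>n. ex n / real n ^ (r - 1)) \<longlonglongrightarrow> c"
  proof (rule order_tendstoI)
    fix a assume "a < c"
    then have "\<forall>\<^sub>F n in sequentially. a < lo n" by (rule order_tendstoD(1)[OF lo])
    then show "\<forall>\<^sub>F n in sequentially. a < ex n / real n ^ (r - 1)"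
      using evt
    proof eventually_elim
      case (elim n)
      then show ?case using lo_st[of n] mono[of n] by linarith
    qed
  qed (rule up)
qed

theorem theorem6p1:
  fixes r k s t :: nat
    and l :: "nat \<Rightarrow> nat"
    and Q :: "nat \<Rightarrow> (nat + nat set \<times> nat) hypergraph"
  assumes "r \<ge> 3" and "k \<ge> 1" and "\<And>i. i \<in> {1..k} \<Longrightarrow> l i \<ge> 5" and "s \<ge> r"
    and "t = (\<Sum>i=1..k. (l i + 1) div 2) - 1"
    and "\<And>i. i \<in> {1..k} \<Longrightarrow>
           Q i \<in> {expansion r (path_graph (l i)), expansion r (cycle_graph (l i))}"
  shows
    "(s \<le> t + r - 1 \<longrightarrow>
        (\<lambda>n. real (ex_copies r n (complete_r_graph r s) (disjoint_union {1..k} Q)))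
          \<sim>[at_top] (\<lambda>n. real (num_copies (complete_r_graph r s) (star_r_graph r n t)))
      \<and> (\<lambda>n. real (num_copies (complete_r_graph r s) (star_r_graph r n t))
              - real (t choose (s - r + 1)) * (real n ^ (r - 1) / fact (r - 1)))
          \<in> o[at_top](\<lambda>n. real n ^ (r - 1))
      \<and> (\<lambda>n. real (ex_copies r n (complete_r_graph r s) (disjoint_union {1..k} Q))
              - real (t choose (s - r + 1)) * (real n ^ (r - 1) / fact (r - 1)))
          \<in> o[at_top](\<lambda>n. real n ^ (r - 1)))
   \<and> (s \<ge> t + r \<longrightarrow>
        (\<lambda>n. real (ex_copies r n (complete_r_graph r s) (disjoint_union {1..k} Q)))
          \<in> o[at_top](\<lambda>n. real n ^ (r - 1)))"
proof -
  define lm where "lm = Max (l ` {1..k})"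
  have lm: "l i \<le> lm" if "i \<in> {1..k}" for i unfolding lm_def using that by (intro Max_ge) auto
  \<comment> \<open>The sum is positive, so the truncated subtraction in the definition of
    \<open>t\<close> loses nothing.\<close>
  have "(\<Sum>i=1..k. (l i + 1) div 2) \<noteq> 0"
  proof -
    have "(l 1 + 1) div 2 \<le> (\<Sum>i=1..k. (l i + 1) div 2)" using assms(2) by (intro member_le_sum) auto
    moreover have "5 \<le> l 1" using assms(2,3) by simp
    ultimately show ?thesis by linarith
  qed
  then have sum: "(\<Sum>i=1..k. (l i + 1) div 2) = t + 1" using assms(5) by linarith
  interpret path_cycle_components r t lm "{1..k}" l Q
    by unfold_locales (use assms(1-3,6) lm sum in auto)
  define ex where "ex n = real (ex_copies r n (complete_r_graph r s) (disjoint_union {1..k} Q))" for n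
  define st where "st n = real (num_copies (complete_r_graph r s) (star_r_graph r n t))" for n
  define c where "c = real (t choose (s - r + 1)) / fact (r - 1)"
  have lim: "(\<lambda>n. st n / real n ^ (r - 1)) \<longlonglongrightarrow> c" "(\<lambda>n. ex n / real n ^ (r - 1)) \<longlonglongrightarrow> c"
    unfolding st_def ex_def c_def by (rule ex_copies_limit[OF assms(4)])+
  have eq: "c * real n ^ (r - 1) = real (t choose (s - r + 1)) * (real n ^ (r - 1) / fact (r - 1))" for n
    by (simp add: c_def)
  have o: "(\<lambda>n. st n - real (t choose (s - r + 1)) * (real n ^ (r - 1) / fact (r - 1))) \<in> o[at_top](\<lambda>n. real n ^ (r - 1))"
      "(\<lambda>n. ex n - real (t choose (s - r + 1)) * (real n ^ (r - 1) / fact (r - 1))) \<in> o[at_top](\<lambda>n. real n ^ (r - 1))"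
    using tendsto_smallo_power[OF lim(1)] tendsto_smallo_power[OF lim(2)] unfolding eq by auto
  have "ex \<sim>[at_top] st" if "s \<le> t + r - 1"
  proof (rule asymp_equivI')
    \<comment> \<open>In this range the binomial coefficient is positive, so dividing the two limits
      is legitimate.\<close>
    have "s - r + 1 \<le> t" using that assms(1,4) by linarith
    then have "c \<noteq> 0" by (simp add: c_def)
    then have "(\<lambda>n. (ex n / real n ^ (r - 1)) / (st n / real n ^ (r - 1))) \<longlonglongrightarrow> c / c"
      by (intro tendsto_divide lim)
    then have lim1: "(\<lambda>n. (ex n / real n ^ (r - 1)) / (st n / real n ^ (r - 1))) \<longlonglongrightarrow> 1"
      using \<open>c \<noteq> 0\<close> by simp
    have ev: "\<forall>\<^sub>F n in sequentially. (ex n / real n ^ (r - 1)) / (st n / real n ^ (r - 1)) = ex n / st n"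
      by (rule eventually_sequentiallyI[of 1]) simp
    show "(\<lambda>n. ex n / st n) \<longlonglongrightarrow> 1" by (rule Lim_transform_eventually[OF lim1 ev])
  qed
  moreover have "ex \<in> o[at_top](\<lambda>n. real n ^ (r - 1))" if "s \<ge> t + r"
  proof -
    have "t < s - r + 1" using that by linarith
    then have "t choose (s - r + 1) = 0" by (rule binomial_eq_0)
    then have "real (t choose (s - r + 1)) * x = 0" for x by simp
    then show ?thesis using o(2) by (simp only: diff_zero)
  qed
  ultimately show ?thesis using o unfolding ex_def st_def by blast
qed

end
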